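(* In the clustered-data framework described in the context, suppose that $\widehat\theta_n^w\to\theta$ in probability, that $V_\theta$ is invertible, and that: (a) $\lim_{n\to\infty}\sum_{i=1}^n\Big(\frac{\sum_{j=1}^{m_i}w_{ij}}{N_n}\Big)=1$ and $\lim_{n\to\infty}\frac1{N_n}\sum_{i=1}^n\sum_{j=1}^{m_i}w_{ij}^2=c_w<\infty$; (b) $\lim_{n\to\infty}\frac1{N_n}\sum_{i=1}^n\sum_{j=1}^{m_i}\sum_{j'\ne j}w_{ij}w_{ij'}C_{\theta,i}=C_\theta^w$, where $C_{\theta,i}=\mathbb{E}_\theta\,\psi(X_{ij},\theta)\psi^{T}(X_{ij'},\theta)$ ($j\ne j'$); (c) $\mathbb{E}_\theta(\|\psi(X_{11},\theta)\|^{2+\eta})<\infty$ for some $\eta>0$ and $\lim_{n\to\infty}\frac1{N_n^{1+\eta/2}}\sum_{i=1}^n\big(\sum_{j=1}^{m_i}w_{ij}\big)^{2+\eta}=0$; (d) for some $\delta>0$, $\mathbb{E}_\theta(\|\dot\psi(X_{11},\theta)\|^{1+\delta})<\infty$, and there are $\lambda\in(0,1]$ and a measurable $k:\mathbb{R}^d\to[0,\infty)$ with $\|\dot\psi(x,a_2)-\dot\psi(x,a_1)\|\le k(x)\|a_2-a_1\|^\lambda$ for all $x\in\mathbb{R}^d$, $a_1,a_2\in\Theta$, $\mathbb{E}_\theta(k^{1+\delta}(X_{11}))<\infty$, and $\lim_{n\to\infty}\sum_{i=1}^n\Big(\frac{\sum_{j=1}^{m_i}w_{ij}}{N_n}\Big)^{1+\delta}=0$;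 (e) $\lim_{n\to\infty}\sum_{i=1}^n\Big(\frac{\sum_{j=1}^{m_i}w_{ij}^2}{N_n}\Big)^{1+\eta/2}=0$ and $\lim_{n\to\infty}\sum_{i=1}^n\Big(\frac{\sum_{j=1}^{m_i}\sum_{j'=1,\,j'\ne j}^{m_i}w_{ij}w_{ij'}}{N_n}\Big)^{1+\eta/2}=0$. Then: 1) If $\sup_{a\in\Theta}\mathbb{E}_\theta\|\psi(X_{11},a)\|^{2+\eta}<\infty$ and, for some $\lambda\in(0,1]$ and some measurable $k:\mathbb{R}^d\to[0,\infty)$ with $\mathbb{E}_\theta(k^{1+\eta/2}(X_{11}))<\infty$, $$\|\psi(x,a_2)\psi^T(x,a_2)-\psi(x,a_1)\psi^T(x,a_1)\|\le k(x)\|a_2-a_1\|^{\lambda}\quad(x\in\mathbb{R}^d,\ a_1,a_2\in\Theta),$$ then $\widehat B_n^w(\widehat\theta_n^w)\to c_wB_\theta$ in probability. 2) If $\sup_{a\in\Theta}\mathbb{E}_\theta\|\psi(X_{11},a)\|^{2+\eta}<\infty$ and, for some $\lambda\in(0,1]$ and some measurable $k:\mathbb{R}^d\times\mathbb{R}^d\to[0,\infty)$, $$\|\psi(x,a_2)\psi^T(y,a_2)-\psi(x,a_1)\psi^T(y,a_1)\|\le k(x,y)\|a_2-a_1\|^{\lambda}\quad(x,y\in\mathbb{R}^d,\ a_1,a_2\in\Theta),$$ with $\mathbb{E}_\theta(k^{1+\eta/2}(X_{i1},X_{i2}))<\infty$ for all $i$ (with $m_i\ge2$) and $$\lim_{n\to\infty}\frac1{N_n}\sum_{i=1}^n\sum_{j=1}^{m_i}\sum_{j'\ne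 j}w_{ij}w_{ij'}\mathbb{E}_\theta(k(X_{ij},X_{ij'}))=k_w<\infty,$$ then $\widehat C_n^w(\widehat\theta_n^w)\to C_\theta^w$ in probability. 3) If $\sup_{a\in\Theta}\mathbb{E}_\theta\|\dot\psi(X_{11},a)\|^{1+\delta}<\infty$, then $\widehat V_n(\widehat\theta_n^w)\to V_\theta$ in probability.
   Context: Framework. $X_1,X_2,\dots$ are independent clusters; cluster $X_i$ consists of $m_i\ge1$ random variables $X_{i1},\dots,X_{im_i}$ with values in $\mathbb{R}^d$. All $X_{ij}$ have the same distribution $\mathbb{P}_\theta$, with $\theta\in\Theta\subset\mathbb{R}^d$, where $\Theta$ is a convex bounded set with non-empty interior; $\mathbb{E}_\theta$ denotes the corresponding expectation. Within each cluster $i$, $(X_{i1},X_{i2})$ and $(X_{ik},X_{ik'})$ have the same distribution for all $k\ne k'$ in $\{1,\dots,m_i\}$ (variables of the same cluster may be dependent). $N_n:=\sum_{i=1}^n m_i$ and $\lim_{n\to\infty}N_n/n=\ell\in[1,\infty)$. $\rho:\mathbb{R}^d\times\mathbb{R}^d\to\mathbb{R}$ is such that $x\mapsto\rho(x,a)$ is measurable for every $a$, and $\theta=\arg\min_{a\in\Theta}\mathbb{E}_\theta(\rho(X_{11},a))$. For all $x$, $a\mapsto\rho(x,a)$ is twice differentiable on an open set containing $\Theta$; $\psi(x,a)=\big(\frac{\partial\rho}{\partial a_1},\dots,\frac{\partial\rho}{\partial a_d}\big)^T(x,a)$ is its gradient in $a$ and $\dot\psi(x,a)$ its Hessian in $a$;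 $\mathbb{E}_\theta(\psi(X_{11},\theta))=0$. The weights $w_{ij}$ are non-random positive numbers. The weighted M-estimator is $\widehat\theta_n^w=\arg\min_{a\in\Theta}\frac1{N_n}\sum_{i=1}^n\sum_{j=1}^{m_i}w_{ij}\rho(X_{ij},a)$, which satisfies $\sum_{i=1}^n\sum_{j=1}^{m_i}w_{ij}\psi(X_{ij},\widehat\theta_n^w)=0$. Notation: $B_\theta:=\mathbb{E}_\theta\,\psi(X_{11},\theta)\psi^{T}(X_{11},\theta)$, $V_\theta:=\mathbb{E}_\theta(\dot\psi(X_{11},\theta))$, and for $a\in\Theta$ $$\widehat B_n^w(a)=\frac1{N_n}\sum_{i=1}^n\sum_{j=1}^{m_i}w_{ij}^2\psi(X_{ij},a)\psi^T(X_{ij},a),$$ $$\widehat C_n^w(a)=\frac1{N_n}\sum_{i=1}^n\sum_{j=1}^{m_i}\sum_{j'\ne j}w_{ij}w_{ij'}\psi(X_{ij'},a)\psi^T(X_{ij},a),$$ $$\widehat V_n(a)=\frac1{N_n}\sum_{i=1}^n\sum_{j=1}^{m_i}w_{ij}\dot\psi^T(X_{ij},a).$$ Sums over $j'\ne j$ run over $j'\in\{1,\dots,m_i\}\setminus\{j\}$. Norms of matrices are a fixed matrix norm. *)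

theory Defs
  imports "HOL-Probability.Probability"
begin

definition grad :: "(real^'d \<Rightarrow> real) \<Rightarrow> real^'d \<Rightarrow> real^'d"
  where "grad f a = (\<chi> i. deriv (\<lambda>t. f (a + t *\<^sub>R axis i 1)) 0)"

definition hess :: "(real^'d \<Rightarrow> real) \<Rightarrow> real^'d \<Rightarrow> real^'d^'d"
  where "hess f a = (\<chi> i j. deriv (\<lambda>t. grad f (a + t *\<^sub>R axis j 1) $ i) 0)"

text \<open>In the Frechet sense, for open \<open>U\<close>: \<open>differentiable_on\<close> is relative to \<open>U\<close>, while \<open>grad\<close> and
  \<open>hess\<close> are built from two-sided partial derivatives.\<close>

definition twice_differentiable_on :: "(real^'d \<Rightarrow> real) \<Rightarrow> (real^'d) set \<Rightarrow> bool"
  where "twice_differentiable_on f U \<longleftrightarrow> f differentiable_on U \<and> grad f differentiable_on U"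

definition outer :: "real^'d \<Rightarrow> real^'d \<Rightarrow> real^'d^'d"
  where "outer u v = (\<chi> i j. u $ i * v $ j)"

text \<open>Any norm of the vector space of matrices; submultiplicativity is not required.\<close>

definition is_matrix_norm :: "(real^'d^'d \<Rightarrow> real) \<Rightarrow> bool"
  where "is_matrix_norm \<nu> \<longleftrightarrow>
    (\<forall>A. 0 \<le> \<nu> A) \<and> (\<forall>A. \<nu> A = 0 \<longleftrightarrow> A = 0) \<and>
    (\<forall>c A. \<nu> (c *\<^sub>R A) = \<bar>c\<bar> * \<nu> A) \<and> (\<forall>A B. \<nu> (A + B) \<le> \<nu> A + \<nu> B)"

text \<open>Sequences are indexed by \<open>n \<ge> 1\<close>; measurability of the terms is part of the notion.\<close>

definition tendsto_in_prob ::
    "'w measure \<Rightarrow> (nat \<Rightarrow> 'w \<Rightarrow> 'b::metric_space) \<Rightarrow> 'b \<Rightarrow> bool"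
  where "tendsto_in_prob M Y c \<longleftrightarrow>
    (\<forall>n\<ge>1. Y n \<in> borel_measurable M) \<and>
    (\<forall>\<epsilon>>0. (\<lambda>n. measure M {\<omega> \<in> space M. \<epsilon> < dist (Y n \<omega>) c}) \<longlonglongrightarrow> 0)"

text \<open>\<open>score \<rho> x a\<close> is \<open>\<psi>(x,a)\<close> and \<open>score_deriv \<rho> x a\<close> is its derivative, the Hessian of
  \<open>\<rho>(x,\<cdot>)\<close> at \<open>a\<close>.\<close>

definition score :: "(real^'d \<Rightarrow> real^'d \<Rightarrow> real) \<Rightarrow> real^'d \<Rightarrow> real^'d \<Rightarrow> real^'d"
  where "score \<rho> x a = grad (\<rho> x) a"

definition score_deriv :: "(real^'d \<Rightarrow> real^'d \<Rightarrow> real) \<Rightarrow> real^'d \<Rightarrow> real^'d \<Rightarrow> real^'d^'d"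
  where "score_deriv \<rho> x a = hess (\<rho> x) a"

text \<open>Clusters \<open>i\<close> and the members \<open>j\<close> of a cluster are numbered from 1; cluster \<open>i\<close> is
  \<open>X i 1, \<dots>, X i (m i)\<close>, and values of \<open>X\<close>, \<open>m\<close> and \<open>w\<close> outside these ranges are irrelevant.\<close>

definition sample_size :: "(nat \<Rightarrow> nat) \<Rightarrow> nat \<Rightarrow> real"
  where "sample_size m n = real (\<Sum>i=1..n. m i)"

text \<open>\<open>M\<close> carries the law of the whole data set under the true parameter \<open>\<theta>\<close>, so that
  \<open>expectation\<close> is the expectation under \<open>\<theta>\<close>.  The common law of the observations is
  that of \<open>X 1 1\<close>.  The open neighbourhood of \<open>\<Theta>\<close> on which \<open>\<rho> x\<close> is twice
  differentiable may depend on \<open>x\<close>.  Minimizers are not required to be unique.\<close>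

locale clustered_M_estimation = prob_space M for M :: "'w measure" +
  fixes m :: "nat \<Rightarrow> nat"
    and X :: "nat \<Rightarrow> nat \<Rightarrow> 'w \<Rightarrow> real^'d"
    and l :: real
    and \<Theta> :: "(real^'d) set"
    and \<theta> :: "real^'d"
    and \<rho> :: "real^'d \<Rightarrow> real^'d \<Rightarrow> real"
    and w :: "nat \<Rightarrow> nat \<Rightarrow> real"
    and est :: "nat \<Rightarrow> 'w \<Rightarrow> real^'d"
  assumes cluster_size: "\<And>i. 1 \<le> i \<Longrightarrow> 1 \<le> m i"
    and random_variable_X: "\<And>i j. 1 \<le> i \<Longrightarrow> j \<in> {1..m i} \<Longrightarrow> X i j \<in> borel_measurable M"
    and indep_clusters:
      "indep_vars (\<lambda>i. Pi\<^sub>M {1..m i} (\<lambda>_. borel)) (\<lambda>i \<omega>. \<lambda>j\<in>{1..m i}. X i j \<omega>) {1..}"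
    and identically_distributed:
      "\<And>i j. 1 \<le> i \<Longrightarrow> j \<in> {1..m i} \<Longrightarrow> distr M borel (X i j) = distr M borel (X 1 1)"
    and pairs_identically_distributed:
      "\<And>i k k'. 1 \<le> i \<Longrightarrow> k \<in> {1..m i} \<Longrightarrow> k' \<in> {1..m i} \<Longrightarrow> k \<noteq> k' \<Longrightarrow>
        distr M (borel \<Otimes>\<^sub>M borel) (\<lambda>\<omega>. (X i 1 \<omega>, X i 2 \<omega>)) =
        distr M (borel \<Otimes>\<^sub>M borel) (\<lambda>\<omega>. (X i k \<omega>, X i k' \<omega>))"
    and mean_cluster_size: "(\<lambda>n. sample_size m n / real n) \<longlonglongrightarrow> l" "1 \<le> l"
    and parameter_set: "convex \<Theta>" "bounded \<Theta>" "interior \<Theta> \<noteq> {}"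
    and loss_measurable: "\<And>a. (\<lambda>x. \<rho> x a) \<in> borel_measurable borel"
    and loss_integrable: "\<And>a. a \<in> \<Theta> \<Longrightarrow> integrable M (\<lambda>\<omega>. \<rho> (X 1 1 \<omega>) a)"
    and loss_twice_differentiable:
      "\<And>x. \<exists>U. open U \<and> \<Theta> \<subseteq> U \<and> twice_differentiable_on (\<rho> x) U"
    and parameter_arg_min:
      "is_arg_min (\<lambda>a. expectation (\<lambda>\<omega>. \<rho> (X 1 1 \<omega>) a)) (\<lambda>a. a \<in> \<Theta>) \<theta>"
    and score_integrable: "integrable M (\<lambda>\<omega>. score \<rho> (X 1 1 \<omega>) \<theta>)"
    and score_centered: "expectation (\<lambda>\<omega>. score \<rho> (X 1 1 \<omega>) \<theta>) = 0"
    and weights_pos: "\<And>i j. 1 \<le> i \<Longrightarrow> j \<in> {1..m i} \<Longrightarrow> 0 < w i j"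
    and estimator_arg_min:
      "\<And>n \<omega>. 1 \<le> n \<Longrightarrow> \<omega> \<in> space M \<Longrightarrow>
        is_arg_min (\<lambda>a. 1 / sample_size m n * (\<Sum>i=1..n. \<Sum>j=1..m i. w i j * \<rho> (X i j \<omega>) a))
          (\<lambda>a. a \<in> \<Theta>) (est n \<omega>)"
    and estimating_equation:
      "\<And>n \<omega>. 1 \<le> n \<Longrightarrow> \<omega> \<in> space M \<Longrightarrow>
        (\<Sum>i=1..n. \<Sum>j=1..m i. w i j *\<^sub>R score \<rho> (X i j \<omega>) (est n \<omega>)) = 0"

definition score_cov ::
    "'w measure \<Rightarrow> (nat \<Rightarrow> nat \<Rightarrow> 'w \<Rightarrow> real^'d) \<Rightarrow> (real^'d \<Rightarrow> real^'d \<Rightarrow> real) \<Rightarrow> real^'d \<Rightarrow> real^'d^'d"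
  where "score_cov M X \<rho> \<theta> =
    (\<integral>\<omega>. outer (score \<rho> (X 1 1 \<omega>) \<theta>) (score \<rho> (X 1 1 \<omega>) \<theta>) \<partial>M)"

definition mean_score_deriv ::
    "'w measure \<Rightarrow> (nat \<Rightarrow> nat \<Rightarrow> 'w \<Rightarrow> real^'d) \<Rightarrow> (real^'d \<Rightarrow> real^'d \<Rightarrow> real) \<Rightarrow> real^'d \<Rightarrow> real^'d^'d"
  where "mean_score_deriv M X \<rho> \<theta> = (\<integral>\<omega>. score_deriv \<rho> (X 1 1 \<omega>) \<theta> \<partial>M)"

text \<open>By the exchangeability of pairs the cross-covariance within cluster \<open>i\<close> is the same for
  all pairs of distinct members; it is meaningful only if \<open>m i \<ge> 2\<close>.\<close>

definition score_crosscov ::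
    "'w measure \<Rightarrow> (nat \<Rightarrow> nat \<Rightarrow> 'w \<Rightarrow> real^'d) \<Rightarrow> (real^'d \<Rightarrow> real^'d \<Rightarrow> real) \<Rightarrow> real^'d \<Rightarrow> nat \<Rightarrow> real^'d^'d"
  where "score_crosscov M X \<rho> \<theta> i =
    (\<integral>\<omega>. outer (score \<rho> (X i 1 \<omega>) \<theta>) (score \<rho> (X i 2 \<omega>) \<theta>) \<partial>M)"

definition B_hat ::
    "(nat \<Rightarrow> nat) \<Rightarrow> (nat \<Rightarrow> nat \<Rightarrow> 'w \<Rightarrow> real^'d) \<Rightarrow> (real^'d \<Rightarrow> real^'d \<Rightarrow> real) \<Rightarrow>
     (nat \<Rightarrow> nat \<Rightarrow> real) \<Rightarrow> nat \<Rightarrow> real^'d \<Rightarrow> 'w \<Rightarrow> real^'d^'d"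
  where "B_hat m X \<rho> w n a \<omega> =
    (1 / sample_size m n) *\<^sub>R
      (\<Sum>i=1..n. \<Sum>j=1..m i. (w i j)\<^sup>2 *\<^sub>R outer (score \<rho> (X i j \<omega>) a) (score \<rho> (X i j \<omega>) a))"

definition C_hat ::
    "(nat \<Rightarrow> nat) \<Rightarrow> (nat \<Rightarrow> nat \<Rightarrow> 'w \<Rightarrow> real^'d) \<Rightarrow> (real^'d \<Rightarrow> real^'d \<Rightarrow> real) \<Rightarrow>
     (nat \<Rightarrow> nat \<Rightarrow> real) \<Rightarrow> nat \<Rightarrow> real^'d \<Rightarrow> 'w \<Rightarrow> real^'d^'d"
  where "C_hat m X \<rho> w n a \<omega> =
    (1 / sample_size m n) *\<^sub>R
      (\<Sum>i=1..n. \<Sum>j=1..m i. \<Sum>j'\<in>{1..m i} - {j}.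
        (w i j * w i j') *\<^sub>R outer (score \<rho> (X i j' \<omega>) a) (score \<rho> (X i j \<omega>) a))"

definition V_hat ::
    "(nat \<Rightarrow> nat) \<Rightarrow> (nat \<Rightarrow> nat \<Rightarrow> 'w \<Rightarrow> real^'d) \<Rightarrow> (real^'d \<Rightarrow> real^'d \<Rightarrow> real) \<Rightarrow>
     (nat \<Rightarrow> nat \<Rightarrow> real) \<Rightarrow> nat \<Rightarrow> real^'d \<Rightarrow> 'w \<Rightarrow> real^'d^'d"
  where "V_hat m X \<rho> w n a \<omega> =
    (1 / sample_size m n) *\<^sub>R
      (\<Sum>i=1..n. \<Sum>j=1..m i. w i j *\<^sub>R transpose (score_deriv \<rho> (X i j \<omega>) a))"

end

theory Submission
  imports Defs
begin

text \<open>Each of the three statistics is a weighted average over the sample of a matrix that depends on the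
  parameter \<open>a\<close>, evaluated at the estimator. The proof separates the two sources of error.

  At the true parameter the average is a sum over independent clusters, and it converges in mean to
  its limit by a weak law of large numbers. Let the cluster contributions \<open>Y n i\<close> have bounded
  total mean absolute value and let their \<open>p\<close>-th absolute moments, for some \<open>p > 1\<close>, have a sum
  that tends to 0. Truncation at a level \<open>t\<close> then splits the centred sum into a part with variance at
  most \<open>t\<close> times the total mean absolute value and a part whose mean is at most
  \<open>2 t\<^sup>1\<^sup>-\<^sup>p\<close> times the sum of the moments
  (\<open>mean_deviation_sum_indep_le\<close>, \<open>weak_law_triangular_array\<close>). For \<open>B_hat\<close> and \<open>V_hat\<close> the moment of a
  cluster contribution is controlled by the power mean inequality: up to a constant it is a power of the total
  weight of the cluster, and the sum of these powers tends to 0 (\<open>weighted_average_law\<close>).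

  For \<open>C_hat\<close> the total mean absolute value of the cross products is not directly under control,
  because convergence of the weighted sum of the cross-covariances leaves room for cancellation.
  With \<open>T i\<close> the weighted sum of the scores in cluster \<open>i\<close>, however, \<open>C_hat\<close> is the normalized sum of
  the matrices \<open>T i (T i)\<^sup>T\<close> minus \<open>B_hat\<close>. The diagonal entries of these matrices are squares, so their
  mean absolute values are means, and the means converge by the assumptions on the weights and on the
  cross-covariances; off-diagonal entries are dominated by diagonal ones (\<open>cross_product_law\<close>).

  Replacing the true parameter by the estimator changes the average by at most a weighted average of
  the Hoelder constants times a positive power of the estimation error. The first factor has bounded
  mean, so it is bounded in probability, and the second tends to 0 in probability
  (\<open>tendsto_in_prob_perturbed\<close>).

  Two points need care. Measurability of the statistics at the estimator follows from measurability
  in the observation and continuity in the parameter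
  (\<open>borel_measurable_Caratheodory_compose\<close>), and \<open>V_hat\<close> averages transposed Hessians, so its limit is
  the mean Hessian because Hessians are symmetric (\<open>transpose_hess\<close>).\<close>

section \<open>A weak law of large numbers in mean for triangular arrays\<close>

lemma (in prob_space) second_moment_sum_indep:
  fixes U :: "'i \<Rightarrow> 'a \<Rightarrow> real"
  assumes "finite I" "indep_vars (\<lambda>_. borel) U I"
    and "\<And>i. i \<in> I \<Longrightarrow> integrable M (U i)" "\<And>i. i \<in> I \<Longrightarrow> integrable M (\<lambda>\<omega>. (U i \<omega>)\<^sup>2)"
    and "\<And>i. i \<in> I \<Longrightarrow> expectation (U i) = 0"
  shows "integrable M (\<lambda>\<omega>. (\<Sum>i\<in>I. U i \<omega>)\<^sup>2) \<and>
    expectation (\<lambda>\<omega>. (\<Sum>i\<in>I. U i \<omega>)\<^sup>2) = (\<Sum>i\<in>I. expectation (\<lambda>\<omega>. (U i \<omega>)\<^sup>2))"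
  using assms
proof (induction I rule: finite_induct)
  case empty
  then show ?case by simp
next
  case (insert i I)
  let ?S = "\<lambda>\<omega>. \<Sum>i\<in>I. U i \<omega>"
  have IH: "integrable M (\<lambda>\<omega>. (?S \<omega>)\<^sup>2)"
    "expectation (\<lambda>\<omega>. (?S \<omega>)\<^sup>2) = (\<Sum>i\<in>I. expectation (\<lambda>\<omega>. (U i \<omega>)\<^sup>2))"
    using insert.IH insert.prems indep_vars_subset[OF insert.prems(1), of I] by auto
  have ind: "indep_var borel (U i) borel ?S"
    using insert by (intro indep_vars_sum) auto
  have int: "integrable M (U i)" "integrable M ?S" "integrable M (\<lambda>\<omega>. (U i \<omega>)\<^sup>2)"
    using insert.prems by auto
  have cross: "integrable M (\<lambda>\<omega>. U i \<omega> * ?S \<omega>)" "expectation (\<lambda>\<omega>. U i \<omega> * ?S \<omega>) = 0"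
    using indep_var_integrable[OF ind int(1,2)] indep_var_lebesgue_integral[OF ind int(1,2)]
      insert.prems by auto
  have eq: "(\<Sum>i\<in>insert i I. U i \<omega>)\<^sup>2 = (U i \<omega>)\<^sup>2 + 2 * (U i \<omega> * ?S \<omega>) + (?S \<omega>)\<^sup>2" for \<omega>
    using insert by (simp add: power2_sum)
  show ?case
    unfolding eq using insert.hyps IH int cross by simp
qed

lemma (in prob_space) expectation_abs_le_sqrt:
  fixes S :: "'a \<Rightarrow> real"
  assumes [measurable]: "S \<in> borel_measurable M" and int: "integrable M (\<lambda>\<omega>. (S \<omega>)\<^sup>2)"
  shows "expectation (\<lambda>\<omega>. \<bar>S \<omega>\<bar>) \<le> sqrt (expectation (\<lambda>\<omega>. (S \<omega>)\<^sup>2))"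
proof -
  have S: "integrable M S" using square_integrable_imp_integrable[OF assms(1)] int by auto
  have "0 \<le> variance (\<lambda>\<omega>. \<bar>S \<omega>\<bar>)" by simp
  also have "\<dots> = expectation (\<lambda>\<omega>. (S \<omega>)\<^sup>2) - (expectation (\<lambda>\<omega>. \<bar>S \<omega>\<bar>))\<^sup>2"
    using S int by (subst variance_eq) auto
  finally show ?thesis by (intro real_le_rsqrt) simp
qed

text \<open>Quantitative form of the weak law. The variables truncated at level \<open>t\<close> satisfy
  \<open>Z\<^sup>2 \<le> t \<bar>Y\<bar>\<close>, so by independence the variance of their sum is at most \<open>t\<close> times the total mean absolute
  value; the remainders satisfy \<open>\<bar>R\<bar> \<le> t\<^sup>1\<^sup>-\<^sup>p \<bar>Y\<bar>\<^sup>p\<close>. Truncation treats all \<open>p > 1\<close>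
  alike, whereas the usual moment inequalities for sums take different forms below and above \<open>p = 2\<close>.\<close>

lemma (in prob_space) mean_deviation_sum_indep_le:
  fixes Y :: "'i \<Rightarrow> 'a \<Rightarrow> real"
  assumes fin: "finite I" and indep: "indep_vars (\<lambda>_. borel) Y I"
    and int: "\<And>i. i \<in> I \<Longrightarrow> integrable M (Y i)"
    and p: "1 < p"
    and intp: "\<And>i. i \<in> I \<Longrightarrow> integrable M (\<lambda>\<omega>. \<bar>Y i \<omega>\<bar> powr p)"
    and t: "0 < t"
  shows "expectation (\<lambda>\<omega>. \<bar>\<Sum>i\<in>I. (Y i \<omega> - expectation (Y i))\<bar>)
    \<le> sqrt (t * (\<Sum>i\<in>I. expectation (\<lambda>\<omega>. \<bar>Y i \<omega>\<bar>)))
      + 2 * t powr (1 - p) * (\<Sum>i\<in>I. expectation (\<lambda>\<omega>. \<bar>Y i \<omega>\<bar> powr p))"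
proof -
  define h :: "real \<Rightarrow> real" where "h y = (if \<bar>y\<bar> \<le> t then y else 0)" for y
  have [measurable]: "h \<in> borel_measurable borel" unfolding h_def by measurable
  define Z where "Z i \<omega> = h (Y i \<omega>)" for i \<omega>
  define R where "R i \<omega> = Y i \<omega> - Z i \<omega>" for i \<omega>
  have mY[measurable]: "Y i \<in> borel_measurable M" if "i \<in> I" for i
    using int that by auto
  have mZ[measurable]: "Z i \<in> borel_measurable M" if "i \<in> I" for i
    using mY[OF that] unfolding Z_def[abs_def] by measurable
  have Zle: "\<bar>Z i \<omega>\<bar> \<le> t" for i \<omega> using t by (auto simp: Z_def h_def)
  have intZ: "integrable M (Z i)" if "i \<in> I" for i
    by (rule integrable_const_bound[of _ t]) (use Zle that in auto)
  have Zsq: "(Z i \<omega>)\<^sup>2 \<le> t * \<bar>Y i \<omega>\<bar>" for i \<omega>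
  proof -
    have "(Z i \<omega>)\<^sup>2 = \<bar>Z i \<omega>\<bar> * \<bar>Z i \<omega>\<bar>" by (simp add: power2_eq_square)
    also have "\<dots> \<le> t * \<bar>Y i \<omega>\<bar>"
      using Zle[of i \<omega>] t by (intro mult_mono) (auto simp: Z_def h_def)
    finally show ?thesis .
  qed
  have intZ2: "integrable M (\<lambda>\<omega>. (Z i \<omega>)\<^sup>2)" if "i \<in> I" for i
    by (rule Bochner_Integration.integrable_bound[of _ "\<lambda>\<omega>. t * \<bar>Y i \<omega>\<bar>"])
      (use int that Zsq t in \<open>auto simp: abs_mult\<close>)
  have Rle: "\<bar>R i \<omega>\<bar> \<le> t powr (1 - p) * \<bar>Y i \<omega>\<bar> powr p" for i \<omega>
  proof (cases "\<bar>Y i \<omega>\<bar> \<le> t")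
    case True
    then show ?thesis by (simp add: R_def Z_def h_def)
  next
    case False
    have "\<bar>Y i \<omega>\<bar> powr (1 - p) \<le> t powr (1 - p)"
      using False t p by (intro powr_mono2') auto
    then have "\<bar>Y i \<omega>\<bar> powr (1 - p) * \<bar>Y i \<omega>\<bar> powr p \<le> t powr (1 - p) * \<bar>Y i \<omega>\<bar> powr p"
      by (intro mult_right_mono) auto
    then show ?thesis using False t by (simp add: R_def Z_def h_def flip: powr_add)
  qed
  have intR: "integrable M (R i)" if "i \<in> I" for i
    unfolding R_def using int intZ that by auto
  let ?U = "\<lambda>i \<omega>. Z i \<omega> - expectation (Z i)"
  have indU: "indep_vars (\<lambda>_. borel) ?U I"
    unfolding Z_def by (rule indep_vars_compose2[OF indep]) measurable
  have U2: "integrable M (\<lambda>\<omega>. (?U i \<omega>)\<^sup>2)" "expectation (\<lambda>\<omega>. (?U i \<omega>)\<^sup>2) \<le> t * expectation (\<lambda>\<omega>. \<bar>Y i \<omega>\<bar>)"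
    if i: "i \<in> I" for i
  proof -
    have "expectation (\<lambda>\<omega>. (?U i \<omega>)\<^sup>2) \<le> expectation (\<lambda>\<omega>. (Z i \<omega>)\<^sup>2)"
      using variance_eq[OF intZ[OF i] intZ2[OF i]] by simp
    also have "\<dots> \<le> expectation (\<lambda>\<omega>. t * \<bar>Y i \<omega>\<bar>)"
      by (rule integral_mono) (use intZ2 int i Zsq in auto)
    finally show "expectation (\<lambda>\<omega>. (?U i \<omega>)\<^sup>2) \<le> t * expectation (\<lambda>\<omega>. \<bar>Y i \<omega>\<bar>)" by simp
    show "integrable M (\<lambda>\<omega>. (?U i \<omega>)\<^sup>2)"
      using intZ[OF i] intZ2[OF i] by (simp add: power2_diff)
  qed
  have S: "integrable M (\<lambda>\<omega>. (\<Sum>i\<in>I. ?U i \<omega>)\<^sup>2)"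
    "expectation (\<lambda>\<omega>. (\<Sum>i\<in>I. ?U i \<omega>)\<^sup>2) = (\<Sum>i\<in>I. expectation (\<lambda>\<omega>. (?U i \<omega>)\<^sup>2))"
    using second_moment_sum_indep[OF fin indU] intZ U2(1) by (auto simp: prob_space)
  have "expectation (\<lambda>\<omega>. \<bar>\<Sum>i\<in>I. ?U i \<omega>\<bar>) \<le> sqrt (expectation (\<lambda>\<omega>. (\<Sum>i\<in>I. ?U i \<omega>)\<^sup>2))"
    by (rule expectation_abs_le_sqrt) (use S(1) mZ in auto)
  also have "\<dots> \<le> sqrt (t * (\<Sum>i\<in>I. expectation (\<lambda>\<omega>. \<bar>Y i \<omega>\<bar>)))"
    unfolding S(2) sum_distrib_left by (intro real_sqrt_le_mono sum_mono U2)
  finally have main: "expectation (\<lambda>\<omega>. \<bar>\<Sum>i\<in>I. ?U i \<omega>\<bar>) \<le> \<dots>" .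
  have dev: "\<bar>\<Sum>i\<in>I. (Y i \<omega> - expectation (Y i))\<bar> \<le>
    \<bar>\<Sum>i\<in>I. ?U i \<omega>\<bar> + (\<Sum>i\<in>I. \<bar>R i \<omega>\<bar> + expectation (\<lambda>\<omega>. \<bar>R i \<omega>\<bar>))" for \<omega>
  proof -
    have "expectation (Y i) = expectation (Z i) + expectation (R i)" if "i \<in> I" for i
      using int intZ that by (simp add: R_def[abs_def])
    then have "(\<Sum>i\<in>I. (Y i \<omega> - expectation (Y i))) =
        (\<Sum>i\<in>I. ?U i \<omega>) + (\<Sum>i\<in>I. R i \<omega> - expectation (R i))"
      unfolding sum.distrib[symmetric] by (intro sum.cong) (auto simp: R_def)
    moreover have "\<bar>\<Sum>i\<in>I. R i \<omega> - expectation (R i)\<bar> \<le> (\<Sum>i\<in>I. \<bar>R i \<omega>\<bar> + expectation (\<lambda>\<omega>. \<bar>R i \<omega>\<bar>))"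
    proof (rule sum_abs[THEN order_trans], rule sum_mono)
      fix i
      have "\<bar>expectation (R i)\<bar> \<le> expectation (\<lambda>\<omega>. \<bar>R i \<omega>\<bar>)" by simp
      then show "\<bar>R i \<omega> - expectation (R i)\<bar> \<le> \<bar>R i \<omega>\<bar> + expectation (\<lambda>\<omega>. \<bar>R i \<omega>\<bar>)" by linarith
    qed
    ultimately show ?thesis by linarith
  qed
  have intA: "integrable M (\<lambda>\<omega>. \<bar>R i \<omega>\<bar>)" if "i \<in> I" for i using intR that by auto
  have "expectation (\<lambda>\<omega>. \<bar>\<Sum>i\<in>I. (Y i \<omega> - expectation (Y i))\<bar>) \<le>
    expectation (\<lambda>\<omega>. \<bar>\<Sum>i\<in>I. ?U i \<omega>\<bar> + (\<Sum>i\<in>I. \<bar>R i \<omega>\<bar> + expectation (\<lambda>\<omega>. \<bar>R i \<omega>\<bar>)))"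
    by (rule integral_mono) (use dev int intZ intA in \<open>auto intro!: Bochner_Integration.integrable_add integrable_abs Bochner_Integration.integrable_sum\<close>)
  also have "\<dots> = expectation (\<lambda>\<omega>. \<bar>\<Sum>i\<in>I. ?U i \<omega>\<bar>) + (\<Sum>i\<in>I. 2 * expectation (\<lambda>\<omega>. \<bar>R i \<omega>\<bar>))"
    using intZ intA by (subst Bochner_Integration.integral_add)
      (auto intro!: integrable_abs Bochner_Integration.integrable_sum sum.cong simp: prob_space)
  also have "(\<Sum>i\<in>I. 2 * expectation (\<lambda>\<omega>. \<bar>R i \<omega>\<bar>)) \<le>
      (\<Sum>i\<in>I. 2 * (t powr (1 - p) * expectation (\<lambda>\<omega>. \<bar>Y i \<omega>\<bar> powr p)))"
  proof (intro sum_mono mult_left_mono)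
    fix i assume i: "i \<in> I"
    have "expectation (\<lambda>\<omega>. \<bar>R i \<omega>\<bar>) \<le> expectation (\<lambda>\<omega>. t powr (1 - p) * \<bar>Y i \<omega>\<bar> powr p)"
      by (rule integral_mono) (use i intA intp Rle in auto)
    then show "expectation (\<lambda>\<omega>. \<bar>R i \<omega>\<bar>) \<le> t powr (1 - p) * expectation (\<lambda>\<omega>. \<bar>Y i \<omega>\<bar> powr p)"
      by simp
  qed auto
  finally show ?thesis using main by (simp add: sum_distrib_left mult.assoc)
qed

text \<open>A small truncation level makes the variance term small uniformly in \<open>n\<close>; for that fixed level the
  moment term then tends to 0.\<close>

lemma (in prob_space) weak_law_triangular_array:
  fixes Y :: "nat \<Rightarrow> 'i \<Rightarrow> 'a \<Rightarrow> real" and I :: "nat \<Rightarrow> 'i set"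
  assumes fin: "\<And>n. finite (I n)" and indep: "\<And>n. indep_vars (\<lambda>_. borel) (Y n) (I n)"
    and int: "\<And>n i. i \<in> I n \<Longrightarrow> integrable M (Y n i)"
    and p: "1 < p"
    and intp: "\<And>n i. i \<in> I n \<Longrightarrow> integrable M (\<lambda>\<omega>. \<bar>Y n i \<omega>\<bar> powr p)"
    and bound: "\<And>n. (\<Sum>i\<in>I n. expectation (\<lambda>\<omega>. \<bar>Y n i \<omega>\<bar>)) \<le> K"
    and small: "(\<lambda>n. \<Sum>i\<in>I n. expectation (\<lambda>\<omega>. \<bar>Y n i \<omega>\<bar> powr p)) \<longlonglongrightarrow> 0"
  shows "(\<lambda>n. expectation (\<lambda>\<omega>. \<bar>\<Sum>i\<in>I n. (Y n i \<omega> - expectation (Y n i))\<bar>)) \<longlonglongrightarrow> 0"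
proof (rule LIMSEQ_I)
  fix r :: real assume r: "0 < r"
  have K: "0 \<le> K"
    by (rule order_trans[OF _ bound[of 0]]) (intro sum_nonneg integral_nonneg_AE, auto)
  \<comment> \<open>The level at which the variance term stays below \<open>r / 2\<close> for all \<open>n\<close>.\<close>
  define t where "t = (r / 2)\<^sup>2 / (K + 1)"
  have t: "0 < t" using r K by (simp add: t_def)
  have "t * K < (r / 2)\<^sup>2"
    using r K by (simp add: t_def field_simps)
  then have tK: "sqrt (t * K) < r / 2"
    using r real_sqrt_less_mono[of "t * K" "(r/2)\<^sup>2"] by simp
  have "(\<lambda>n. 2 * t powr (1 - p) * (\<Sum>i\<in>I n. expectation (\<lambda>\<omega>. \<bar>Y n i \<omega>\<bar> powr p))) \<longlonglongrightarrow> 2 * t powr (1 - p) * 0"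
    by (intro tendsto_mult tendsto_const small)
  then have "eventually (\<lambda>n. 2 * t powr (1 - p) * (\<Sum>i\<in>I n. expectation (\<lambda>\<omega>. \<bar>Y n i \<omega>\<bar> powr p)) < r / 2) sequentially"
    using r by (intro order_tendstoD) auto
  then obtain n0 where n0: "\<And>n. n \<ge> n0 \<Longrightarrow>
    2 * t powr (1 - p) * (\<Sum>i\<in>I n. expectation (\<lambda>\<omega>. \<bar>Y n i \<omega>\<bar> powr p)) < r / 2"
    by (auto simp: eventually_sequentially)
  show "\<exists>no. \<forall>n\<ge>no. norm (expectation (\<lambda>\<omega>. \<bar>\<Sum>i\<in>I n. (Y n i \<omega> - expectation (Y n i))\<bar>) - 0) < r"
  proof (intro exI allI impI)
    fix n assume n: "n \<ge> n0"
    have "expectation (\<lambda>\<omega>. \<bar>\<Sum>i\<in>I n. (Y n i \<omega> - expectation (Y n i))\<bar>)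
      \<le> sqrt (t * (\<Sum>i\<in>I n. expectation (\<lambda>\<omega>. \<bar>Y n i \<omega>\<bar>)))
      + 2 * t powr (1 - p) * (\<Sum>i\<in>I n. expectation (\<lambda>\<omega>. \<bar>Y n i \<omega>\<bar> powr p))"
      using fin indep int p intp t by (rule mean_deviation_sum_indep_le)
    also have "sqrt (t * (\<Sum>i\<in>I n. expectation (\<lambda>\<omega>. \<bar>Y n i \<omega>\<bar>))) \<le> sqrt (t * K)"
      using t bound by (intro real_sqrt_le_mono mult_left_mono) auto
    finally have "expectation (\<lambda>\<omega>. \<bar>\<Sum>i\<in>I n. (Y n i \<omega> - expectation (Y n i))\<bar>) < r"
      using tK n0[OF n] by linarith
    moreover have "0 \<le> expectation (\<lambda>\<omega>. \<bar>\<Sum>i\<in>I n. (Y n i \<omega> - expectation (Y n i))\<bar>)"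
      by (rule integral_nonneg_AE) auto
    ultimately show "norm (expectation (\<lambda>\<omega>. \<bar>\<Sum>i\<in>I n. (Y n i \<omega> - expectation (Y n i))\<bar>) - 0) < r"
      by simp
  qed
qed

lemma (in prob_space) weak_law_triangular_array_mean:
  fixes Y :: "nat \<Rightarrow> 'i \<Rightarrow> 'a \<Rightarrow> real" and I :: "nat \<Rightarrow> 'i set"
  assumes fin: "\<And>n. finite (I n)" and indep: "\<And>n. indep_vars (\<lambda>_. borel) (Y n) (I n)"
    and int: "\<And>n i. i \<in> I n \<Longrightarrow> integrable M (Y n i)"
    and p: "1 < p"
    and intp: "\<And>n i. i \<in> I n \<Longrightarrow> integrable M (\<lambda>\<omega>. \<bar>Y n i \<omega>\<bar> powr p)"
    and bound: "\<And>n. (\<Sum>i\<in>I n. expectation (\<lambda>\<omega>. \<bar>Y n i \<omega>\<bar>)) \<le> K"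
    and small: "(\<lambda>n. \<Sum>i\<in>I n. expectation (\<lambda>\<omega>. \<bar>Y n i \<omega>\<bar> powr p)) \<longlonglongrightarrow> 0"
    and mean: "(\<lambda>n. \<Sum>i\<in>I n. expectation (Y n i)) \<longlonglongrightarrow> c"
  shows "(\<lambda>n. expectation (\<lambda>\<omega>. \<bar>(\<Sum>i\<in>I n. Y n i \<omega>) - c\<bar>)) \<longlonglongrightarrow> 0"
proof (rule tendsto_sandwich[of "\<lambda>_. 0"])
  let ?D = "\<lambda>n \<omega>. \<Sum>i\<in>I n. (Y n i \<omega> - expectation (Y n i))"
  let ?m = "\<lambda>n. \<Sum>i\<in>I n. expectation (Y n i)"
  have "(\<lambda>n. expectation (\<lambda>\<omega>. \<bar>?D n \<omega>\<bar>) + \<bar>?m n - c\<bar>) \<longlonglongrightarrow> 0 + \<bar>c - c\<bar>"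
    by (intro tendsto_intros mean weak_law_triangular_array[OF fin indep int p intp bound small])
  then show "(\<lambda>n. expectation (\<lambda>\<omega>. \<bar>?D n \<omega>\<bar>) + \<bar>?m n - c\<bar>) \<longlonglongrightarrow> 0" by simp
  have "expectation (\<lambda>\<omega>. \<bar>(\<Sum>i\<in>I n. Y n i \<omega>) - c\<bar>) \<le> expectation (\<lambda>\<omega>. \<bar>?D n \<omega>\<bar>) + \<bar>?m n - c\<bar>" for n
  proof -
    have D: "integrable M (\<lambda>\<omega>. \<bar>?D n \<omega>\<bar>)" using int by auto
    have "expectation (\<lambda>\<omega>. \<bar>(\<Sum>i\<in>I n. Y n i \<omega>) - c\<bar>) \<le> expectation (\<lambda>\<omega>. \<bar>?D n \<omega>\<bar> + \<bar>?m n - c\<bar>)"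
    proof (rule integral_mono)
      show "integrable M (\<lambda>\<omega>. \<bar>(\<Sum>i\<in>I n. Y n i \<omega>) - c\<bar>)" using int by auto
      show "integrable M (\<lambda>\<omega>. \<bar>?D n \<omega>\<bar> + \<bar>?m n - c\<bar>)" using D by simp
    qed (simp add: sum_subtractf)
    then show ?thesis using D by (simp add: prob_space)
  qed
  then show "eventually (\<lambda>n. expectation (\<lambda>\<omega>. \<bar>(\<Sum>i\<in>I n. Y n i \<omega>) - c\<bar>) \<le>
      expectation (\<lambda>\<omega>. \<bar>?D n \<omega>\<bar>) + \<bar>?m n - c\<bar>) sequentially" by simp
qed auto

text \<open>Power mean inequality for weights that need not add up to 1: Jensen's inequality for \<open>x\<^sup>p\<close>. Terms
  with weight or value 0 are dropped first, since convexity of the real power is used on the open half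
  line.\<close>

lemma sum_powr_le:
  fixes v y :: "'i \<Rightarrow> real"
  assumes fin: "finite J" and v: "\<And>j. j \<in> J \<Longrightarrow> 0 \<le> v j" and y: "\<And>j. j \<in> J \<Longrightarrow> 0 \<le> y j" and p: "1 \<le> p"
  shows "(\<Sum>j\<in>J. v j * y j) powr p \<le> (\<Sum>j\<in>J. v j) powr (p - 1) * (\<Sum>j\<in>J. v j * y j powr p)"
proof -
  define S where "S = {j\<in>J. 0 < v j \<and> 0 < y j}"
  have S: "finite S" "S \<subseteq> J" using fin by (auto simp: S_def)
  have eq: "(\<Sum>j\<in>J. v j * y j) = (\<Sum>j\<in>S. v j * y j)"
    by (rule sum.mono_neutral_right) (use fin S v y in \<open>force simp: S_def\<close>)+
  have eq': "(\<Sum>j\<in>J. v j * y j powr p) = (\<Sum>j\<in>S. v j * y j powr p)"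
    by (rule sum.mono_neutral_right) (use fin S v y in \<open>force simp: S_def\<close>)+
  show ?thesis
  proof (cases "S = {}")
    case True
    then show ?thesis using eq eq' p by simp
  next
    case False
    define V where "V = (\<Sum>j\<in>S. v j)"
    have V: "0 < V" unfolding V_def using S(1) False by (intro sum_pos) (auto simp: S_def)
    have "(\<Sum>j\<in>S. (v j / V) *\<^sub>R y j) powr p \<le> (\<Sum>j\<in>S. (v j / V) * (y j powr p))"
      using powr_convex[OF p] S(1) False V
      by (intro convex_on_sum[where C="{0<..}"]) (auto simp: S_def V_def simp flip: sum_divide_distrib)
    then have le: "((\<Sum>j\<in>S. v j * y j) / V) powr p \<le> (\<Sum>j\<in>S. v j * y j powr p) / V"
      by (simp add: sum_divide_distrib)
    have pos: "0 \<le> (\<Sum>j\<in>S. v j * y j)" by (intro sum_nonneg) (auto simp: S_def)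
    have "(\<Sum>j\<in>S. v j * y j) powr p = V powr p * ((\<Sum>j\<in>S. v j * y j) / V) powr p"
      using V pos by (simp add: powr_divide)
    also have "\<dots> \<le> V powr p * ((\<Sum>j\<in>S. v j * y j powr p) / V)"
      by (intro mult_left_mono le) auto
    also have "\<dots> = V powr (p - 1) * (\<Sum>j\<in>S. v j * y j powr p)"
      using V by (simp add: powr_diff)
    also have "\<dots> \<le> (\<Sum>j\<in>J. v j) powr (p - 1) * (\<Sum>j\<in>S. v j * y j powr p)"
      using V p S fin v unfolding V_def
      by (intro mult_right_mono powr_mono2 sum_mono2 sum_nonneg) (auto simp: S_def)
    finally show ?thesis using eq eq' by simp
  qed
qed

section \<open>Measurability\<close>

lemma borel_measurable_vecI:
  fixes f :: "'a \<Rightarrow> 'b::euclidean_space^'n"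
  assumes "\<And>i. (\<lambda>x. f x $ i) \<in> borel_measurable M"
  shows "f \<in> borel_measurable M"
proof -
  have "(\<lambda>x. f x \<bullet> c) \<in> borel_measurable M" if c: "c \<in> Basis" for c
  proof -
    obtain i b where "c = axis i b" using c by (auto simp: Basis_vec_def)
    then have "(\<lambda>x. f x \<bullet> c) = (\<lambda>x. f x $ i \<bullet> b)" by (simp add: inner_axis)
    then show ?thesis using assms[of i] by simp
  qed
  then show ?thesis by (simp add: borel_measurable_euclidean_space[of f])
qed

lemma borel_measurable_matrix_entry:
  fixes f :: "'a \<Rightarrow> real^'n^'m"
  assumes "f \<in> borel_measurable M"
  shows "(\<lambda>x. f x $ a $ b) \<in> borel_measurable M"
proof (rule measurable_compose[OF assms])
  show "(\<lambda>A :: real^'n^'m. A $ a $ b) \<in> borel_measurable borel"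
    by (intro borel_measurable_continuous_onI continuous_intros)
qed

text \<open>A function measurable in its first and continuous in its second argument may be evaluated at a
  measurable point: the point is approximated by the first member of a countable dense subset of \<open>S\<close>
  within distance \<open>1 / (n + 1)\<close>, which takes countably many values, all in \<open>S\<close>. The set \<open>S\<close> itself may
  fail to be Borel, as a bounded convex set can.\<close>

lemma borel_measurable_Caratheodory_compose:
  fixes f :: "'a \<Rightarrow> 'c::{metric_space, second_countable_topology} \<Rightarrow> 'b::metric_space"
  assumes f: "\<And>a. a \<in> S \<Longrightarrow> (\<lambda>x. f x a) \<in> borel_measurable M"
    and cont: "\<And>x. x \<in> space M \<Longrightarrow> continuous_on S (f x)"
    and T[measurable]: "T \<in> borel_measurable M" and TS: "\<And>x. x \<in> space M \<Longrightarrow> T x \<in> S"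
  shows "(\<lambda>x. f x (T x)) \<in> borel_measurable M"
proof (cases "S = {}")
  case True
  then have "space M = {}" using TS by auto
  then show ?thesis by (auto simp: measurable_def)
next
  case False
  obtain D where D: "countable D" "D \<subseteq> S" "S \<subseteq> closure D" by (rule separable)
  have "D \<noteq> {}" using False D(3) by auto
  define d where "d = from_nat_into D"
  have dD: "range d = D" unfolding d_def by (rule range_from_nat_into) fact+
  have dS: "d k \<in> S" for k using dD D(2) by auto
  define q where "q n x = (LEAST k. dist (d k) (T x) < inverse (real (Suc n)))" for n x
  have qn: "dist (d (q n x)) (T x) < inverse (real (Suc n))" if x: "x \<in> space M" for n x
  proof -
    have "T x \<in> closure D" using TS[OF x] D(3) by auto
    then obtain y where "y \<in> D" "dist y (T x) < inverse (real (Suc n))"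
      unfolding closure_approachable by (metis inverse_positive_iff_positive of_nat_0_less_iff zero_less_Suc)
    then obtain k where "dist (d k) (T x) < inverse (real (Suc n))" using dD by auto
    then show ?thesis unfolding q_def by (rule LeastI)
  qed
  show ?thesis
  proof (rule borel_measurable_LIMSEQ_metric)
    fix n
    have [measurable]: "q n \<in> measurable M (count_space UNIV)" unfolding q_def by measurable
    show "(\<lambda>x. f x (d (q n x))) \<in> borel_measurable M"
      by (rule measurable_compose_countable[where f="\<lambda>k x. f x (d k)"]) (auto intro: f dS)
  next
    fix x assume x: "x \<in> space M"
    have "(\<lambda>n. d (q n x)) \<longlonglongrightarrow> T x"
    proof (subst tendsto_dist_iff, rule tendsto_sandwich[of "\<lambda>_. 0"])
      show "(\<lambda>n. inverse (real (Suc n))) \<longlonglongrightarrow> 0" by (rule LIMSEQ_inverse_real_of_nat)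
    qed (use qn[OF x] in \<open>auto intro!: always_eventually less_imp_le\<close>)
    then show "(\<lambda>n. f x (d (q n x))) \<longlonglongrightarrow> f x (T x)"
      by (rule continuous_on_tendsto_compose[OF cont[OF x]]) (simp_all add: TS x dS)
  qed
qed

lemma borel_measurable_outer:
  assumes "f \<in> borel_measurable M" "g \<in> borel_measurable M"
  shows "(\<lambda>x. outer (f x) (g x)) \<in> borel_measurable M"
proof (intro borel_measurable_vecI)
  fix i j
  have "(\<lambda>x. f x $ i * g x $ j) \<in> borel_measurable M"
    by (intro borel_measurable_times measurable_compose[OF assms(1) borel_measurable_nth]
        measurable_compose[OF assms(2) borel_measurable_nth])
  then show "(\<lambda>x. outer (f x) (g x) $ i $ j) \<in> borel_measurable M" by (simp add: outer_def)
qed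

section \<open>Convergence in probability\<close>

lemma matrix_norm_le_sum_entries: "norm (A :: real^'n^'m) \<le> (\<Sum>a\<in>UNIV. \<Sum>b\<in>UNIV. \<bar>A $ a $ b\<bar>)"
proof -
  have "norm A \<le> (\<Sum>a\<in>UNIV. norm (A $ a))"
    unfolding norm_vec_def by (rule L2_set_le_sum) simp
  also have "\<dots> \<le> (\<Sum>a\<in>UNIV. \<Sum>b\<in>UNIV. \<bar>A $ a $ b\<bar>)" by (intro sum_mono norm_le_l1_cart)
  finally show ?thesis .
qed

lemma tendsto_in_prob_cong:
  assumes "\<And>n \<omega>. 1 \<le> n \<Longrightarrow> \<omega> \<in> space M \<Longrightarrow> Y n \<omega> = Z n \<omega>"
  shows "tendsto_in_prob M Y c \<longleftrightarrow> tendsto_in_prob M Z c"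
proof -
  have "Y n \<in> borel_measurable M \<longleftrightarrow> Z n \<in> borel_measurable M" if "1 \<le> n" for n
    using assms[OF that] by (intro measurable_cong) auto
  moreover have "((\<lambda>n. measure M {\<omega> \<in> space M. e < dist (Y n \<omega>) c}) \<longlonglongrightarrow> 0) \<longleftrightarrow>
      ((\<lambda>n. measure M {\<omega> \<in> space M. e < dist (Z n \<omega>) c}) \<longlonglongrightarrow> 0)" for e
    using assms
    by (intro tendsto_cong eventually_sequentiallyI[of 1] arg_cong[where f="measure M"]) auto
  ultimately show ?thesis unfolding tendsto_in_prob_def by blast
qed

lemma (in prob_space) tendsto_in_prob_if_mean:
  fixes Y :: "nat \<Rightarrow> 'a \<Rightarrow> 'b::{real_normed_vector, second_countable_topology}"
  assumes meas: "\<And>n. 1 \<le> n \<Longrightarrow> Y n \<in> borel_measurable M"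
    and int: "\<And>n. 1 \<le> n \<Longrightarrow> integrable M (\<lambda>\<omega>. norm (Y n \<omega> - c))"
    and lim: "(\<lambda>n. expectation (\<lambda>\<omega>. norm (Y n \<omega> - c))) \<longlonglongrightarrow> 0"
  shows "tendsto_in_prob M Y c"
  unfolding tendsto_in_prob_def
proof (intro conjI allI impI meas)
  fix \<epsilon> :: real assume \<epsilon>: "0 < \<epsilon>"
  show "(\<lambda>n. measure M {\<omega> \<in> space M. \<epsilon> < dist (Y n \<omega>) c}) \<longlonglongrightarrow> 0"
  proof (rule tendsto_sandwich[of "\<lambda>_. 0"])
    show "(\<lambda>n. expectation (\<lambda>\<omega>. norm (Y n \<omega> - c)) / \<epsilon>) \<longlonglongrightarrow> 0"
      using tendsto_divide[OF lim tendsto_const[of \<epsilon>]] \<epsilon> by simp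
    have "measure M {\<omega> \<in> space M. \<epsilon> < dist (Y n \<omega>) c} \<le> expectation (\<lambda>\<omega>. norm (Y n \<omega> - c)) / \<epsilon>"
      if "1 \<le> n" for n
    proof -
      have [measurable]: "Y n \<in> borel_measurable M" by (rule meas[OF that])
      have "measure M {\<omega> \<in> space M. \<epsilon> < dist (Y n \<omega>) c} \<le> measure M {\<omega> \<in> space M. \<epsilon> \<le> norm (Y n \<omega> - c)}"
        by (intro finite_measure_mono) (auto simp: dist_norm)
      also have "\<dots> \<le> expectation (\<lambda>\<omega>. norm (Y n \<omega> - c)) / \<epsilon>"
        using \<epsilon> int[OF that] by (intro integral_Markov_inequality_measure[of _ _ "space M"]) auto
      finally show ?thesis .
    qed
    then show "eventually (\<lambda>n. measure M {\<omega> \<in> space M. \<epsilon> < dist (Y n \<omega>) c}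
        \<le> expectation (\<lambda>\<omega>. norm (Y n \<omega> - c)) / \<epsilon>) sequentially"
      unfolding eventually_sequentially by blast
  qed auto
qed

lemma (in prob_space) tendsto_in_prob_if_entries_mean:
  fixes Y :: "nat \<Rightarrow> 'a \<Rightarrow> real^'n^'m"
  assumes int: "\<And>n a b. 1 \<le> n \<Longrightarrow> integrable M (\<lambda>\<omega>. Y n \<omega> $ a $ b)"
    and lim: "\<And>a b. (\<lambda>n. expectation (\<lambda>\<omega>. \<bar>Y n \<omega> $ a $ b - c $ a $ b\<bar>)) \<longlonglongrightarrow> 0"
  shows "tendsto_in_prob M Y c"
proof (rule tendsto_in_prob_if_mean)
  fix n :: nat assume n: "1 \<le> n"
  show [measurable]: "Y n \<in> borel_measurable M"
    by (intro borel_measurable_vecI) (use int[OF n] in auto)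
  show "integrable M (\<lambda>\<omega>. norm (Y n \<omega> - c))"
  proof (rule Bochner_Integration.integrable_bound)
    show "integrable M (\<lambda>\<omega>. \<Sum>a\<in>UNIV. \<Sum>b\<in>UNIV. \<bar>Y n \<omega> $ a $ b - c $ a $ b\<bar>)"
      using int[OF n] by auto
    show "AE \<omega> in M. norm (norm (Y n \<omega> - c)) \<le> norm (\<Sum>a\<in>UNIV. \<Sum>b\<in>UNIV. \<bar>Y n \<omega> $ a $ b - c $ a $ b\<bar>)"
      using matrix_norm_le_sum_entries[of "Y n _ - c"] by (auto simp: sum_nonneg)
  qed simp
next
  show "(\<lambda>n. expectation (\<lambda>\<omega>. norm (Y n \<omega> - c))) \<longlonglongrightarrow> 0"
  proof (rule tendsto_sandwich[of "\<lambda>_. 0"])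
    have "(\<lambda>n. \<Sum>a\<in>UNIV. \<Sum>b\<in>UNIV. expectation (\<lambda>\<omega>. \<bar>Y n \<omega> $ a $ b - c $ a $ b\<bar>)) \<longlonglongrightarrow>
        (\<Sum>a\<in>(UNIV :: 'm set). \<Sum>b\<in>(UNIV :: 'n set). 0)"
      by (intro tendsto_sum lim)
    then show "(\<lambda>n. \<Sum>a\<in>UNIV. \<Sum>b\<in>UNIV. expectation (\<lambda>\<omega>. \<bar>Y n \<omega> $ a $ b - c $ a $ b\<bar>)) \<longlonglongrightarrow> 0"
      by simp
    have "expectation (\<lambda>\<omega>. norm (Y n \<omega> - c)) \<le>
        (\<Sum>a\<in>UNIV. \<Sum>b\<in>UNIV. expectation (\<lambda>\<omega>. \<bar>Y n \<omega> $ a $ b - c $ a $ b\<bar>))" if n: "1 \<le> n" for n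
    proof -
      have e: "integrable M (\<lambda>\<omega>. \<bar>Y n \<omega> $ a $ b - c $ a $ b\<bar>)" for a b using int[OF n] by auto
      have "expectation (\<lambda>\<omega>. norm (Y n \<omega> - c)) \<le>
        expectation (\<lambda>\<omega>. \<Sum>a\<in>UNIV. \<Sum>b\<in>UNIV. \<bar>Y n \<omega> $ a $ b - c $ a $ b\<bar>)"
        using matrix_norm_le_sum_entries[of "Y n _ - c"] e
        by (intro integral_mono') (auto intro!: sum_nonneg)
      also have "\<dots> = (\<Sum>a\<in>UNIV. \<Sum>b\<in>UNIV. expectation (\<lambda>\<omega>. \<bar>Y n \<omega> $ a $ b - c $ a $ b\<bar>))"
        using e by (simp add: Bochner_Integration.integral_sum)
      finally show ?thesis .
    qed
    then show "eventually (\<lambda>n. expectation (\<lambda>\<omega>. norm (Y n \<omega> - c)) \<le>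
        (\<Sum>a\<in>UNIV. \<Sum>b\<in>UNIV. expectation (\<lambda>\<omega>. \<bar>Y n \<omega> $ a $ b - c $ a $ b\<bar>))) sequentially"
      unfolding eventually_sequentially by blast
  qed auto
qed

text \<open>The plug-in principle: a factor \<open>W n\<close> with bounded mean is bounded in probability by Markov's
  inequality, and its product with a positive power of the estimation error vanishes in probability.\<close>

lemma (in prob_space) tendsto_in_prob_perturbed:
  fixes A B :: "nat \<Rightarrow> 'a \<Rightarrow> 'b::{metric_space, second_countable_topology}"
    and T :: "nat \<Rightarrow> 'a \<Rightarrow> 'c::{metric_space, second_countable_topology}" and W :: "nat \<Rightarrow> 'a \<Rightarrow> real"
  assumes A: "tendsto_in_prob M A c" and T: "tendsto_in_prob M T \<theta>" and \<kappa>: "0 < \<kappa>"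
    and B: "\<And>n. 1 \<le> n \<Longrightarrow> B n \<in> borel_measurable M"
    and W: "\<And>n. 1 \<le> n \<Longrightarrow> integrable M (W n)"
    and W_nonneg: "\<And>n \<omega>. 1 \<le> n \<Longrightarrow> \<omega> \<in> space M \<Longrightarrow> 0 \<le> W n \<omega>"
    and W_bound: "\<And>n. 1 \<le> n \<Longrightarrow> expectation (W n) \<le> K"
    and le: "\<And>n \<omega>. 1 \<le> n \<Longrightarrow> \<omega> \<in> space M \<Longrightarrow> dist (B n \<omega>) (A n \<omega>) \<le> W n \<omega> * dist (T n \<omega>) \<theta> powr \<kappa>"
  shows "tendsto_in_prob M B c"
  unfolding tendsto_in_prob_def
proof (intro conjI allI impI B)
  fix \<epsilon> :: real assume \<epsilon>: "0 < \<epsilon>"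
  have K: "0 \<le> K"
    by (rule order_trans[OF _ W_bound[of 1]]) (intro integral_nonneg_AE, use W_nonneg in auto)
  show "(\<lambda>n. measure M {\<omega> \<in> space M. \<epsilon> < dist (B n \<omega>) c}) \<longlonglongrightarrow> 0"
  proof (rule LIMSEQ_I)
    fix r :: real assume r: "0 < r"
    \<comment> \<open>\<open>L\<close> is a level that \<open>W n\<close> exceeds with probability below \<open>r / 2\<close>; \<open>g\<close> is the distance from
      \<open>\<theta>\<close> within which \<open>W n \<le> L\<close> forces \<open>B n\<close> to be \<open>\<epsilon> / 2\<close>-close to \<open>A n\<close>.\<close>
    define L where "L = 2 * (K + 1) / r"
    define g where "g = (\<epsilon> / 2 / L) powr (1 / \<kappa>)"
    have L: "0 < L" "K / L < r / 2" using K r by (auto simp: L_def field_simps)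
    have g: "0 < g" "g powr \<kappa> = \<epsilon> / 2 / L" using \<epsilon> L \<kappa> by (auto simp: g_def powr_powr)
    have lim: "(\<lambda>n. measure M {\<omega> \<in> space M. \<epsilon> / 2 < dist (A n \<omega>) c}
        + measure M {\<omega> \<in> space M. g < dist (T n \<omega>) \<theta>}) \<longlonglongrightarrow> 0 + 0"
      using A T half_gt_zero[OF \<epsilon>] g(1) unfolding tendsto_in_prob_def by (intro tendsto_add) blast+
    then obtain n0 where n0: "\<And>n. n0 \<le> n \<Longrightarrow> measure M {\<omega> \<in> space M. \<epsilon> / 2 < dist (A n \<omega>) c}
        + measure M {\<omega> \<in> space M. g < dist (T n \<omega>) \<theta>} < r / 2"
      using order_tendstoD(2)[OF lim, of "r / 2"] r by (auto simp: eventually_sequentially)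
    show "\<exists>no. \<forall>n\<ge>no. norm (measure M {\<omega> \<in> space M. \<epsilon> < dist (B n \<omega>) c} - 0) < r"
    proof (intro exI allI impI)
      fix n assume n: "max 1 n0 \<le> n"
      then have n1: "1 \<le> n" "n0 \<le> n" by auto
      have [measurable]: "A n \<in> borel_measurable M" "B n \<in> borel_measurable M"
        "T n \<in> borel_measurable M" "W n \<in> borel_measurable M"
        using A T B[OF n1(1)] W[OF n1(1)] n1 by (auto simp: tendsto_in_prob_def)
      let ?A = "{\<omega> \<in> space M. \<epsilon> / 2 < dist (A n \<omega>) c}" and ?T = "{\<omega> \<in> space M. g < dist (T n \<omega>) \<theta>}"
        and ?W = "{\<omega> \<in> space M. L \<le> W n \<omega>}"
      have "{\<omega> \<in> space M. \<epsilon> < dist (B n \<omega>) c} \<subseteq> (?A \<union> ?T) \<union> ?W"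
      proof (rule subsetI, rule ccontr)
        fix \<omega> assume "\<omega> \<in> {\<omega> \<in> space M. \<epsilon> < dist (B n \<omega>) c}" "\<omega> \<notin> (?A \<union> ?T) \<union> ?W"
        then have \<omega>: "\<omega> \<in> space M" "\<epsilon> < dist (B n \<omega>) c" "dist (A n \<omega>) c \<le> \<epsilon> / 2"
          "dist (T n \<omega>) \<theta> \<le> g" "W n \<omega> < L" by auto
        have "dist (B n \<omega>) (A n \<omega>) \<le> W n \<omega> * dist (T n \<omega>) \<theta> powr \<kappa>" by (rule le[OF n1(1) \<omega>(1)])
        also have "\<dots> \<le> L * g powr \<kappa>"
          using \<omega> L \<kappa> W_nonneg[OF n1(1) \<omega>(1)] by (intro mult_mono powr_mono2) auto
        also have "\<dots> = \<epsilon> / 2" using g L by simp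
        finally show False using \<omega> dist_triangle[of "B n \<omega>" c "A n \<omega>"] by linarith
      qed
      then have "measure M {\<omega> \<in> space M. \<epsilon> < dist (B n \<omega>) c} \<le> measure M ((?A \<union> ?T) \<union> ?W)"
        by (intro finite_measure_mono) auto
      also have "\<dots> \<le> measure M (?A \<union> ?T) + measure M ?W"
        by (intro measure_Un_le) auto
      also have "measure M (?A \<union> ?T) \<le> measure M ?A + measure M ?T"
        by (intro measure_Un_le) auto
      also have "measure M ?W \<le> expectation (W n) / L"
        using W[OF n1(1)] W_nonneg[OF n1(1)] L
        by (intro integral_Markov_inequality_measure[of _ _ "space M"]) auto
      also have "\<dots> \<le> K / L" using W_bound[OF n1(1)] L by (intro divide_right_mono) auto
      finally have "measure M {\<omega> \<in> space M. \<epsilon> < dist (B n \<omega>) c} < r"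
        using n0[OF n1(2)] L(2) by linarith
      then show "norm (measure M {\<omega> \<in> space M. \<epsilon> < dist (B n \<omega>) c} - 0) < r"
        by simp
    qed
  qed
qed

section \<open>Gradients and Hessians\<close>

lemma directional_derivative:
  fixes h :: "'a::real_normed_vector \<Rightarrow> real"
  assumes "(h has_derivative D) (at (a + s *\<^sub>R v))"
  shows "((\<lambda>t. h (a + t *\<^sub>R v)) has_real_derivative D v) (at s)"
proof -
  have "((\<lambda>t. h (a + t *\<^sub>R v)) has_derivative (\<lambda>t. D (t *\<^sub>R v))) (at s)"
    by (rule has_derivative_compose[of "\<lambda>t. a + t *\<^sub>R v" "\<lambda>t. t *\<^sub>R v" s UNIV h D])
      (auto intro!: derivative_eq_intros assms)
  moreover have "(\<lambda>t. D (t *\<^sub>R v)) = (\<lambda>t. D v * t)"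
    using linear_cmul[OF has_derivative_linear[OF assms]] by auto
  ultimately show ?thesis by (simp add: has_field_derivative_def)
qed

lemma grad_eq:
  assumes "(h has_derivative D) (at a)"
  shows "grad h a $ i = D (axis i 1)"
  unfolding grad_def using directional_derivative[of h D a 0 "axis i 1"] assms
  by (simp add: DERIV_imp_deriv)

lemma hess_eq:
  assumes "(grad h has_derivative G) (at a)"
  shows "hess h a $ i $ j = G (axis j 1) $ i"
proof -
  have "((\<lambda>b. grad h b $ i) has_derivative (\<lambda>v. G v $ i)) (at a)"
    by (rule bounded_linear.has_derivative[OF bounded_linear_vec_nth]) fact
  then have "((\<lambda>t. grad h (a + t *\<^sub>R axis j 1) $ i) has_real_derivative G (axis j 1) $ i) (at 0)"
    by (intro directional_derivative) simp
  then show ?thesis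
    unfolding hess_def by (simp add: DERIV_imp_deriv)
qed

lemma directional_derivative_LIMSEQ:
  fixes h :: "'a::real_normed_vector \<Rightarrow> real"
  assumes "(h has_derivative D) (at a)"
  shows "(\<lambda>n. (h (a + inverse (real (Suc n)) *\<^sub>R v) - h a) * real (Suc n)) \<longlonglongrightarrow> D v"
proof -
  have "((\<lambda>t. h (a + t *\<^sub>R v)) has_real_derivative D v) (at 0)"
    using directional_derivative[of h D a 0 v] assms by simp
  then have "((\<lambda>t. (h (a + t *\<^sub>R v) - h a) / t) \<longlongrightarrow> D v) (at 0)"
    by (simp add: has_field_derivative_iff)
  moreover have "filterlim (\<lambda>n. inverse (real (Suc n))) (at 0) sequentially"
    using LIMSEQ_inverse_real_of_nat by (auto simp: filterlim_at)
  ultimately have "(\<lambda>n. (h (a + inverse (real (Suc n)) *\<^sub>R v) - h a) / inverse (real (Suc n))) \<longlonglongrightarrow> D v"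
    by (rule filterlim_compose)
  then show ?thesis by (simp add: divide_inverse)
qed

text \<open>The partial derivative as a limit along the sequence of increments \<open>1 / (n + 1)\<close>. As a limit of a sequence it
  depends measurably on parameters of \<open>h\<close> at every point \<open>a\<close>, whether or not the derivative exists
  there; \<open>grad\<close> offers this only at points of differentiability.\<close>

definition seq_partial :: "(real^'d \<Rightarrow> real) \<Rightarrow> 'd \<Rightarrow> real^'d \<Rightarrow> real"
  where "seq_partial h i a =
    lim (\<lambda>n. (h (a + inverse (real (Suc n)) *\<^sub>R axis i 1) - h a) * real (Suc n))"

lemma seq_partial_eq_grad:
  assumes "h differentiable (at a)"
  shows "seq_partial h i a = grad h a $ i"
proof -
  obtain D where D: "(h has_derivative D) (at a)" using assms by (auto simp: differentiable_def)
  show ?thesis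
    unfolding seq_partial_def grad_eq[OF D] by (rule limI[OF directional_derivative_LIMSEQ[OF D]])
qed

lemma twice_differentiable_onD:
  assumes "twice_differentiable_on h U" "open U" "a \<in> U"
  shows "h differentiable (at a)" "grad h differentiable (at a)"
  using assms at_within_open[of a U] unfolding twice_differentiable_on_def differentiable_on_def
  by metis+

text \<open>Presents the Hessian as an iterated sequential limit of values of \<open>h\<close>. The points
  \<open>a + axis j 1 / (n + 1)\<close> lie in \<open>U\<close> only from some \<open>n\<close> on, which for a family of functions may differ from
  one function to the next; this is why the inner derivative is \<open>seq_partial\<close>.\<close>

lemma hess_LIMSEQ:
  assumes h: "twice_differentiable_on h U" and U: "open U" "a \<in> U"
  shows "(\<lambda>n. (seq_partial h i (a + inverse (real (Suc n)) *\<^sub>R axis j 1) - seq_partial h i a) * real (Suc n))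
    \<longlonglongrightarrow> hess h a $ i $ j"
proof -
  note d = twice_differentiable_onD[OF h U(1)]
  obtain G where G: "(grad h has_derivative G) (at a)"
    using d(2)[OF U(2)] by (auto simp: differentiable_def)
  have "((\<lambda>b. grad h b $ i) has_derivative (\<lambda>v. G v $ i)) (at a)"
    by (rule bounded_linear.has_derivative[OF bounded_linear_vec_nth]) fact
  from directional_derivative_LIMSEQ[OF this, of "axis j 1"]
  have lim: "(\<lambda>n. (grad h (a + inverse (real (Suc n)) *\<^sub>R axis j 1) $ i - grad h a $ i) * real (Suc n))
      \<longlonglongrightarrow> hess h a $ i $ j"
    by (simp add: hess_eq[OF G])
  have "(\<lambda>n. a + inverse (real (Suc n)) *\<^sub>R axis j 1) \<longlonglongrightarrow> a + 0 *\<^sub>R axis j 1"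
    by (intro tendsto_intros LIMSEQ_inverse_real_of_nat)
  then have "eventually (\<lambda>n. a + inverse (real (Suc n)) *\<^sub>R axis j 1 \<in> U) sequentially"
    using U by (intro topological_tendstoD) auto
  then have "eventually (\<lambda>n. (grad h (a + inverse (real (Suc n)) *\<^sub>R axis j 1) $ i - grad h a $ i) * real (Suc n)
      = (seq_partial h i (a + inverse (real (Suc n)) *\<^sub>R axis j 1) - seq_partial h i a) * real (Suc n)) sequentially"
    by eventually_elim (use d(1) U in \<open>simp add: seq_partial_eq_grad\<close>)
  then show ?thesis using lim by (rule Lim_transform_eventually[rotated])
qed

definition mixed_difference :: "(real^'d \<Rightarrow> real) \<Rightarrow> real^'d \<Rightarrow> 'd \<Rightarrow> 'd \<Rightarrow> real \<Rightarrow> real"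
  where "mixed_difference h a i j t =
    h (a + t *\<^sub>R axis i 1 + t *\<^sub>R axis j 1) - h (a + t *\<^sub>R axis i 1) - h (a + t *\<^sub>R axis j 1) + h a"

text \<open>By the mean value theorem in direction \<open>i\<close>, the mixed difference is \<open>t\<close> times an increment of the
  \<open>i\<close>-th partial derivative over \<open>t\<close> times the \<open>j\<close>-th unit vector, and differentiability of the gradient at
  \<open>a\<close> evaluates this increment up to \<open>o(t)\<close>.\<close>

lemma mixed_difference_tendsto_hess:
  assumes h: "twice_differentiable_on h U" and U: "open U" "a \<in> U"
  shows "((\<lambda>t. mixed_difference h a i j t / t\<^sup>2) \<longlongrightarrow> hess h a $ i $ j) (at_right 0)"
proof (rule tendstoI)
  fix e :: real assume e: "0 < e"
  note d = twice_differentiable_onD[OF h U(1)]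
  obtain G where G: "(grad h has_derivative G) (at a)"
    using d(2)[OF U(2)] by (auto simp: differentiable_def)
  have lin: "linear G" using G by (rule has_derivative_linear)
  \<comment> \<open>The linearization errors at two points within \<open>2 * t\<close> and \<open>t\<close> of \<open>a\<close> add up to \<open>3 * t * e / 4 < e * t\<close>.\<close>
  have "0 < e / 4" using e by simp
  then obtain \<delta>1 where \<delta>1: "0 < \<delta>1"
    "\<And>y. norm (y - a) < \<delta>1 \<Longrightarrow> norm (grad h y - grad h a - G (y - a)) \<le> e / 4 * norm (y - a)"
    using G unfolding has_derivative_at_alt by blast
  obtain \<delta>2 where \<delta>2: "0 < \<delta>2" "ball a \<delta>2 \<subseteq> U" using U openE by blast
  define \<delta> where "\<delta> = min \<delta>1 \<delta>2 / 2"
  have \<delta>: "0 < \<delta>" using \<delta>1 \<delta>2 by (simp add: \<delta>_def)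
  have close: "\<bar>mixed_difference h a i j t / t\<^sup>2 - hess h a $ i $ j\<bar> < e" if t: "0 < t" "t < \<delta>" for t
  proof -
    let ?p = "\<lambda>s. a + s *\<^sub>R axis i 1 + t *\<^sub>R axis j 1" and ?q = "\<lambda>s. a + s *\<^sub>R axis i (1::real)"
    have np: "norm (?p s - a) \<le> 2 * t" "norm (?q s - a) \<le> t" if "0 \<le> s" "s \<le> t" for s
    proof -
      have "norm (?p s - a) \<le> norm (s *\<^sub>R axis i (1::real)) + norm (t *\<^sub>R axis j (1::real))"
        using norm_triangle_ineq[of "s *\<^sub>R axis i (1::real)" "t *\<^sub>R axis j (1::real)"] by (simp add: add.assoc)
      then show "norm (?p s - a) \<le> 2 * t" "norm (?q s - a) \<le> t" using that by (auto simp: norm_axis_1)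
    qed
    have inU: "?p s \<in> U" "?q s \<in> U" "norm (?p s - a) < \<delta>1" "norm (?q s - a) < \<delta>1" if "0 \<le> s" "s \<le> t" for s
    proof -
      have bound: "norm (?p s - a) < min \<delta>1 \<delta>2" "norm (?q s - a) < min \<delta>1 \<delta>2"
        using np[OF that] t by (simp_all add: \<delta>_def)
      then show "norm (?p s - a) < \<delta>1" "norm (?q s - a) < \<delta>1" by auto
      have "?p s \<in> ball a \<delta>2" "?q s \<in> ball a \<delta>2"
        using bound unfolding mem_ball dist_norm norm_minus_commute[of a] by auto
      then show "?p s \<in> U" "?q s \<in> U" using \<delta>2(2) by blast+
    qed
    define \<phi> where "\<phi> s = h (?p s) - h (?q s)" for s
    have der: "(\<phi> has_real_derivative grad h (?p s) $ i - grad h (?q s) $ i) (at s)" if s: "0 \<le> s" "s \<le> t" for s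
    proof -
      obtain D E where DE: "(h has_derivative D) (at (?p s))" "(h has_derivative E) (at (?q s))"
        using d(1)[OF inU(1)[OF s]] d(1)[OF inU(2)[OF s]] by (auto simp: differentiable_def)
      have "((\<lambda>s. h (a + t *\<^sub>R axis j 1 + s *\<^sub>R axis i 1)) has_real_derivative D (axis i 1)) (at s)"
        using DE(1) by (intro directional_derivative) (simp add: ac_simps)
      then have "((\<lambda>s. h (?p s)) has_real_derivative D (axis i 1)) (at s)"
        by (simp add: ac_simps)
      moreover have "((\<lambda>s. h (?q s)) has_real_derivative E (axis i 1)) (at s)"
        by (intro directional_derivative DE(2))
      ultimately show ?thesis
        unfolding \<phi>_def grad_eq[OF DE(1)] grad_eq[OF DE(2)] by (rule DERIV_diff)
    qed
    obtain s where s: "0 < s" "s < t" "\<phi> t - \<phi> 0 = (t - 0) * (grad h (?p s) $ i - grad h (?q s) $ i)"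
      using MVT2[of 0 t \<phi>, OF t(1) der] by blast
    have \<phi>: "\<phi> t - \<phi> 0 = mixed_difference h a i j t" by (simp add: \<phi>_def mixed_difference_def)
    have "G (?p s - a) = G (?q s - a) + t *\<^sub>R G (axis j 1)"
      using linear_add[OF lin, of "s *\<^sub>R axis i 1" "t *\<^sub>R axis j 1"] linear_cmul[OF lin, of t] by simp
    then have "grad h (?p s) $ i - grad h (?q s) $ i - t * hess h a $ i $ j =
      (grad h (?p s) - grad h a - G (?p s - a)) $ i - (grad h (?q s) - grad h a - G (?q s - a)) $ i"
      by (simp add: hess_eq[OF G])
    then have "\<bar>grad h (?p s) $ i - grad h (?q s) $ i - t * hess h a $ i $ j\<bar> \<le>
      norm (grad h (?p s) - grad h a - G (?p s - a)) + norm (grad h (?q s) - grad h a - G (?q s - a))"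
      using component_le_norm_cart[of "grad h (?p s) - grad h a - G (?p s - a)" i]
        component_le_norm_cart[of "grad h (?q s) - grad h a - G (?q s - a)" i] by linarith
    also have "\<dots> \<le> e / 4 * norm (?p s - a) + e / 4 * norm (?q s - a)"
      using s by (intro add_mono \<delta>1(2) inU) auto
    also have "\<dots> \<le> e / 4 * (2 * t) + e / 4 * t"
      using np[of s] s e by (intro add_mono mult_left_mono) auto
    also have "\<dots> < e * t" using e t by simp
    finally have "\<bar>mixed_difference h a i j t / t - t * hess h a $ i $ j\<bar> < e * t"
      using s(3) t unfolding \<phi> by simp
    moreover have "mixed_difference h a i j t / t\<^sup>2 - hess h a $ i $ j =
      (mixed_difference h a i j t / t - t * hess h a $ i $ j) / t"
      using t by (simp add: field_simps power2_eq_square)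
    ultimately show ?thesis using t by (simp add: abs_divide pos_divide_less_eq)
  qed
  show "eventually (\<lambda>t. dist (mixed_difference h a i j t / t\<^sup>2) (hess h a $ i $ j) < e) (at_right 0)"
    unfolding eventually_at_right_field using \<delta> close by (auto simp: dist_real_def)
qed

text \<open>Both mixed partial derivatives are limits of the same quotient, because the mixed difference is symmetric
  in the two directions.\<close>

lemma transpose_hess:
  assumes "twice_differentiable_on h U" "open U" "a \<in> U"
  shows "transpose (hess h a) = hess h a"
proof -
  have "hess h a $ i $ j = hess h a $ j $ i" for i j
  proof (rule tendsto_unique)
    show "((\<lambda>t. mixed_difference h a i j t / t\<^sup>2) \<longlongrightarrow> hess h a $ i $ j) (at_right 0)"
      by (rule mixed_difference_tendsto_hess[OF assms])
    have "mixed_difference h a i j = mixed_difference h a j i"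
      by (auto simp: mixed_difference_def ac_simps)
    then show "((\<lambda>t. mixed_difference h a i j t / t\<^sup>2) \<longlongrightarrow> hess h a $ j $ i) (at_right 0)"
      using mixed_difference_tendsto_hess[OF assms, of j i] by simp
  qed simp
  then show ?thesis by (simp add: transpose_def vec_eq_iff)
qed

section \<open>Norms and integrals of matrices\<close>

text \<open>Half of the equivalence of norms on a finite-dimensional space: \<open>\<nu>\<close> is Lipschitz for the Euclidean
  norm, hence attains a positive minimum on the unit sphere.\<close>

lemma matrix_norm_dominates_norm:
  assumes "is_matrix_norm \<nu>"
  obtains K where "0 < K" "\<And>A :: real^'d^'d. norm A \<le> K * \<nu> A"
proof -
  have nonneg: "0 \<le> \<nu> A" and zero: "\<nu> A = 0 \<longleftrightarrow> A = 0" and scale: "\<nu> (c *\<^sub>R A) = \<bar>c\<bar> * \<nu> A"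
    and tri: "\<nu> (A + B) \<le> \<nu> A + \<nu> B" for A B c
    using assms unfolding is_matrix_norm_def by blast+
  have sum: "\<nu> (sum f S) \<le> (\<Sum>i\<in>S. \<nu> (f i))" if "finite S" for f :: "real^'d^'d \<Rightarrow> _" and S
    using that
  proof (induction S)
    case (insert x S)
    then show ?case using tri[of "f x" "sum f S"] by simp
  qed (use zero[of 0] in simp)
  define L where "L = (\<Sum>b\<in>Basis. \<nu> b)"
  have upper: "\<nu> A \<le> L * norm A" for A
  proof -
    have "\<nu> A = \<nu> (\<Sum>b\<in>Basis. (A \<bullet> b) *\<^sub>R b)" by (simp add: euclidean_representation)
    also have "\<dots> \<le> (\<Sum>b\<in>Basis. \<nu> ((A \<bullet> b) *\<^sub>R b))" by (rule sum) simp
    also have "\<dots> = (\<Sum>b\<in>Basis. \<bar>A \<bullet> b\<bar> * \<nu> b)" by (simp only: scale)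
    also have "\<dots> \<le> (\<Sum>b\<in>Basis. norm A * \<nu> b)"
      by (intro sum_mono mult_right_mono Basis_le_norm nonneg)
    finally show ?thesis by (simp add: L_def sum_distrib_left mult.commute)
  qed
  have L: "0 \<le> L" by (simp add: L_def sum_nonneg nonneg)
  have "\<bar>\<nu> A - \<nu> B\<bar> \<le> L * norm (A - B)" for A B
  proof -
    have "\<nu> A \<le> \<nu> B + \<nu> (A - B)" "\<nu> B \<le> \<nu> A + \<nu> (B - A)"
      using tri[of B "A - B"] tri[of A "B - A"] by auto
    then show ?thesis using upper[of "A - B"] upper[of "B - A"] by (simp add: norm_minus_commute)
  qed
  then have "L-lipschitz_on UNIV \<nu>"
    using L by (intro lipschitz_onI) (auto simp: dist_norm)
  then have cont: "continuous_on (sphere 0 1) \<nu>"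
    by (meson lipschitz_on_continuous_on continuous_on_subset subset_UNIV)
  obtain b :: "real^'d^'d" where "b \<in> Basis" using nonempty_Basis by blast
  then have "sphere (0::real^'d^'d) 1 \<noteq> {}" by (auto simp: sphere_def intro!: exI[of _ b])
  then obtain A0 :: "real^'d^'d" where A0: "A0 \<in> sphere 0 1" "\<And>A. A \<in> sphere 0 1 \<Longrightarrow> \<nu> A0 \<le> \<nu> A"
    using continuous_attains_inf[OF compact_sphere _ cont] by blast
  have pos: "0 < \<nu> A0" using nonneg[of A0] zero[of A0] A0(1) by force
  have "norm A \<le> (1 / \<nu> A0) * \<nu> A" for A :: "real^'d^'d"
  proof (cases "A = 0")
    case False
    then have "\<nu> A0 \<le> \<nu> ((1 / norm A) *\<^sub>R A)" by (intro A0(2)) simp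
    then show ?thesis using False pos by (simp add: scale field_simps)
  qed (use nonneg pos in simp)
  then show ?thesis using that[of "1 / \<nu> A0"] pos by simp
qed

lemma norm_outer: "norm (outer u v) = norm u * norm v"
proof -
  have row: "outer u v $ i = (u $ i) *\<^sub>R v" for i by (simp add: outer_def vec_eq_iff)
  show ?thesis
    unfolding norm_vec_def[of "outer u v"] row norm_scaleR
    by (simp add: norm_vec_def[of u] L2_set_left_distrib)
qed

lemma norm_outer_self_powr: "norm (outer u u) powr (1 + \<eta> / 2) = norm u powr (2 + \<eta>)"
proof -
  have "norm (outer u u) = norm u powr 2" by (simp add: norm_outer power2_eq_square)
  then have "norm (outer u u) powr (1 + \<eta> / 2) = norm u powr (2 * (1 + \<eta> / 2))"
    by (simp only: powr_powr)
  also have "2 * (1 + \<eta> / 2) = 2 + \<eta>" by simp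
  finally show ?thesis .
qed

lemma continuous_on_outer:
  assumes "continuous_on S f" "continuous_on S g"
  shows "continuous_on S (\<lambda>a. outer (f a) (g a))"
  unfolding outer_def by (intro continuous_on_vec_lambda continuous_intros assms)

lemma continuous_on_if_holder:
  fixes f :: "'a::real_normed_vector \<Rightarrow> 'b::real_normed_vector"
  assumes \<kappa>: "0 < \<kappa>" and holder: "\<And>a b. a \<in> S \<Longrightarrow> b \<in> S \<Longrightarrow> norm (f b - f a) \<le> K * norm (b - a) powr \<kappa>"
  shows "continuous_on S f"
  unfolding continuous_on_def
proof
  fix a assume a: "a \<in> S"
  have "((\<lambda>b. norm (b - a)) \<longlongrightarrow> norm (a - a)) (at a within S)" by (intro tendsto_intros)
  then have "((\<lambda>b. norm (b - a)) \<longlongrightarrow> 0) (at a within S)" by simp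
  then have "((\<lambda>b. norm (b - a) powr \<kappa>) \<longlongrightarrow> 0 powr \<kappa>) (at a within S)"
    by (rule tendsto_powr'[OF _ tendsto_const]) (use \<kappa> in auto)
  then have "((\<lambda>b. K * norm (b - a) powr \<kappa>) \<longlongrightarrow> K * 0 powr \<kappa>) (at a within S)"
    by (intro tendsto_mult tendsto_const)
  then have "((\<lambda>b. K * norm (b - a) powr \<kappa>) \<longlongrightarrow> 0) (at a within S)" by simp
  moreover have "eventually (\<lambda>b. norm (f b - f a) \<le> K * norm (b - a) powr \<kappa>) (at a within S)"
    unfolding eventually_at_filter by (intro always_eventually) (auto intro: holder a)
  ultimately have "((\<lambda>b. f b - f a) \<longlongrightarrow> 0) (at a within S)"
    by (rule Lim_null_comparison[rotated])
  then show "(f \<longlongrightarrow> f a) (at a within S)" by (simp add: LIM_zero_iff)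
qed

lemma integral_matrix_entry:
  fixes f :: "'a \<Rightarrow> real^'n^'m"
  assumes "integrable M f"
  shows "(\<integral>x. f x \<partial>M) $ a $ b = (\<integral>x. f x $ a $ b \<partial>M)" "integrable M (\<lambda>x. f x $ a $ b)"
proof -
  have bl: "bounded_linear (\<lambda>A :: real^'n^'m. A $ a $ b)"
    by (rule bounded_linear_compose[OF bounded_linear_vec_nth bounded_linear_vec_nth])
  show "(\<integral>x. f x \<partial>M) $ a $ b = (\<integral>x. f x $ a $ b \<partial>M)"
    using integral_bounded_linear[OF bl assms] by simp
  show "integrable M (\<lambda>x. f x $ a $ b)" by (rule integrable_bounded_linear[OF bl assms])
qed

lemma integral_eq_if_distr_eq:
  fixes h :: "'b \<Rightarrow> 'c::{banach, second_countable_topology}"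
  assumes "distr M N Y = distr M N Z" and [measurable]: "Y \<in> measurable M N" "Z \<in> measurable M N"
    "h \<in> borel_measurable N"
  shows "integrable M (\<lambda>\<omega>. h (Y \<omega>)) \<longleftrightarrow> integrable M (\<lambda>\<omega>. h (Z \<omega>))"
    "(\<integral>\<omega>. h (Y \<omega>) \<partial>M) = (\<integral>\<omega>. h (Z \<omega>) \<partial>M)"
proof -
  note [measurable] = assms(2,3)
  show "integrable M (\<lambda>\<omega>. h (Y \<omega>)) \<longleftrightarrow> integrable M (\<lambda>\<omega>. h (Z \<omega>))"
    using arg_cong[OF assms(1), of "\<lambda>D. integrable D h"] by (simp add: integrable_distr_eq)
  show "(\<integral>\<omega>. h (Y \<omega>) \<partial>M) = (\<integral>\<omega>. h (Z \<omega>) \<partial>M)"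
    using arg_cong[OF assms(1), of "\<lambda>D. integral\<^sup>L D h"] by (simp add: integral_distr)
qed

lemma (in prob_space) integrable_if_powr:
  fixes f :: "'a \<Rightarrow> real"
  assumes [measurable]: "f \<in> borel_measurable M" and nonneg: "\<And>\<omega>. 0 \<le> f \<omega>" and p: "1 \<le> p"
    and fin: "(\<integral>\<^sup>+\<omega>. ennreal (f \<omega> powr p) \<partial>M) < \<infinity>"
  shows "integrable M (\<lambda>\<omega>. f \<omega> powr p)" "integrable M f"
proof -
  show i: "integrable M (\<lambda>\<omega>. f \<omega> powr p)"
    by (rule integrableI_nonneg) (use fin in auto)
  have le: "x \<le> 1 + x powr p" if "0 \<le> x" for x :: real
  proof (cases "x \<le> 1")
    case False
    then have "x powr 1 \<le> x powr p" using p by (intro powr_mono) auto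
    then show ?thesis using False by simp
  next
    case True
    then show ?thesis using powr_ge_zero[of x p] by linarith
  qed
  show "integrable M f"
  proof (rule Bochner_Integration.integrable_bound)
    show "integrable M (\<lambda>\<omega>. 1 + f \<omega> powr p)" using i by simp
    have "norm (f \<omega>) \<le> norm (1 + f \<omega> powr p)" for \<omega>
      using le[OF nonneg[of \<omega>]] nonneg[of \<omega>] by (simp add: abs_of_nonneg)
    then show "AE \<omega> in M. norm (f \<omega>) \<le> norm (1 + f \<omega> powr p)" by simp
  qed measurable
qed

text \<open>The constant is moved to the side of \<open>f\<close>, where measurability is at hand; \<open>g\<close> will be an arbitrary
  matrix norm of a random matrix.\<close>

lemma nn_integral_powr_finite_mono:
  fixes f g :: "'a \<Rightarrow> real"
  assumes f[measurable]: "f \<in> borel_measurable M" and nonneg: "\<And>x. 0 \<le> f x" and le: "\<And>x. f x \<le> K * g x"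
    and K: "0 < K" and p: "0 \<le> p"
    and fin: "(\<integral>\<^sup>+x. ennreal (g x powr p) \<partial>M) < \<infinity>"
  shows "(\<integral>\<^sup>+x. ennreal (f x powr p) \<partial>M) < \<infinity>"
proof -
  have g: "0 \<le> g x" for x using order_trans[OF nonneg le, of x] K by (simp add: zero_le_mult_iff)
  have "(\<integral>\<^sup>+x. ennreal (f x powr p) \<partial>M) = (\<integral>\<^sup>+x. ennreal (K powr p) * ennreal ((f x / K) powr p) \<partial>M)"
    using K by (intro nn_integral_cong) (simp add: powr_divide flip: ennreal_mult)
  also have "\<dots> = ennreal (K powr p) * (\<integral>\<^sup>+x. ennreal ((f x / K) powr p) \<partial>M)"
    by (rule nn_integral_cmult) measurable
  also have "\<dots> \<le> ennreal (K powr p) * (\<integral>\<^sup>+x. ennreal (g x powr p) \<partial>M)"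
    using le nonneg K p
    by (intro mult_left_mono nn_integral_mono ennreal_leI powr_mono2) (simp_all add: pos_divide_le_eq mult.commute)
  also have "\<dots> < \<infinity>" using fin by (simp add: ennreal_mult_less_top)
  finally show ?thesis .
qed

section \<open>The clustered framework\<close>

context clustered_M_estimation
begin

abbreviation N :: "nat \<Rightarrow> real" where "N \<equiv> sample_size m"

lemma sample_size_nonneg: "0 \<le> N n"
  by (simp add: sample_size_def sum_nonneg)

lemma parameter_in: "\<theta> \<in> \<Theta>"
  using parameter_arg_min by (simp add: is_arg_min_def)

lemma estimator_in: "1 \<le> n \<Longrightarrow> \<omega> \<in> space M \<Longrightarrow> est n \<omega> \<in> \<Theta>"
  using estimator_arg_min by (simp add: is_arg_min_def)

lemma random_variable_X1 [measurable]: "X 1 1 \<in> borel_measurable M" "X (Suc 0) (Suc 0) \<in> borel_measurable M"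
  using random_variable_X cluster_size by simp_all

lemma member_law:
  fixes h :: "real^'d \<Rightarrow> 'c::{banach, second_countable_topology}"
  assumes "1 \<le> i" "j \<in> {1..m i}" "h \<in> borel_measurable borel"
  shows "integrable M (\<lambda>\<omega>. h (X i j \<omega>)) \<longleftrightarrow> integrable M (\<lambda>\<omega>. h (X 1 1 \<omega>))"
    "expectation (\<lambda>\<omega>. h (X i j \<omega>)) = expectation (\<lambda>\<omega>. h (X 1 1 \<omega>))"
  using integral_eq_if_distr_eq[OF identically_distributed[OF assms(1,2)]]
    random_variable_X[OF assms(1,2)] assms(3) random_variable_X1(1) by metis+

lemma pair_law:
  fixes h :: "(real^'d) \<times> (real^'d) \<Rightarrow> 'c::{banach, second_countable_topology}"
  assumes "1 \<le> i" "j \<in> {1..m i}" "j' \<in> {1..m i}" "j \<noteq> j'" "h \<in> borel_measurable (borel \<Otimes>\<^sub>M borel)"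
  shows "integrable M (\<lambda>\<omega>. h (X i j \<omega>, X i j' \<omega>)) \<longleftrightarrow> integrable M (\<lambda>\<omega>. h (X i 1 \<omega>, X i 2 \<omega>))"
    "expectation (\<lambda>\<omega>. h (X i j \<omega>, X i j' \<omega>)) = expectation (\<lambda>\<omega>. h (X i 1 \<omega>, X i 2 \<omega>))"
proof -
  have [measurable]: "X i j \<in> borel_measurable M" "X i j' \<in> borel_measurable M"
    "X i 1 \<in> borel_measurable M" "X i 2 \<in> borel_measurable M"
    using assms by (auto intro!: random_variable_X)
  have meas: "(\<lambda>\<omega>. (X i j \<omega>, X i j' \<omega>)) \<in> M \<rightarrow>\<^sub>M borel \<Otimes>\<^sub>M borel"
    "(\<lambda>\<omega>. (X i 1 \<omega>, X i 2 \<omega>)) \<in> M \<rightarrow>\<^sub>M borel \<Otimes>\<^sub>M borel" by measurable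
  note eq = integral_eq_if_distr_eq[OF pairs_identically_distributed[OF assms(1-4), symmetric] meas assms(5)]
  show "integrable M (\<lambda>\<omega>. h (X i j \<omega>, X i j' \<omega>)) \<longleftrightarrow> integrable M (\<lambda>\<omega>. h (X i 1 \<omega>, X i 2 \<omega>))"
    by (rule eq(1))
  show "expectation (\<lambda>\<omega>. h (X i j \<omega>, X i j' \<omega>)) = expectation (\<lambda>\<omega>. h (X i 1 \<omega>, X i 2 \<omega>))"
    by (rule eq(2))
qed

lemma indep_cluster_statistics:
  assumes "\<And>i. 1 \<le> i \<Longrightarrow> G i \<in> borel_measurable (Pi\<^sub>M {1..m i} (\<lambda>_. borel))"
    and "\<And>i \<omega>. 1 \<le> i \<Longrightarrow> Y i \<omega> = G i (\<lambda>j\<in>{1..m i}. X i j \<omega>)"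
  shows "indep_vars (\<lambda>_. borel) Y {1..n}"
proof -
  have "indep_vars (\<lambda>_. borel) (\<lambda>i \<omega>. G i (\<lambda>j\<in>{1..m i}. X i j \<omega>)) {1..}"
    using assms(1) by (intro indep_vars_compose2[OF indep_clusters]) auto
  then have "indep_vars (\<lambda>_. borel) (\<lambda>i \<omega>. G i (\<lambda>j\<in>{1..m i}. X i j \<omega>)) {1..n}"
    by (rule indep_vars_subset) auto
  then show ?thesis
    by (rule indep_vars_cong[THEN iffD1, rotated 3]) (auto simp: assms(2))
qed

lemma score_measurable:
  assumes "a \<in> \<Theta>"
  shows "(\<lambda>x. score \<rho> x a) \<in> borel_measurable borel"
proof (rule borel_measurable_vecI)
  fix i
  note [measurable] = loss_measurable
  have "score \<rho> x a $ i = seq_partial (\<rho> x) i a" for x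
  proof -
    obtain U where U: "open U" "\<Theta> \<subseteq> U" "twice_differentiable_on (\<rho> x) U"
      using loss_twice_differentiable by blast
    then show ?thesis
      using assms twice_differentiable_onD(1)[OF U(3,1), of a] by (auto simp: seq_partial_eq_grad score_def)
  qed
  then show "(\<lambda>x. score \<rho> x a $ i) \<in> borel_measurable borel"
    by (simp add: seq_partial_def)
qed

lemma score_deriv_measurable:
  assumes "a \<in> \<Theta>"
  shows "(\<lambda>x. score_deriv \<rho> x a) \<in> borel_measurable borel"
proof (intro borel_measurable_vecI)
  fix i j
  note [measurable] = loss_measurable
  have [measurable]: "(\<lambda>x. seq_partial (\<rho> x) i b) \<in> borel_measurable borel" for b
    unfolding seq_partial_def by measurable
  show "(\<lambda>x. score_deriv \<rho> x a $ i $ j) \<in> borel_measurable borel"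
  proof (rule borel_measurable_LIMSEQ_metric)
    fix x
    obtain U where U: "open U" "\<Theta> \<subseteq> U" "twice_differentiable_on (\<rho> x) U"
      using loss_twice_differentiable by blast
    then show "(\<lambda>n. (seq_partial (\<rho> x) i (a + inverse (real (Suc n)) *\<^sub>R axis j 1) - seq_partial (\<rho> x) i a)
        * real (Suc n)) \<longlonglongrightarrow> score_deriv \<rho> x a $ i $ j"
      using assms unfolding score_deriv_def by (intro hess_LIMSEQ[OF U(3,1)]) auto
  qed measurable
qed

lemma continuous_on_score: "continuous_on \<Theta> (score \<rho> x)"
proof -
  obtain U where U: "open U" "\<Theta> \<subseteq> U" "twice_differentiable_on (\<rho> x) U"
    using loss_twice_differentiable by blast
  have "score \<rho> x = grad (\<rho> x)" by (auto simp: score_def)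
  then have "score \<rho> x differentiable_on U" using U(3) by (simp add: twice_differentiable_on_def)
  then show ?thesis
    using U(2) differentiable_imp_continuous_on continuous_on_subset by blast
qed

lemma transpose_score_deriv: "a \<in> \<Theta> \<Longrightarrow> transpose (score_deriv \<rho> x a) = score_deriv \<rho> x a"
  using loss_twice_differentiable[of x] transpose_hess[of "\<rho> x" _ a] unfolding score_deriv_def by blast

text \<open>A weighted sum over one cluster has a \<open>p\<close>-th moment of the order of its total weight to the power \<open>p\<close>,
  whatever the dependence within the cluster.\<close>

lemma weighted_cluster_moment:
  fixes v :: "nat \<Rightarrow> real" and g :: "real^'d \<Rightarrow> real"
  assumes i: "1 \<le> i" and v: "\<And>j. j \<in> {1..m i} \<Longrightarrow> 0 \<le> v j" and p: "1 \<le> p"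
    and g: "g \<in> borel_measurable borel" "\<And>x. 0 \<le> g x"
    and int: "integrable M (\<lambda>\<omega>. g (X 1 1 \<omega>) powr p)"
  shows "integrable M (\<lambda>\<omega>. (\<Sum>j=1..m i. v j * g (X i j \<omega>)) powr p)"
    "expectation (\<lambda>\<omega>. (\<Sum>j=1..m i. v j * g (X i j \<omega>)) powr p) \<le>
      (\<Sum>j=1..m i. v j) powr p * expectation (\<lambda>\<omega>. g (X 1 1 \<omega>) powr p)"
proof -
  let ?V = "\<Sum>j=1..m i. v j"
  let ?L = "\<lambda>\<omega>. (\<Sum>j=1..m i. v j * g (X i j \<omega>)) powr p"
  let ?R = "\<lambda>\<omega>. ?V powr (p - 1) * (\<Sum>j=1..m i. v j * g (X i j \<omega>) powr p)"
  note [measurable] = g(1)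
  have X [measurable]: "X i j \<in> borel_measurable M" if "j \<in> {1..m i}" for j
    using random_variable_X[OF i that] .
  have V: "0 \<le> ?V" by (rule sum_nonneg) (use v in auto)
  have le: "?L \<omega> \<le> ?R \<omega>" for \<omega>
    by (rule sum_powr_le) (use v g p in auto)
  have gp: "(\<lambda>x. g x powr p) \<in> borel_measurable borel" by measurable
  have intj: "integrable M (\<lambda>\<omega>. g (X i j \<omega>) powr p)" if "j \<in> {1..m i}" for j
    using member_law(1)[OF i that gp] int by simp
  have R: "integrable M ?R" using intj by auto
  show L: "integrable M ?L"
    by (rule Bochner_Integration.integrable_bound[OF R])
      (use order_trans[OF le abs_ge_self] in auto)
  have "expectation ?L \<le> expectation ?R"
    by (rule integral_mono[OF L R le])
  also have "\<dots> = ?V powr (p - 1) * (\<Sum>j=1..m i. v j * expectation (\<lambda>\<omega>. g (X i j \<omega>) powr p))"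
    using intj by simp
  also have "\<dots> = ?V powr (p - 1) * (\<Sum>j=1..m i. v j * expectation (\<lambda>\<omega>. g (X 1 1 \<omega>) powr p))"
    using member_law(2)[OF i _ gp] by simp
  also have "\<dots> = ?V powr p * expectation (\<lambda>\<omega>. g (X 1 1 \<omega>) powr p)"
    using powr_mult_base[OF V, of "p - 1"] by (simp add: sum_distrib_right[symmetric] mult_ac)
  finally show "expectation ?L \<le> ?V powr p * expectation (\<lambda>\<omega>. g (X 1 1 \<omega>) powr p)" .
qed

section \<open>Weighted averages over the sample\<close>

(* The observation that represents the common law keeps its name X 1 1 under simplification. *)
declare One_nat_def [simp del]

text \<open>The weak law for weighted averages of a function of the observations. The total weights, divided by
  the sample size, bound the mean absolute values of the cluster contributions; their \<open>p\<close>-th powers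
  bound the \<open>p\<close>-th moments.\<close>

lemma weighted_average_law:
  fixes v :: "nat \<Rightarrow> nat \<Rightarrow> real" and g :: "real^'d \<Rightarrow> real"
  assumes v: "\<And>i j. 1 \<le> i \<Longrightarrow> j \<in> {1..m i} \<Longrightarrow> 0 \<le> v i j"
    and total: "(\<lambda>n. \<Sum>i=1..n. (\<Sum>j=1..m i. v i j) / N n) \<longlonglongrightarrow> c"
    and p: "1 < p"
    and negligible: "(\<lambda>n. \<Sum>i=1..n. ((\<Sum>j=1..m i. v i j) / N n) powr p) \<longlonglongrightarrow> 0"
    and g[measurable]: "g \<in> borel_measurable borel"
    and int: "integrable M (\<lambda>\<omega>. \<bar>g (X 1 1 \<omega>)\<bar> powr p)" "integrable M (\<lambda>\<omega>. g (X 1 1 \<omega>))"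
  shows "(\<lambda>n. expectation (\<lambda>\<omega>. \<bar>(\<Sum>i=1..n. (\<Sum>j=1..m i. v i j * g (X i j \<omega>)) / N n)
      - c * expectation (\<lambda>\<omega>. g (X 1 1 \<omega>))\<bar>)) \<longlonglongrightarrow> 0"
proof -
  let ?v = "\<lambda>n i. (\<Sum>j=1..m i. v i j) / N n"
  let ?\<mu> = "expectation (\<lambda>\<omega>. g (X 1 1 \<omega>))"
  define Y where "Y n i \<omega> = (\<Sum>j=1..m i. v i j * g (X i j \<omega>)) / N n" for n i \<omega>
  have gint: "integrable M (\<lambda>\<omega>. g (X i j \<omega>))" and gexp: "expectation (\<lambda>\<omega>. g (X i j \<omega>)) = ?\<mu>"
    if "1 \<le> i" "j \<in> {1..m i}" for i j
    using member_law[OF that g] int(2) by auto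
  have Yint: "integrable M (Y n i)" if "i \<in> {1..n}" for n i
    unfolding Y_def[abs_def] using gint that by (auto intro!: Bochner_Integration.integrable_sum integrable_divide_zero)
  have Yexp: "expectation (Y n i) = ?v n i * ?\<mu>" if "i \<in> {1..n}" for n i
    unfolding Y_def[abs_def] using gint gexp that by (simp add: sum_distrib_right)
  have moment: "integrable M (\<lambda>\<omega>. \<bar>Y n i \<omega>\<bar> powr q)"
    "expectation (\<lambda>\<omega>. \<bar>Y n i \<omega>\<bar> powr q) \<le> ?v n i powr q * expectation (\<lambda>\<omega>. \<bar>g (X 1 1 \<omega>)\<bar> powr q)"
    if i: "i \<in> {1..n}" and q: "1 \<le> q" "integrable M (\<lambda>\<omega>. \<bar>g (X 1 1 \<omega>)\<bar> powr q)" for n i q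
  proof -
    have i1: "1 \<le> i" using i by simp
    have [measurable]: "Y n i \<in> borel_measurable M" using Yint[OF i] by simp
    let ?S = "\<lambda>\<omega>. \<Sum>j=1..m i. v i j / N n * \<bar>g (X i j \<omega>)\<bar>"
    have vN: "0 \<le> v i j / N n" if "j \<in> {1..m i}" for j
      using v[OF i1 that] sample_size_nonneg[of n] by simp
    have le: "\<bar>Y n i \<omega>\<bar> powr q \<le> ?S \<omega> powr q" for \<omega>
    proof (rule powr_mono2)
      have "\<bar>Y n i \<omega>\<bar> = \<bar>\<Sum>j=1..m i. v i j / N n * g (X i j \<omega>)\<bar>"
        by (simp add: Y_def sum_divide_distrib)
      also have "\<dots> \<le> (\<Sum>j=1..m i. \<bar>v i j / N n * g (X i j \<omega>)\<bar>)" by (rule sum_abs)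
      also have "\<dots> = ?S \<omega>" by (intro sum.cong refl) (use vN in \<open>simp only: abs_mult abs_of_nonneg\<close>)
      finally show "\<bar>Y n i \<omega>\<bar> \<le> ?S \<omega>" .
    qed (use q in auto)
    note S = weighted_cluster_moment[of i "\<lambda>j. v i j / N n" q "\<lambda>x. \<bar>g x\<bar>", OF i1 vN q(1) _ _ q(2)]
    have Sint: "integrable M (\<lambda>\<omega>. ?S \<omega> powr q)" by (rule S(1)) auto
    show Yq: "integrable M (\<lambda>\<omega>. \<bar>Y n i \<omega>\<bar> powr q)"
      by (rule Bochner_Integration.integrable_bound[OF Sint]) (use le in auto)
    have "expectation (\<lambda>\<omega>. \<bar>Y n i \<omega>\<bar> powr q) \<le> expectation (\<lambda>\<omega>. ?S \<omega> powr q)"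
      by (rule integral_mono[OF Yq Sint le])
    also have "\<dots> \<le> (\<Sum>j=1..m i. v i j / N n) powr q * expectation (\<lambda>\<omega>. \<bar>g (X 1 1 \<omega>)\<bar> powr q)"
      by (rule S(2)) auto
    finally show "expectation (\<lambda>\<omega>. \<bar>Y n i \<omega>\<bar> powr q) \<le> ?v n i powr q * expectation (\<lambda>\<omega>. \<bar>g (X 1 1 \<omega>)\<bar> powr q)"
      by (simp add: sum_divide_distrib)
  qed
  have v_nonneg: "0 \<le> ?v n i" if "i \<in> {1..n}" for n i
    using that v sample_size_nonneg by (intro divide_nonneg_nonneg sum_nonneg) auto
  obtain K where K: "\<And>n. (\<Sum>i=1..n. ?v n i) \<le> K"
    using convergent_imp_Bseq[OF convergentI[OF total]] by (auto simp: Bseq_def abs_le_iff)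
  let ?E = "expectation (\<lambda>\<omega>. \<bar>g (X 1 1 \<omega>)\<bar>)"
  have L1: "expectation (\<lambda>\<omega>. \<bar>Y n i \<omega>\<bar>) \<le> ?v n i * ?E" if "i \<in> {1..n}" for n i
  proof -
    have "integrable M (\<lambda>\<omega>. \<bar>g (X 1 1 \<omega>)\<bar> powr 1)" using int(2) by simp
    from moment(2)[OF that order_refl this] show ?thesis
      by (simp only: powr_one[OF v_nonneg[OF that]] powr_one[OF abs_ge_zero])
  qed
  have "(\<lambda>n. expectation (\<lambda>\<omega>. \<bar>(\<Sum>i=1..n. Y n i \<omega>) - c * ?\<mu>\<bar>)) \<longlonglongrightarrow> 0"
  proof (rule weak_law_triangular_array_mean[OF _ _ Yint p])
    fix n
    show "indep_vars (\<lambda>_. borel) (Y n) {1..n}"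
      by (rule indep_cluster_statistics[where G="\<lambda>i x. (\<Sum>j=1..m i. v i j * g (x j)) / N n"])
        (auto simp: Y_def)
    have "(\<Sum>i=1..n. expectation (\<lambda>\<omega>. \<bar>Y n i \<omega>\<bar>)) \<le> (\<Sum>i=1..n. ?v n i * ?E)"
      by (intro sum_mono L1)
    also have "\<dots> = (\<Sum>i=1..n. ?v n i) * ?E" by (simp add: sum_distrib_right)
    also have "\<dots> \<le> K * ?E" by (intro mult_right_mono K) simp
    finally show "(\<Sum>i=1..n. expectation (\<lambda>\<omega>. \<bar>Y n i \<omega>\<bar>)) \<le> K * ?E" .
  next
    fix n i :: nat assume "i \<in> {1..n}"
    then show "integrable M (\<lambda>\<omega>. \<bar>Y n i \<omega>\<bar> powr p)" using moment(1) p int(1) by simp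
  next
    show "(\<lambda>n. \<Sum>i=1..n. expectation (\<lambda>\<omega>. \<bar>Y n i \<omega>\<bar> powr p)) \<longlonglongrightarrow> 0"
    proof (rule tendsto_sandwich[of "\<lambda>_. 0"])
      let ?Ep = "expectation (\<lambda>\<omega>. \<bar>g (X 1 1 \<omega>)\<bar> powr p)"
      have "(\<lambda>n. (\<Sum>i=1..n. ?v n i powr p) * ?Ep) \<longlonglongrightarrow> 0 * ?Ep"
        by (intro tendsto_mult negligible tendsto_const)
      then show "(\<lambda>n. (\<Sum>i=1..n. ?v n i powr p) * ?Ep) \<longlonglongrightarrow> 0" by simp
      show "eventually (\<lambda>n. (\<Sum>i=1..n. expectation (\<lambda>\<omega>. \<bar>Y n i \<omega>\<bar> powr p)) \<le>
          (\<Sum>i=1..n. ?v n i powr p) * ?Ep) sequentially"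
        unfolding sum_distrib_right
        by (intro always_eventually allI sum_mono moment(2)) (use p int(1) in auto)
    qed (auto intro!: sum_nonneg always_eventually)
  next
    have "(\<lambda>n. (\<Sum>i=1..n. ?v n i) * ?\<mu>) \<longlonglongrightarrow> c * ?\<mu>"
      by (intro tendsto_mult total tendsto_const)
    then show "(\<lambda>n. \<Sum>i=1..n. expectation (Y n i)) \<longlonglongrightarrow> c * ?\<mu>"
      by (simp add: Yexp sum_distrib_right)
  qed auto
  then show ?thesis by (simp add: Y_def)
qed

text \<open>The common core of the statements on \<open>B_hat\<close> and \<open>V_hat\<close>: the weak law at the true parameter, applied
  entrywise, and the plug-in principle with the weighted average of the Hoelder constants \<open>k\<close> as the factor
  of bounded mean.\<close>

lemma plug_in_weighted_average:
  fixes F :: "real^'d \<Rightarrow> real^'d \<Rightarrow> real^'d^'d" and v :: "nat \<Rightarrow> nat \<Rightarrow> real"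
  assumes consistent: "tendsto_in_prob M est \<theta>"
    and v: "\<And>i j. 1 \<le> i \<Longrightarrow> j \<in> {1..m i} \<Longrightarrow> 0 \<le> v i j"
    and total: "(\<lambda>n. \<Sum>i=1..n. (\<Sum>j=1..m i. v i j) / N n) \<longlonglongrightarrow> c"
    and p: "1 < p"
    and negligible: "(\<lambda>n. \<Sum>i=1..n. ((\<Sum>j=1..m i. v i j) / N n) powr p) \<longlonglongrightarrow> 0"
    and F: "\<And>a. a \<in> \<Theta> \<Longrightarrow> (\<lambda>x. F x a) \<in> borel_measurable borel"
    and cont: "\<And>x. continuous_on \<Theta> (F x)"
    and moment: "(\<integral>\<^sup>+\<omega>. ennreal (norm (F (X 1 1 \<omega>) \<theta>) powr p) \<partial>M) < \<infinity>"
    and \<kappa>: "0 < \<kappa>"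
    and k[measurable]: "k \<in> borel_measurable borel" and k_nonneg: "\<And>x. 0 \<le> k x"
    and k_int: "integrable M (\<lambda>\<omega>. k (X 1 1 \<omega>))"
    and holder: "\<And>x a. a \<in> \<Theta> \<Longrightarrow> norm (F x a - F x \<theta>) \<le> k x * norm (a - \<theta>) powr \<kappa>"
  shows "tendsto_in_prob M
    (\<lambda>n \<omega>. (1 / N n) *\<^sub>R (\<Sum>i=1..n. \<Sum>j=1..m i. v i j *\<^sub>R F (X i j \<omega>) (est n \<omega>)))
    (c *\<^sub>R expectation (\<lambda>\<omega>. F (X 1 1 \<omega>) \<theta>))"
proof -
  define H where "H n a \<omega> = (1 / N n) *\<^sub>R (\<Sum>i=1..n. \<Sum>j=1..m i. v i j *\<^sub>R F (X i j \<omega>) a)" for n a \<omega>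
  define W where "W n \<omega> = (1 / N n) * (\<Sum>i=1..n. \<Sum>j=1..m i. v i j * k (X i j \<omega>))" for n \<omega>
  note [measurable] = F[OF parameter_in]
  have nF: "integrable M (\<lambda>\<omega>. norm (F (X 1 1 \<omega>) \<theta>) powr p)" "integrable M (\<lambda>\<omega>. norm (F (X 1 1 \<omega>) \<theta>))"
    by (rule integrable_if_powr[OF _ norm_ge_zero less_imp_le[OF p] moment], measurable)+
  have F_int: "integrable M (\<lambda>\<omega>. F (X 1 1 \<omega>) \<theta>)"
    by (rule integrable_norm_cancel[OF nF(2)]) simp
  have limit: "tendsto_in_prob M (\<lambda>n. H n \<theta>) (c *\<^sub>R expectation (\<lambda>\<omega>. F (X 1 1 \<omega>) \<theta>))"
  proof (rule tendsto_in_prob_if_entries_mean)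
    fix a b
    define g where "g x = F x \<theta> $ a $ b" for x
    have g[measurable]: "g \<in> borel_measurable borel" unfolding g_def by (intro borel_measurable_matrix_entry F parameter_in)
    have g_le: "\<bar>g x\<bar> \<le> norm (F x \<theta>)" for x
      unfolding g_def by (rule order_trans[OF component_le_norm_cart Finite_Cartesian_Product.norm_nth_le])
    have g1: "integrable M (\<lambda>\<omega>. g (X 1 1 \<omega>))"
      unfolding g_def by (rule integral_matrix_entry(2)[OF F_int])
    have entry: "H n \<theta> \<omega> $ a $ b = (\<Sum>i=1..n. (\<Sum>j=1..m i. v i j * g (X i j \<omega>)) / N n)" for n \<omega>
      by (simp add: H_def g_def sum_divide_distrib)
    have gp: "integrable M (\<lambda>\<omega>. \<bar>g (X 1 1 \<omega>)\<bar> powr p)"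
      by (rule Bochner_Integration.integrable_bound[OF nF(1)])
        (use g_le p in \<open>auto intro!: powr_mono2\<close>)
    have gij: "integrable M (\<lambda>\<omega>. g (X i j \<omega>))" if "1 \<le> i" "j \<in> {1..m i}" for i j
      using member_law(1)[OF that g] g1 by simp
    show "integrable M (\<lambda>\<omega>. H n \<theta> \<omega> $ a $ b)" for n
      unfolding entry using gij by (auto intro!: Bochner_Integration.integrable_sum integrable_divide_zero)
    have "(c *\<^sub>R expectation (\<lambda>\<omega>. F (X 1 1 \<omega>) \<theta>)) $ a $ b = c * expectation (\<lambda>\<omega>. g (X 1 1 \<omega>))"
      by (simp add: integral_matrix_entry(1)[OF F_int] g_def)
    note limit = this
    show "(\<lambda>n. expectation (\<lambda>\<omega>. \<bar>H n \<theta> \<omega> $ a $ b -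
        (c *\<^sub>R expectation (\<lambda>\<omega>. F (X 1 1 \<omega>) \<theta>)) $ a $ b\<bar>)) \<longlonglongrightarrow> 0"
      unfolding entry limit by (rule weighted_average_law[OF v total p negligible g gp g1])
  qed
  have kij: "integrable M (\<lambda>\<omega>. k (X i j \<omega>))" "expectation (\<lambda>\<omega>. k (X i j \<omega>)) = expectation (\<lambda>\<omega>. k (X 1 1 \<omega>))"
    if "1 \<le> i" "j \<in> {1..m i}" for i j
    using member_law[OF that k] k_int by auto
  obtain K where K: "\<And>n. (\<Sum>i=1..n. (\<Sum>j=1..m i. v i j) / N n) \<le> K"
    using convergent_imp_Bseq[OF convergentI[OF total]] by (auto simp: Bseq_def abs_le_iff)
  have "tendsto_in_prob M (\<lambda>n \<omega>. H n (est n \<omega>) \<omega>) (c *\<^sub>R expectation (\<lambda>\<omega>. F (X 1 1 \<omega>) \<theta>))"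
  proof (rule tendsto_in_prob_perturbed[OF limit consistent \<kappa>])
    fix n :: nat assume n: "1 \<le> n"
    have est: "est n \<in> borel_measurable M" using consistent n by (simp add: tendsto_in_prob_def)
    show "(\<lambda>\<omega>. H n (est n \<omega>) \<omega>) \<in> borel_measurable M"
    proof (rule borel_measurable_Caratheodory_compose[where S=\<Theta> and f="\<lambda>\<omega> a. H n a \<omega>" and T="est n"])
      show "(\<lambda>\<omega>. H n a \<omega>) \<in> borel_measurable M" if "a \<in> \<Theta>" for a
        unfolding H_def using measurable_compose[OF random_variable_X F[OF that]] by auto
      show "continuous_on \<Theta> (\<lambda>a. H n a \<omega>)" for \<omega>
        unfolding H_def using cont by (intro continuous_intros)
    qed (use est estimator_in[OF n] in auto)
    show "integrable M (W n)" unfolding W_def using kij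
      by (auto intro!: Bochner_Integration.integrable_sum integrable_mult_right)
    show "0 \<le> W n \<omega>" for \<omega>
      unfolding W_def using v k_nonneg sample_size_nonneg[of n]
      by (intro mult_nonneg_nonneg sum_nonneg) auto
    have "integrable M (\<lambda>\<omega>. \<Sum>j=1..m i. v i j * k (X i j \<omega>))"
      "expectation (\<lambda>\<omega>. \<Sum>j=1..m i. v i j * k (X i j \<omega>)) = (\<Sum>j=1..m i. v i j * expectation (\<lambda>\<omega>. k (X 1 1 \<omega>)))"
      if "1 \<le> i" for i
      using kij[OF that] by (auto intro!: Bochner_Integration.integrable_sum)
    then have "expectation (W n) = 1 / N n * (\<Sum>i=1..n. \<Sum>j=1..m i. v i j * expectation (\<lambda>\<omega>. k (X 1 1 \<omega>)))"
      unfolding W_def by simp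
    also have "\<dots> = (\<Sum>i=1..n. (\<Sum>j=1..m i. v i j) / N n) * expectation (\<lambda>\<omega>. k (X 1 1 \<omega>))"
      by (simp add: sum_divide_distrib sum_distrib_right)
    also have "\<dots> \<le> K * expectation (\<lambda>\<omega>. k (X 1 1 \<omega>))"
      using k_nonneg by (intro mult_right_mono K) simp
    finally show "expectation (W n) \<le> K * expectation (\<lambda>\<omega>. k (X 1 1 \<omega>))" .
    fix \<omega> assume \<omega>: "\<omega> \<in> space M"
    have "dist (H n (est n \<omega>) \<omega>) (H n \<theta> \<omega>) =
      norm ((1 / N n) *\<^sub>R (\<Sum>i=1..n. \<Sum>j=1..m i. v i j *\<^sub>R (F (X i j \<omega>) (est n \<omega>) - F (X i j \<omega>) \<theta>)))"
      by (simp add: dist_norm H_def scaleR_diff_right sum_subtractf)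
    also have "\<dots> = 1 / N n * norm (\<Sum>i=1..n. \<Sum>j=1..m i. v i j *\<^sub>R (F (X i j \<omega>) (est n \<omega>) - F (X i j \<omega>) \<theta>))"
      using sample_size_nonneg[of n] by simp
    also have "\<dots> \<le> 1 / N n * (\<Sum>i=1..n. \<Sum>j=1..m i. v i j * (k (X i j \<omega>) * dist (est n \<omega>) \<theta> powr \<kappa>))"
    proof (intro mult_left_mono sum_norm_le)
      fix i j assume ij: "i \<in> {1..n}" "j \<in> {1..m i}"
      show "norm (v i j *\<^sub>R (F (X i j \<omega>) (est n \<omega>) - F (X i j \<omega>) \<theta>)) \<le>
          v i j * (k (X i j \<omega>) * dist (est n \<omega>) \<theta> powr \<kappa>)"
        using v[of i j] ij holder[OF estimator_in[OF n \<omega>]]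
        by (simp add: dist_norm abs_of_nonneg mult_left_mono)
    qed (use sample_size_nonneg[of n] in simp)
    also have "\<dots> = W n \<omega> * dist (est n \<omega>) \<theta> powr \<kappa>"
      by (simp add: W_def sum_distrib_right mult.assoc)
    finally show "dist (H n (est n \<omega>) \<omega>) (H n \<theta> \<omega>) \<le> W n \<omega> * dist (est n \<omega>) \<theta> powr \<kappa>" .
  qed
  then show ?thesis by (simp add: H_def)
qed

section \<open>Cross products within clusters\<close>

text \<open>The product of two weighted sums over a cluster consists of the pairs of distinct members, which make up
  \<open>C_hat\<close>, and of the diagonal pairs, which make up \<open>B_hat\<close>.\<close>

lemma C_hat_eq:
  "C_hat m X \<rho> w n a \<omega> $ b $ c =
    (\<Sum>i=1..n. (\<Sum>j=1..m i. w i j * score \<rho> (X i j \<omega>) a $ b) * (\<Sum>j=1..m i. w i j * score \<rho> (X i j \<omega>) a $ c) / N n)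
    - B_hat m X \<rho> w n a \<omega> $ b $ c"
proof -
  let ?s = "\<lambda>i j b. score \<rho> (X i j \<omega>) a $ b"
  have "(\<Sum>j=1..m i. w i j * ?s i j b) * (\<Sum>j=1..m i. w i j * ?s i j c) =
    (\<Sum>j=1..m i. \<Sum>j'\<in>{1..m i} - {j}. (w i j * w i j') * (?s i j' b * ?s i j c)) +
    (\<Sum>j=1..m i. (w i j)\<^sup>2 * (?s i j b * ?s i j c))" for i
  proof -
    have "(\<Sum>j=1..m i. w i j * ?s i j b) * (\<Sum>j=1..m i. w i j * ?s i j c) =
      (\<Sum>j=1..m i. w i j * ?s i j c) * (\<Sum>j=1..m i. w i j * ?s i j b)" by (rule mult.commute)
    also have "\<dots> = (\<Sum>j=1..m i. \<Sum>j'=1..m i. (w i j * w i j') * (?s i j' b * ?s i j c))"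
      unfolding sum_product by (intro sum.cong refl) (simp only: mult_ac)
    also have "\<dots> = (\<Sum>j=1..m i. (\<Sum>j'\<in>{1..m i} - {j}. (w i j * w i j') * (?s i j' b * ?s i j c))
        + (w i j)\<^sup>2 * (?s i j b * ?s i j c))"
    proof (intro sum.cong refl)
      fix j assume "j \<in> {1..m i}"
      from sum.remove[OF _ this, of "\<lambda>j'. (w i j * w i j') * (?s i j' b * ?s i j c)"]
      show "(\<Sum>j'=1..m i. (w i j * w i j') * (?s i j' b * ?s i j c)) =
        (\<Sum>j'\<in>{1..m i} - {j}. (w i j * w i j') * (?s i j' b * ?s i j c)) + (w i j)\<^sup>2 * (?s i j b * ?s i j c)"
        by (simp add: power2_eq_square)
    qed
    finally show ?thesis by (simp only: sum.distrib)
  qed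
  then have "(\<Sum>i=1..n. (\<Sum>j=1..m i. w i j * ?s i j b) * (\<Sum>j=1..m i. w i j * ?s i j c) / N n) =
    (1 / N n) * (\<Sum>i=1..n. \<Sum>j=1..m i. \<Sum>j'\<in>{1..m i} - {j}. (w i j * w i j') * (?s i j' b * ?s i j c)) +
    (1 / N n) * (\<Sum>i=1..n. \<Sum>j=1..m i. (w i j)\<^sup>2 * (?s i j b * ?s i j c))"
    by (simp only: sum_divide_distrib[symmetric] sum.distrib add_divide_distrib) simp
  then show ?thesis by (simp add: C_hat_def B_hat_def outer_def)
qed

text \<open>The weak law for the products of the weighted cluster sums \<open>T i a\<close> and \<open>T i b\<close> of score entries. Their
  moments of order \<open>1 + \<eta> / 2\<close> are moments of order \<open>2 + \<eta>\<close> of the weighted sum \<open>R i\<close> of the norms of the scores. The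
  bound on the total mean absolute value comes from \<open>\<bar>x y\<bar> \<le> x\<^sup>2 + y\<^sup>2\<close>, since the means of the
  squares converge.\<close>

lemma cross_product_law:
  assumes a2: "(\<lambda>n. \<Sum>i=1..n. (\<Sum>j=1..m i. (w i j)\<^sup>2) / N n) \<longlonglongrightarrow> c\<^sub>w"
    and b: "(\<lambda>n. (1 / N n) *\<^sub>R (\<Sum>i=1..n. \<Sum>j=1..m i. \<Sum>j'\<in>{1..m i} - {j}.
                (w i j * w i j') *\<^sub>R score_crosscov M X \<rho> \<theta> i)) \<longlonglongrightarrow> C"
    and \<eta>: "0 < \<eta>"
    and moment: "(\<integral>\<^sup>+\<omega>. ennreal (norm (score \<rho> (X 1 1 \<omega>) \<theta>) powr (2 + \<eta>)) \<partial>M) < \<infinity>"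
    and c2: "(\<lambda>n. 1 / N n powr (1 + \<eta> / 2) *
              (\<Sum>i=1..n. (\<Sum>j=1..m i. w i j) powr (2 + \<eta>))) \<longlonglongrightarrow> 0"
  shows "integrable M (\<lambda>\<omega>. \<Sum>i=1..n. (\<Sum>j=1..m i. w i j * score \<rho> (X i j \<omega>) \<theta> $ a) *
        (\<Sum>j=1..m i. w i j * score \<rho> (X i j \<omega>) \<theta> $ b) / N n)" (is "integrable M (\<lambda>\<omega>. ?S n a b \<omega>)")
    and "(\<lambda>n. expectation (\<lambda>\<omega>. \<bar>(\<Sum>i=1..n. (\<Sum>j=1..m i. w i j * score \<rho> (X i j \<omega>) \<theta> $ a) *
        (\<Sum>j=1..m i. w i j * score \<rho> (X i j \<omega>) \<theta> $ b) / N n)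
      - (C $ a $ b + c\<^sub>w * score_cov M X \<rho> \<theta> $ a $ b)\<bar>)) \<longlonglongrightarrow> 0"
proof -
  let ?s = "\<lambda>x. score \<rho> x \<theta>"
  let ?p = "1 + \<eta> / 2"
  have s[measurable]: "?s \<in> borel_measurable borel" by (rule score_measurable[OF parameter_in])
  have sa[measurable]: "(\<lambda>x. ?s x $ a) \<in> borel_measurable borel" for a
    by (rule measurable_compose[OF s borel_measurable_nth])
  define T where "T i a \<omega> = (\<Sum>j=1..m i. w i j * ?s (X i j \<omega>) $ a)" for i a \<omega>
  define Y where "Y a b n i \<omega> = T i a \<omega> * T i b \<omega> / N n" for a b n i \<omega>
  define R where "R i \<omega> = (\<Sum>j=1..m i. w i j * norm (?s (X i j \<omega>)))" for i \<omega>
  have X [measurable]: "X i j \<in> borel_measurable M" if "1 \<le> i" "j \<in> {1..m i}" for i j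
    using random_variable_X that .
  have w: "0 \<le> w i j" if "1 \<le> i" "j \<in> {1..m i}" for i j
    using weights_pos[OF that] by simp
  have mom: "integrable M (\<lambda>\<omega>. norm (?s (X 1 1 \<omega>)) powr (2 + \<eta>))"
    by (rule integrable_if_powr[OF _ norm_ge_zero _ moment]) (use \<eta> in simp_all)
  have sq: "integrable M (\<lambda>\<omega>. norm (?s (X 1 1 \<omega>)) powr 2)"
  proof (rule Bochner_Integration.integrable_bound)
    show "integrable M (\<lambda>\<omega>. 1 + norm (?s (X 1 1 \<omega>)) powr (2 + \<eta>))" using mom by simp
    have "x powr 2 \<le> 1 + x powr (2 + \<eta>)" if "0 \<le> x" for x :: real
    proof (cases "x \<le> 1")
      case True
      then have "x powr 2 \<le> 1 powr 2" using that by (intro powr_mono2) auto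
      then show ?thesis using powr_ge_zero[of x "2 + \<eta>"] unfolding powr_one_eq_one by linarith
    next
      case False
      then have "x powr 2 \<le> x powr (2 + \<eta>)" using \<eta> by (intro powr_mono) auto
      then show ?thesis by simp
    qed
    then show "AE \<omega> in M. norm (norm (?s (X 1 1 \<omega>)) powr 2) \<le> norm (1 + norm (?s (X 1 1 \<omega>)) powr (2 + \<eta>))"
      by (auto intro: order_trans[OF _ abs_ge_self])
  qed measurable
  have s_meas: "(\<lambda>x. norm (?s x)) \<in> borel_measurable borel" by measurable
  have Rmom: "integrable M (\<lambda>\<omega>. R i \<omega> powr q)"
    "expectation (\<lambda>\<omega>. R i \<omega> powr q) \<le> (\<Sum>j=1..m i. w i j) powr q * expectation (\<lambda>\<omega>. norm (?s (X 1 1 \<omega>)) powr q)"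
    if "1 \<le> i" "1 \<le> q" "integrable M (\<lambda>\<omega>. norm (?s (X 1 1 \<omega>)) powr q)" for i q
    unfolding R_def
    by (rule weighted_cluster_moment[OF that(1) w[OF that(1)] that(2) s_meas norm_ge_zero that(3)], assumption)+
  have R_nonneg: "0 \<le> R i \<omega>" if "1 \<le> i" for i \<omega>
    unfolding R_def using w[OF that] by (intro sum_nonneg) auto
  have T_le: "\<bar>T i a \<omega>\<bar> \<le> R i \<omega>" if "1 \<le> i" for i a \<omega>
    unfolding T_def R_def using w[OF that] component_le_norm_cart
    by (intro order_trans[OF sum_abs] sum_mono) (auto simp: abs_mult intro!: mult_left_mono)
  have T_meas: "T i a \<in> borel_measurable M" if "1 \<le> i" for i a
    unfolding T_def[abs_def] using that by measurable
  have Y_meas: "Y a b n i \<in> borel_measurable M" if "i \<in> {1..n}" for a b n i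
    unfolding Y_def[abs_def] using that by (intro borel_measurable_divide borel_measurable_times T_meas) auto
  have Y_le: "\<bar>Y a b n i \<omega>\<bar> \<le> R i \<omega> powr 2 / N n" if "i \<in> {1..n}" for a b n i \<omega>
  proof -
    have i: "1 \<le> i" using that by simp
    have "\<bar>T i a \<omega> * T i b \<omega>\<bar> \<le> R i \<omega> * R i \<omega>"
      unfolding abs_mult using T_le[OF i] R_nonneg[OF i] by (intro mult_mono) auto
    also have "\<dots> = R i \<omega> powr 2" using R_nonneg[OF i, of \<omega>] by (simp add: power2_eq_square)
    finally show ?thesis
      using sample_size_nonneg[of n] by (simp add: Y_def divide_right_mono)
  qed
  have Y_int: "integrable M (Y a b n i)" if "i \<in> {1..n}" for a b n i
  proof (rule Bochner_Integration.integrable_bound)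
    show "integrable M (\<lambda>\<omega>. R i \<omega> powr 2 / N n)"
      using Rmom(1)[OF _ _ sq] that by (intro integrable_divide_zero) auto
    show "AE \<omega> in M. norm (Y a b n i \<omega>) \<le> norm (R i \<omega> powr 2 / N n)"
      by (intro AE_I2) (metis Y_le[OF that] abs_ge_self order_trans real_norm_def)
  qed (rule Y_meas[OF that])
  have Y_powr: "\<bar>Y a b n i \<omega>\<bar> powr ?p \<le> 1 / N n powr ?p * R i \<omega> powr (2 + \<eta>)" if "i \<in> {1..n}" for a b n i \<omega>
  proof -
    have "\<bar>Y a b n i \<omega>\<bar> powr ?p \<le> (R i \<omega> powr 2 / N n) powr ?p"
      using Y_le[OF that] \<eta> by (intro powr_mono2) auto
    also have "\<dots> = (R i \<omega> powr 2) powr ?p / N n powr ?p"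
      by (rule powr_divide)
    also have "(R i \<omega> powr 2) powr ?p = R i \<omega> powr (2 + \<eta>)"
      unfolding powr_powr by (simp add: algebra_simps)
    finally show ?thesis by simp
  qed
  have R_mom: "integrable M (\<lambda>\<omega>. R i \<omega> powr (2 + \<eta>))" if "1 \<le> i" for i
    by (rule Rmom(1)[OF that _ mom]) (use \<eta> in simp)
  have Yp_int: "integrable M (\<lambda>\<omega>. \<bar>Y a b n i \<omega>\<bar> powr ?p)" if "i \<in> {1..n}" for a b n i
  proof (rule Bochner_Integration.integrable_bound)
    show "integrable M (\<lambda>\<omega>. 1 / N n powr ?p * R i \<omega> powr (2 + \<eta>))"
      using R_mom that by (intro integrable_mult_right) auto
    show "AE \<omega> in M. norm (\<bar>Y a b n i \<omega>\<bar> powr ?p) \<le> norm (1 / N n powr ?p * R i \<omega> powr (2 + \<eta>))"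
      using Y_powr[OF that] by (intro AE_I2) (auto intro: order_trans[OF _ abs_ge_self])
  qed (use Y_meas[OF that] in measurable)
  let ?E = "expectation (\<lambda>\<omega>. norm (?s (X 1 1 \<omega>)) powr (2 + \<eta>))"
  have Yp_le: "expectation (\<lambda>\<omega>. \<bar>Y a b n i \<omega>\<bar> powr ?p) \<le>
      1 / N n powr ?p * ((\<Sum>j=1..m i. w i j) powr (2 + \<eta>) * ?E)" if "i \<in> {1..n}" for a b n i
  proof -
    have i: "1 \<le> i" using that by simp
    have "expectation (\<lambda>\<omega>. \<bar>Y a b n i \<omega>\<bar> powr ?p) \<le>
        expectation (\<lambda>\<omega>. 1 / N n powr ?p * R i \<omega> powr (2 + \<eta>))"
      using Yp_int[OF that] R_mom[OF i] Y_powr[OF that]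
      by (intro integral_mono integrable_mult_right) auto
    also have "\<dots> = 1 / N n powr ?p * expectation (\<lambda>\<omega>. R i \<omega> powr (2 + \<eta>))" by simp
    also have "\<dots> \<le> 1 / N n powr ?p * ((\<Sum>j=1..m i. w i j) powr (2 + \<eta>) * ?E)"
      by (intro mult_left_mono Rmom(2)[OF i _ mom]) (use \<eta> in simp_all)
    finally show ?thesis .
  qed
  have small: "(\<lambda>n. \<Sum>i=1..n. expectation (\<lambda>\<omega>. \<bar>Y a b n i \<omega>\<bar> powr ?p)) \<longlonglongrightarrow> 0" for a b
  proof (rule tendsto_sandwich[of "\<lambda>_. 0"])
    have "(\<lambda>n. 1 / N n powr ?p * (\<Sum>i=1..n. (\<Sum>j=1..m i. w i j) powr (2 + \<eta>)) * ?E) \<longlonglongrightarrow> 0 * ?E"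
      by (intro tendsto_mult c2 tendsto_const)
    then show "(\<lambda>n. \<Sum>i=1..n. 1 / N n powr ?p * ((\<Sum>j=1..m i. w i j) powr (2 + \<eta>) * ?E)) \<longlonglongrightarrow> 0"
      by (simp add: sum_distrib_left sum_distrib_right sum_divide_distrib mult_ac)
    show "eventually (\<lambda>n. (\<Sum>i=1..n. expectation (\<lambda>\<omega>. \<bar>Y a b n i \<omega>\<bar> powr ?p)) \<le>
        (\<Sum>i=1..n. 1 / N n powr ?p * ((\<Sum>j=1..m i. w i j) powr (2 + \<eta>) * ?E))) sequentially"
      by (intro always_eventually allI sum_mono Yp_le)
  qed (auto intro!: sum_nonneg always_eventually)
  let ?B = "\<lambda>a b. score_cov M X \<rho> \<theta> $ a $ b" and ?C = "\<lambda>i a b. score_crosscov M X \<rho> \<theta> i $ a $ b"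
  have nint: "integrable M (\<lambda>\<omega>. (norm (?s (X i j \<omega>)))\<^sup>2)" if "1 \<le> i" "j \<in> {1..m i}" for i j
  proof -
    have "integrable M (\<lambda>\<omega>. (norm (?s (X 1 1 \<omega>)))\<^sup>2)" using sq by simp
    then show ?thesis using member_law(1)[OF that, of "\<lambda>x. (norm (?s x))\<^sup>2"] by simp
  qed
  have outer_int: "integrable M (\<lambda>\<omega>. outer (?s (X i j \<omega>)) (?s (X i j' \<omega>)))"
    if ij: "1 \<le> i" "j \<in> {1..m i}" "j' \<in> {1..m i}" for i j j'
  proof (rule Bochner_Integration.integrable_bound)
    show "integrable M (\<lambda>\<omega>. (norm (?s (X i j \<omega>)))\<^sup>2 + (norm (?s (X i j' \<omega>)))\<^sup>2)"
      using nint ij by (intro Bochner_Integration.integrable_add) auto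
    have "x * y \<le> x\<^sup>2 + y\<^sup>2" for x y :: real
      using sum_squares_bound[of x y] sum_power2_ge_zero[of x y] by linarith
    then show "AE \<omega> in M. norm (outer (?s (X i j \<omega>)) (?s (X i j' \<omega>))) \<le>
        norm ((norm (?s (X i j \<omega>)))\<^sup>2 + (norm (?s (X i j' \<omega>)))\<^sup>2)"
      by (auto simp: norm_outer)
    have [measurable]: "X i j \<in> borel_measurable M" "X i j' \<in> borel_measurable M" using ij by (auto intro: X)
    show "(\<lambda>\<omega>. outer (?s (X i j \<omega>)) (?s (X i j' \<omega>))) \<in> borel_measurable M"
      by (intro borel_measurable_vecI) (simp add: outer_def)
  qed
  have entry_int: "integrable M (\<lambda>\<omega>. ?s (X i j \<omega>) $ a * ?s (X i j' \<omega>) $ b)"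
    if "1 \<le> i" "j \<in> {1..m i}" "j' \<in> {1..m i}" for i j j' a b
    using integral_matrix_entry(2)[OF outer_int[OF that], of a b] by (simp add: outer_def)
  have one: "1 \<in> {1..m 1}" using cluster_size[of 1] by simp
  have diag: "expectation (\<lambda>\<omega>. ?s (X i j \<omega>) $ a * ?s (X i j \<omega>) $ b) = ?B a b"
    if "1 \<le> i" "j \<in> {1..m i}" for i j a b
  proof -
    have "expectation (\<lambda>\<omega>. ?s (X i j \<omega>) $ a * ?s (X i j \<omega>) $ b) =
        expectation (\<lambda>\<omega>. ?s (X 1 1 \<omega>) $ a * ?s (X 1 1 \<omega>) $ b)"
      by (rule member_law(2)[OF that]) measurable
    then show ?thesis
      unfolding score_cov_def using integral_matrix_entry(1)[OF outer_int[OF order_refl one one], of a b]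
      by (simp add: outer_def)
  qed
  have off: "expectation (\<lambda>\<omega>. ?s (X i j \<omega>) $ a * ?s (X i j' \<omega>) $ b) = ?C i a b"
    if ij: "1 \<le> i" "j \<in> {1..m i}" "j' \<in> {1..m i}" "j \<noteq> j'" for i j j' a b
  proof -
    have two: "1 \<in> {1..m i}" "2 \<in> {1..m i}" using ij by auto
    have meas: "(\<lambda>z. ?s (fst z) $ a * ?s (snd z) $ b) \<in> borel_measurable (borel \<Otimes>\<^sub>M borel)"
      by measurable
    have "expectation (\<lambda>\<omega>. ?s (X i j \<omega>) $ a * ?s (X i j' \<omega>) $ b) =
        expectation (\<lambda>\<omega>. ?s (X i 1 \<omega>) $ a * ?s (X i 2 \<omega>) $ b)"
      using pair_law(2)[OF ij meas] by simp
    then show ?thesis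
      unfolding score_crosscov_def using integral_matrix_entry(1)[OF outer_int[OF ij(1) two], of a b]
      by (simp add: outer_def)
  qed
  have Y_exp: "expectation (Y a b n i) =
      (\<Sum>j=1..m i. \<Sum>j'\<in>{1..m i} - {j}. w i j * w i j' * ?C i a b) / N n + (\<Sum>j=1..m i. (w i j)\<^sup>2) / N n * ?B a b"
    if "i \<in> {1..n}" for a b n i
  proof -
    have i: "1 \<le> i" using that by simp
    have e: "expectation (\<lambda>\<omega>. ?s (X i j \<omega>) $ a * ?s (X i j' \<omega>) $ b) = (if j = j' then ?B a b else ?C i a b)"
      if "j \<in> {1..m i}" "j' \<in> {1..m i}" for j j'
      using diag[OF i that(1)] off[OF i that] by auto
    have "Y a b n i = (\<lambda>\<omega>. (\<Sum>j=1..m i. \<Sum>j'=1..m i. w i j * w i j' * (?s (X i j \<omega>) $ a * ?s (X i j' \<omega>) $ b)) / N n)"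
      unfolding Y_def T_def sum_product by (simp add: mult_ac)
    moreover have "integrable M (\<lambda>\<omega>. \<Sum>j'=1..m i. w i j * w i j' * (?s (X i j \<omega>) $ a * ?s (X i j' \<omega>) $ b))"
      "expectation (\<lambda>\<omega>. \<Sum>j'=1..m i. w i j * w i j' * (?s (X i j \<omega>) $ a * ?s (X i j' \<omega>) $ b)) =
        (\<Sum>j'=1..m i. w i j * w i j' * expectation (\<lambda>\<omega>. ?s (X i j \<omega>) $ a * ?s (X i j' \<omega>) $ b))"
      if "j \<in> {1..m i}" for j
      using entry_int[OF i that] by (auto intro!: Bochner_Integration.integrable_sum)
    ultimately have "expectation (Y a b n i) =
      (\<Sum>j=1..m i. \<Sum>j'=1..m i. w i j * w i j' * expectation (\<lambda>\<omega>. ?s (X i j \<omega>) $ a * ?s (X i j' \<omega>) $ b)) / N n"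
      by simp
    also have "(\<Sum>j=1..m i. \<Sum>j'=1..m i. w i j * w i j' * expectation (\<lambda>\<omega>. ?s (X i j \<omega>) $ a * ?s (X i j' \<omega>) $ b)) =
      (\<Sum>j=1..m i. \<Sum>j'=1..m i. w i j * w i j' * (if j = j' then ?B a b else ?C i a b))"
      by (intro sum.cong refl) (simp add: e)
    also have "\<dots> = (\<Sum>j=1..m i. (\<Sum>j'\<in>{1..m i} - {j}. w i j * w i j' * ?C i a b) + (w i j)\<^sup>2 * ?B a b)"
      by (intro sum.cong refl) (auto simp: sum.remove power2_eq_square intro!: sum.cong)
    finally show ?thesis
      by (simp add: sum.distrib add_divide_distrib sum_distrib_right)
  qed
  have mean: "(\<lambda>n. \<Sum>i=1..n. expectation (Y a b n i)) \<longlonglongrightarrow> C $ a $ b + c\<^sub>w * ?B a b" for a b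
  proof -
    have "(\<lambda>n. ((1 / N n) *\<^sub>R (\<Sum>i=1..n. \<Sum>j=1..m i. \<Sum>j'\<in>{1..m i} - {j}.
                (w i j * w i j') *\<^sub>R score_crosscov M X \<rho> \<theta> i)) $ a $ b) \<longlonglongrightarrow> C $ a $ b"
      by (intro tendsto_vec_nth b)
    then have 1: "(\<lambda>n. \<Sum>i=1..n. (\<Sum>j=1..m i. \<Sum>j'\<in>{1..m i} - {j}. w i j * w i j' * ?C i a b) / N n) \<longlonglongrightarrow> C $ a $ b"
      by (simp add: sum_divide_distrib)
    have "(\<lambda>n. (\<Sum>i=1..n. (\<Sum>j=1..m i. \<Sum>j'\<in>{1..m i} - {j}. w i j * w i j' * ?C i a b) / N n)
       + (\<Sum>i=1..n. (\<Sum>j=1..m i. (w i j)\<^sup>2) / N n) * ?B a b) \<longlonglongrightarrow> C $ a $ b + c\<^sub>w * ?B a b"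
      by (intro tendsto_add tendsto_mult 1 a2 tendsto_const)
    then show ?thesis by (simp add: Y_exp sum.distrib sum_distrib_right)
  qed
  \<comment> \<open>The sums of the means of the squares converge for each of the finitely many entries, which gives one bound
    for all entries.\<close>
  obtain K where K: "\<And>n. (\<Sum>i=1..n. expectation (Y a a n i)) + (\<Sum>i=1..n. expectation (Y b b n i)) \<le> K" for a b
  proof -
    have "\<exists>K. \<forall>n. (\<Sum>i=1..n. expectation (Y a a n i)) \<le> K" for a
      using convergent_imp_Bseq[OF convergentI[OF mean[of a a]]] by (auto simp: Bseq_def abs_le_iff)
    then obtain k where k: "\<And>a n. (\<Sum>i=1..n. expectation (Y a a n i)) \<le> k a" by metis
    have "k a \<le> (\<Sum>a\<in>UNIV. \<bar>k a\<bar>)" for a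
      by (rule order_trans[OF abs_ge_self]) (auto intro: member_le_sum)
    then show ?thesis
      using that[of "2 * (\<Sum>a\<in>UNIV. \<bar>k a\<bar>)"] k by (smt (verit))
  qed
  have L1: "(\<Sum>i=1..n. expectation (\<lambda>\<omega>. \<bar>Y a b n i \<omega>\<bar>)) \<le> K" for n a b
  proof -
    have "expectation (\<lambda>\<omega>. \<bar>Y a b n i \<omega>\<bar>) \<le> expectation (Y a a n i) + expectation (Y b b n i)"
      if i: "i \<in> {1..n}" for i
    proof -
      have "\<bar>x * y\<bar> \<le> x * x + y * y" for x y :: real
        using sum_squares_bound[of x y] sum_squares_bound[of x "- y"] sum_power2_ge_zero[of x y]
        by (simp add: abs_le_iff power2_eq_square)
      then have le: "\<bar>Y a b n i \<omega>\<bar> \<le> Y a a n i \<omega> + Y b b n i \<omega>" for \<omega>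
        using sample_size_nonneg[of n]
        by (auto simp: Y_def add_divide_distrib[symmetric] intro!: divide_right_mono)
      have "expectation (\<lambda>\<omega>. \<bar>Y a b n i \<omega>\<bar>) \<le> expectation (\<lambda>\<omega>. Y a a n i \<omega> + Y b b n i \<omega>)"
        using Y_int[OF i] le by (intro integral_mono) auto
      then show ?thesis using Y_int[OF i] by simp
    qed
    then have "(\<Sum>i=1..n. expectation (\<lambda>\<omega>. \<bar>Y a b n i \<omega>\<bar>)) \<le>
        (\<Sum>i=1..n. expectation (Y a a n i) + expectation (Y b b n i))" by (rule sum_mono)
    also have "\<dots> \<le> K" using K by (simp add: sum.distrib)
    finally show ?thesis .
  qed
  have "(\<lambda>n. expectation (\<lambda>\<omega>. \<bar>(\<Sum>i=1..n. Y a b n i \<omega>) - (C $ a $ b + c\<^sub>w * ?B a b)\<bar>)) \<longlonglongrightarrow> 0"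
  proof (rule weak_law_triangular_array_mean[OF _ _ Y_int _ Yp_int L1 small mean])
    fix n
    show "indep_vars (\<lambda>_. borel) (Y a b n) {1..n}"
      by (rule indep_cluster_statistics[where
          G="\<lambda>i x. (\<Sum>j=1..m i. w i j * ?s (x j) $ a) * (\<Sum>j=1..m i. w i j * ?s (x j) $ b) / N n"])
        (auto simp: Y_def T_def)
  qed (use \<eta> in auto)
  then show "(\<lambda>n. expectation (\<lambda>\<omega>. \<bar>(\<Sum>i=1..n. (\<Sum>j=1..m i. w i j * ?s (X i j \<omega>) $ a) *
        (\<Sum>j=1..m i. w i j * ?s (X i j \<omega>) $ b) / N n) - (C $ a $ b + c\<^sub>w * ?B a b)\<bar>)) \<longlonglongrightarrow> 0"
    by (simp add: Y_def T_def)
  have "integrable M (\<lambda>\<omega>. \<Sum>i=1..n. Y a b n i \<omega>)"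
    by (intro Bochner_Integration.integrable_sum Y_int)
  then show "integrable M (\<lambda>\<omega>. ?S n a b \<omega>)" by (simp add: Y_def T_def)
qed

lemma B_hat_entry_law:
  assumes a2: "(\<lambda>n. \<Sum>i=1..n. (\<Sum>j=1..m i. (w i j)\<^sup>2) / N n) \<longlonglongrightarrow> c\<^sub>w"
    and \<eta>: "0 < \<eta>"
    and moment: "(\<integral>\<^sup>+\<omega>. ennreal (norm (score \<rho> (X 1 1 \<omega>) \<theta>) powr (2 + \<eta>)) \<partial>M) < \<infinity>"
    and e1: "(\<lambda>n. \<Sum>i=1..n. ((\<Sum>j=1..m i. (w i j)\<^sup>2) / N n) powr (1 + \<eta> / 2)) \<longlonglongrightarrow> 0"
  shows "integrable M (\<lambda>\<omega>. B_hat m X \<rho> w n \<theta> \<omega> $ a $ b)"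
    "(\<lambda>n. expectation (\<lambda>\<omega>. \<bar>B_hat m X \<rho> w n \<theta> \<omega> $ a $ b - c\<^sub>w * score_cov M X \<rho> \<theta> $ a $ b\<bar>)) \<longlonglongrightarrow> 0"
proof -
  let ?s = "\<lambda>x. score \<rho> x \<theta>"
  define g where "g x = outer (?s x) (?s x) $ a $ b" for x
  have s[measurable]: "?s \<in> borel_measurable borel" by (rule score_measurable[OF parameter_in])
  have o: "(\<lambda>x. outer (?s x) (?s x)) \<in> borel_measurable borel" by (rule borel_measurable_outer[OF s s])
  have o'[measurable]: "(\<lambda>\<omega>. outer (?s (X 1 1 \<omega>)) (?s (X 1 1 \<omega>))) \<in> borel_measurable M"
    by (rule measurable_compose[OF random_variable_X1(1) o])
  have g: "g \<in> borel_measurable borel" unfolding g_def by (rule borel_measurable_matrix_entry[OF o])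
  have o_int: "integrable M (\<lambda>\<omega>. norm (outer (?s (X 1 1 \<omega>)) (?s (X 1 1 \<omega>))) powr (1 + \<eta> / 2))"
    "integrable M (\<lambda>\<omega>. norm (outer (?s (X 1 1 \<omega>)) (?s (X 1 1 \<omega>))))"
    using moment \<eta> by (intro integrable_if_powr[where p="1 + \<eta> / 2"]; simp add: norm_outer_self_powr)+
  have O: "integrable M (\<lambda>\<omega>. outer (?s (X 1 1 \<omega>)) (?s (X 1 1 \<omega>)))"
    by (rule integrable_norm_cancel[OF o_int(2) o'])
  have g1: "integrable M (\<lambda>\<omega>. g (X 1 1 \<omega>))"
    unfolding g_def by (rule integral_matrix_entry(2)[OF O])
  have gp: "integrable M (\<lambda>\<omega>. \<bar>g (X 1 1 \<omega>)\<bar> powr (1 + \<eta> / 2))"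
  proof (rule Bochner_Integration.integrable_bound[OF o_int(1)])
    have "\<bar>g x\<bar> \<le> norm (outer (?s x) (?s x))" for x
      unfolding g_def by (rule order_trans[OF component_le_norm_cart Finite_Cartesian_Product.norm_nth_le])
    then show "AE \<omega> in M. norm (\<bar>g (X 1 1 \<omega>)\<bar> powr (1 + \<eta> / 2)) \<le>
        norm (norm (outer (?s (X 1 1 \<omega>)) (?s (X 1 1 \<omega>))) powr (1 + \<eta> / 2))"
      using \<eta> by (intro AE_I2) (simp add: powr_mono2)
  qed (use g in measurable)
  have entry: "B_hat m X \<rho> w n \<theta> \<omega> $ a $ b = (\<Sum>i=1..n. (\<Sum>j=1..m i. (w i j)\<^sup>2 * g (X i j \<omega>)) / N n)" for n \<omega>
    by (simp add: B_hat_def g_def sum_divide_distrib)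
  have mean: "score_cov M X \<rho> \<theta> $ a $ b = expectation (\<lambda>\<omega>. g (X 1 1 \<omega>))"
    unfolding score_cov_def g_def by (rule integral_matrix_entry(1)[OF O])
  have gij: "integrable M (\<lambda>\<omega>. g (X i j \<omega>))" if "1 \<le> i" "j \<in> {1..m i}" for i j
    using member_law(1)[OF that g] g1 by simp
  show "integrable M (\<lambda>\<omega>. B_hat m X \<rho> w n \<theta> \<omega> $ a $ b)"
    unfolding entry using gij by (auto intro!: Bochner_Integration.integrable_sum integrable_divide_zero)
  show "(\<lambda>n. expectation (\<lambda>\<omega>. \<bar>B_hat m X \<rho> w n \<theta> \<omega> $ a $ b - c\<^sub>w * score_cov M X \<rho> \<theta> $ a $ b\<bar>)) \<longlonglongrightarrow> 0"
    unfolding entry mean by (rule weighted_average_law[OF _ a2 _ e1 g gp g1]) (use \<eta> in auto)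
qed

lemma C_hat_parameter_law:
  assumes a2: "(\<lambda>n. \<Sum>i=1..n. (\<Sum>j=1..m i. (w i j)\<^sup>2) / N n) \<longlonglongrightarrow> c\<^sub>w"
    and b: "(\<lambda>n. (1 / N n) *\<^sub>R (\<Sum>i=1..n. \<Sum>j=1..m i. \<Sum>j'\<in>{1..m i} - {j}.
                (w i j * w i j') *\<^sub>R score_crosscov M X \<rho> \<theta> i)) \<longlonglongrightarrow> C"
    and \<eta>: "0 < \<eta>"
    and moment: "(\<integral>\<^sup>+\<omega>. ennreal (norm (score \<rho> (X 1 1 \<omega>) \<theta>) powr (2 + \<eta>)) \<partial>M) < \<infinity>"
    and c2: "(\<lambda>n. 1 / N n powr (1 + \<eta> / 2) *
              (\<Sum>i=1..n. (\<Sum>j=1..m i. w i j) powr (2 + \<eta>))) \<longlonglongrightarrow> 0"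
    and e1: "(\<lambda>n. \<Sum>i=1..n. ((\<Sum>j=1..m i. (w i j)\<^sup>2) / N n) powr (1 + \<eta> / 2)) \<longlonglongrightarrow> 0"
  shows "tendsto_in_prob M (\<lambda>n. C_hat m X \<rho> w n \<theta>) C"
proof (rule tendsto_in_prob_if_entries_mean)
  fix a b
  define S where "S n \<omega> = (\<Sum>i=1..n. (\<Sum>j=1..m i. w i j * score \<rho> (X i j \<omega>) \<theta> $ a) *
    (\<Sum>j=1..m i. w i j * score \<rho> (X i j \<omega>) \<theta> $ b) / N n)" for n \<omega>
  define B where "B n \<omega> = B_hat m X \<rho> w n \<theta> \<omega> $ a $ b" for n \<omega>
  let ?c = "c\<^sub>w * score_cov M X \<rho> \<theta> $ a $ b"
  have eq: "C_hat m X \<rho> w n \<theta> \<omega> $ a $ b = S n \<omega> - B n \<omega>" for n \<omega>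
    unfolding S_def B_def by (rule C_hat_eq)
  have S: "integrable M (S n)" "(\<lambda>n. expectation (\<lambda>\<omega>. \<bar>S n \<omega> - (C $ a $ b + ?c)\<bar>)) \<longlonglongrightarrow> 0" for n
    unfolding S_def[abs_def] by (rule cross_product_law[OF a2 assms(2) \<eta> moment c2])+
  have B: "integrable M (B n)" "(\<lambda>n. expectation (\<lambda>\<omega>. \<bar>B n \<omega> - ?c\<bar>)) \<longlonglongrightarrow> 0" for n
    unfolding B_def[abs_def] by (rule B_hat_entry_law[OF a2 \<eta> moment e1])+
  show "integrable M (\<lambda>\<omega>. C_hat m X \<rho> w n \<theta> \<omega> $ a $ b)" for n
    unfolding eq using S(1) B(1) by simp
  show "(\<lambda>n. expectation (\<lambda>\<omega>. \<bar>C_hat m X \<rho> w n \<theta> \<omega> $ a $ b - C $ a $ b\<bar>)) \<longlonglongrightarrow> 0"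
  proof (rule tendsto_sandwich[of "\<lambda>_. 0"])
    show "(\<lambda>n. expectation (\<lambda>\<omega>. \<bar>S n \<omega> - (C $ a $ b + ?c)\<bar>) + expectation (\<lambda>\<omega>. \<bar>B n \<omega> - ?c\<bar>)) \<longlonglongrightarrow> 0"
      using tendsto_add[OF S(2) B(2)] by simp
    have "expectation (\<lambda>\<omega>. \<bar>C_hat m X \<rho> w n \<theta> \<omega> $ a $ b - C $ a $ b\<bar>) \<le>
      expectation (\<lambda>\<omega>. \<bar>S n \<omega> - (C $ a $ b + ?c)\<bar> + \<bar>B n \<omega> - ?c\<bar>)" for n
      unfolding eq using S(1)[of n] B(1)[of n]
      by (intro integral_mono) (auto intro!: Bochner_Integration.integrable_add integrable_abs Bochner_Integration.integrable_diff)
    also have "expectation (\<lambda>\<omega>. \<bar>S n \<omega> - (C $ a $ b + ?c)\<bar> + \<bar>B n \<omega> - ?c\<bar>) =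
        expectation (\<lambda>\<omega>. \<bar>S n \<omega> - (C $ a $ b + ?c)\<bar>) + expectation (\<lambda>\<omega>. \<bar>B n \<omega> - ?c\<bar>)" for n
      using S(1)[of n] B(1)[of n] by simp
    finally show "eventually (\<lambda>n. expectation (\<lambda>\<omega>. \<bar>C_hat m X \<rho> w n \<theta> \<omega> $ a $ b - C $ a $ b\<bar>) \<le>
        expectation (\<lambda>\<omega>. \<bar>S n \<omega> - (C $ a $ b + ?c)\<bar>) + expectation (\<lambda>\<omega>. \<bar>B n \<omega> - ?c\<bar>)) sequentially"
      by simp
  qed auto
qed

text \<open>The factor of bounded mean is the weighted average of \<open>k\<close> over ordered pairs of distinct members of a
  cluster. \<open>C_hat\<close> takes the members of a pair in the order opposite to that in \<open>bounded\<close>; exchangeability of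
  pairs makes the means agree.\<close>

lemma C_hat_plug_in:
  assumes consistent: "tendsto_in_prob M est \<theta>"
    and limit: "tendsto_in_prob M (\<lambda>n. C_hat m X \<rho> w n \<theta>) C"
    and \<kappa>: "0 < \<kappa>"
    and k: "(\<lambda>(x, y). k x y) \<in> borel_measurable (borel \<Otimes>\<^sub>M borel)" and k_nonneg: "\<And>x y. 0 \<le> k x y"
    and holder: "\<And>x y a. a \<in> \<Theta> \<Longrightarrow>
      norm (outer (score \<rho> x a) (score \<rho> y a) - outer (score \<rho> x \<theta>) (score \<rho> y \<theta>)) \<le> k x y * norm (a - \<theta>) powr \<kappa>"
    and k_int: "\<And>i. 1 \<le> i \<Longrightarrow> 2 \<le> m i \<Longrightarrow> integrable M (\<lambda>\<omega>. k (X i 1 \<omega>) (X i 2 \<omega>))"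
    and bounded: "(\<lambda>n. 1 / N n * (\<Sum>i=1..n. \<Sum>j=1..m i. \<Sum>j'\<in>{1..m i} - {j}.
            w i j * w i j' * expectation (\<lambda>\<omega>. k (X i j \<omega>) (X i j' \<omega>)))) \<longlonglongrightarrow> k\<^sub>w"
  shows "tendsto_in_prob M (\<lambda>n \<omega>. C_hat m X \<rho> w n (est n \<omega>) \<omega>) C"
proof -
  define W where "W n \<omega> = 1 / N n * (\<Sum>i=1..n. \<Sum>j=1..m i. \<Sum>j'\<in>{1..m i} - {j}.
    w i j * w i j' * k (X i j' \<omega>) (X i j \<omega>))" for n \<omega>
  have pair: "integrable M (\<lambda>\<omega>. k (X i j \<omega>) (X i j' \<omega>))"
    "expectation (\<lambda>\<omega>. k (X i j \<omega>) (X i j' \<omega>)) = expectation (\<lambda>\<omega>. k (X i 1 \<omega>) (X i 2 \<omega>))"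
    if ij: "1 \<le> i" "j \<in> {1..m i}" "j' \<in> {1..m i}" "j \<noteq> j'" for i j j'
  proof -
    have "2 \<le> m i" using ij by auto
    then show "integrable M (\<lambda>\<omega>. k (X i j \<omega>) (X i j' \<omega>))"
      using pair_law(1)[OF ij k] k_int[OF ij(1)] by simp
    show "expectation (\<lambda>\<omega>. k (X i j \<omega>) (X i j' \<omega>)) = expectation (\<lambda>\<omega>. k (X i 1 \<omega>) (X i 2 \<omega>))"
      using pair_law(2)[OF ij k] by simp
  qed
  have w: "0 \<le> w i j" if "1 \<le> i" "j \<in> {1..m i}" for i j using weights_pos[OF that] by simp
  have inner: "integrable M (\<lambda>\<omega>. \<Sum>j'\<in>{1..m i} - {j}. w i j * w i j' * k (X i j' \<omega>) (X i j \<omega>))"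
    "expectation (\<lambda>\<omega>. \<Sum>j'\<in>{1..m i} - {j}. w i j * w i j' * k (X i j' \<omega>) (X i j \<omega>)) =
      (\<Sum>j'\<in>{1..m i} - {j}. w i j * w i j' * expectation (\<lambda>\<omega>. k (X i j \<omega>) (X i j' \<omega>)))"
    if "1 \<le> i" "j \<in> {1..m i}" for i j
  proof -
    have e: "integrable M (\<lambda>\<omega>. k (X i j' \<omega>) (X i j \<omega>))"
      "expectation (\<lambda>\<omega>. k (X i j' \<omega>) (X i j \<omega>)) = expectation (\<lambda>\<omega>. k (X i j \<omega>) (X i j' \<omega>))"
      if "j' \<in> {1..m i} - {j}" for j'
      using pair[of i j j'] pair[of i j' j] that \<open>1 \<le> i\<close> \<open>j \<in> {1..m i}\<close> by auto
    show "integrable M (\<lambda>\<omega>. \<Sum>j'\<in>{1..m i} - {j}. w i j * w i j' * k (X i j' \<omega>) (X i j \<omega>))"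
      by (intro Bochner_Integration.integrable_sum integrable_mult_right e)
    have "expectation (\<lambda>\<omega>. \<Sum>j'\<in>{1..m i} - {j}. w i j * w i j' * k (X i j' \<omega>) (X i j \<omega>)) =
      (\<Sum>j'\<in>{1..m i} - {j}. expectation (\<lambda>\<omega>. w i j * w i j' * k (X i j' \<omega>) (X i j \<omega>)))"
      by (intro Bochner_Integration.integral_sum integrable_mult_right e)
    also have "\<dots> = (\<Sum>j'\<in>{1..m i} - {j}. w i j * w i j' * expectation (\<lambda>\<omega>. k (X i j \<omega>) (X i j' \<omega>)))"
      by (intro sum.cong refl) (simp add: e(2))
    finally show "expectation (\<lambda>\<omega>. \<Sum>j'\<in>{1..m i} - {j}. w i j * w i j' * k (X i j' \<omega>) (X i j \<omega>)) = \<dots>" .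
  qed
  have middle: "integrable M (\<lambda>\<omega>. \<Sum>j=1..m i. \<Sum>j'\<in>{1..m i} - {j}. w i j * w i j' * k (X i j' \<omega>) (X i j \<omega>))"
    "expectation (\<lambda>\<omega>. \<Sum>j=1..m i. \<Sum>j'\<in>{1..m i} - {j}. w i j * w i j' * k (X i j' \<omega>) (X i j \<omega>)) =
      (\<Sum>j=1..m i. \<Sum>j'\<in>{1..m i} - {j}. w i j * w i j' * expectation (\<lambda>\<omega>. k (X i j \<omega>) (X i j' \<omega>)))"
    if "1 \<le> i" for i
  proof -
    show "integrable M (\<lambda>\<omega>. \<Sum>j=1..m i. \<Sum>j'\<in>{1..m i} - {j}. w i j * w i j' * k (X i j' \<omega>) (X i j \<omega>))"
      by (intro Bochner_Integration.integrable_sum inner(1)[OF that])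
    show "expectation (\<lambda>\<omega>. \<Sum>j=1..m i. \<Sum>j'\<in>{1..m i} - {j}. w i j * w i j' * k (X i j' \<omega>) (X i j \<omega>)) =
      (\<Sum>j=1..m i. \<Sum>j'\<in>{1..m i} - {j}. w i j * w i j' * expectation (\<lambda>\<omega>. k (X i j \<omega>) (X i j' \<omega>)))"
      by (subst Bochner_Integration.integral_sum) (auto intro!: inner(1)[OF that] sum.cong simp: inner(2)[OF that])
  qed
  obtain K where K: "\<And>n. 1 / N n * (\<Sum>i=1..n. \<Sum>j=1..m i. \<Sum>j'\<in>{1..m i} - {j}.
            w i j * w i j' * expectation (\<lambda>\<omega>. k (X i j \<omega>) (X i j' \<omega>))) \<le> K"
    using convergent_imp_Bseq[OF convergentI[OF bounded]] unfolding Bseq_def real_norm_def abs_le_iff by blast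
  show ?thesis
  proof (rule tendsto_in_prob_perturbed[OF limit consistent \<kappa>])
    fix n :: nat assume n: "1 \<le> n"
    have est: "est n \<in> borel_measurable M" using consistent n by (simp add: tendsto_in_prob_def)
    show "(\<lambda>\<omega>. C_hat m X \<rho> w n (est n \<omega>) \<omega>) \<in> borel_measurable M"
    proof (rule borel_measurable_Caratheodory_compose[where S=\<Theta> and f="\<lambda>\<omega> a. C_hat m X \<rho> w n a \<omega>" and T="est n"])
      fix a assume a: "a \<in> \<Theta>"
      have "(\<lambda>\<omega>. score \<rho> (X i j \<omega>) a) \<in> borel_measurable M" if "1 \<le> i" "j \<in> {1..m i}" for i j
        by (rule measurable_compose[OF random_variable_X[OF that] score_measurable[OF a]])
      then show "(\<lambda>\<omega>. C_hat m X \<rho> w n a \<omega>) \<in> borel_measurable M"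
        unfolding C_hat_def
        by (intro borel_measurable_scaleR borel_measurable_sum borel_measurable_const borel_measurable_outer) auto
    next
      show "continuous_on \<Theta> (\<lambda>a. C_hat m X \<rho> w n a \<omega>)" for \<omega>
        unfolding C_hat_def by (intro continuous_intros continuous_on_outer continuous_on_score)
    qed (use est estimator_in[OF n] in auto)
    show "integrable M (W n)"
      unfolding W_def[abs_def] by (intro integrable_mult_right Bochner_Integration.integrable_sum middle(1)) simp
    show "0 \<le> W n \<omega>" for \<omega>
      unfolding W_def using w k_nonneg sample_size_nonneg[of n]
      by (intro mult_nonneg_nonneg sum_nonneg) auto
    have "expectation (W n) = 1 / N n * (\<Sum>i=1..n. expectation (\<lambda>\<omega>.
        \<Sum>j=1..m i. \<Sum>j'\<in>{1..m i} - {j}. w i j * w i j' * k (X i j' \<omega>) (X i j \<omega>)))"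
      unfolding W_def[abs_def] integral_mult_right_zero
      by (subst Bochner_Integration.integral_sum) (use middle(1) in auto)
    also have "\<dots> = 1 / N n * (\<Sum>i=1..n. \<Sum>j=1..m i. \<Sum>j'\<in>{1..m i} - {j}.
            w i j * w i j' * expectation (\<lambda>\<omega>. k (X i j \<omega>) (X i j' \<omega>)))"
      by (intro arg_cong[where f="\<lambda>x. 1 / N n * x"] sum.cong refl middle(2)) simp
    also have "\<dots> \<le> K" by (rule K)
    finally show "expectation (W n) \<le> K" .
    fix \<omega> assume \<omega>: "\<omega> \<in> space M"
    let ?o = "\<lambda>i j j' a. outer (score \<rho> (X i j' \<omega>) a) (score \<rho> (X i j \<omega>) a)"
    have "dist (C_hat m X \<rho> w n (est n \<omega>) \<omega>) (C_hat m X \<rho> w n \<theta> \<omega>) =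
      norm ((1 / N n) *\<^sub>R (\<Sum>i=1..n. \<Sum>j=1..m i. \<Sum>j'\<in>{1..m i} - {j}.
        (w i j * w i j') *\<^sub>R (?o i j j' (est n \<omega>) - ?o i j j' \<theta>)))"
      by (simp only: dist_norm C_hat_def scaleR_diff_right sum_subtractf)
    also have "\<dots> = 1 / N n * norm (\<Sum>i=1..n. \<Sum>j=1..m i. \<Sum>j'\<in>{1..m i} - {j}.
        (w i j * w i j') *\<^sub>R (?o i j j' (est n \<omega>) - ?o i j j' \<theta>))"
      using sample_size_nonneg[of n] by simp
    also have "\<dots> \<le> 1 / N n * (\<Sum>i=1..n. \<Sum>j=1..m i. \<Sum>j'\<in>{1..m i} - {j}.
        w i j * w i j' * (k (X i j' \<omega>) (X i j \<omega>) * dist (est n \<omega>) \<theta> powr \<kappa>))"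
    proof (intro mult_left_mono sum_norm_le)
      fix i j j' assume ij: "i \<in> {1..n}" "j \<in> {1..m i}" "j' \<in> {1..m i} - {j}"
      have "0 \<le> w i j * w i j'" using w[of i j] w[of i j'] ij by simp
      then show "norm ((w i j * w i j') *\<^sub>R (?o i j j' (est n \<omega>) - ?o i j j' \<theta>)) \<le>
          w i j * w i j' * (k (X i j' \<omega>) (X i j \<omega>) * dist (est n \<omega>) \<theta> powr \<kappa>)"
        using mult_left_mono[OF holder[OF estimator_in[OF n \<omega>], of "X i j' \<omega>" "X i j \<omega>"], of "w i j * w i j'"]
        by (simp add: dist_norm abs_of_nonneg)
    qed (use sample_size_nonneg[of n] in simp)
    also have "\<dots> = W n \<omega> * dist (est n \<omega>) \<theta> powr \<kappa>"
      by (simp only: W_def sum_distrib_right sum_distrib_left mult.assoc)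
    finally show "dist (C_hat m X \<rho> w n (est n \<omega>) \<omega>) (C_hat m X \<rho> w n \<theta> \<omega>) \<le> W n \<omega> * dist (est n \<omega>) \<theta> powr \<kappa>" .
  qed
qed

end

text \<open>The Euclidean norm is at most a constant \<open>L\<close> times \<open>\<nu>\<close>, so all moment and Hoelder conditions
  pass to the Euclidean norm, with \<open>L * k\<close> in place of \<open>k\<close>. The exponents are \<open>p = 1 + \<delta>\<close> for \<open>V_hat\<close> and
  \<open>p = 1 + \<eta> / 2\<close> for the other two.\<close>

theorem theorem4p1:
  fixes M :: "'w measure"
    and m :: "nat \<Rightarrow> nat"
    and X :: "nat \<Rightarrow> nat \<Rightarrow> 'w \<Rightarrow> real^'d"
    and l :: real
    and \<Theta> :: "(real^'d) set"
    and \<theta> :: "real^'d"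
    and \<rho> :: "real^'d \<Rightarrow> real^'d \<Rightarrow> real"
    and w :: "nat \<Rightarrow> nat \<Rightarrow> real"
    and est :: "nat \<Rightarrow> 'w \<Rightarrow> real^'d"
    and \<nu> :: "real^'d^'d \<Rightarrow> real"
    and c\<^sub>w \<eta> \<delta> :: real
    and C :: "real^'d^'d"
  assumes framework: "clustered_M_estimation M m X l \<Theta> \<theta> \<rho> w est"
    and matrix_norm: "is_matrix_norm \<nu>"
    and consistent: "tendsto_in_prob M est \<theta>"
    and V_invertible: "invertible (mean_score_deriv M X \<rho> \<theta>)"
    and a1: "(\<lambda>n. \<Sum>i=1..n. (\<Sum>j=1..m i. w i j) / sample_size m n) \<longlonglongrightarrow> 1"
    and a2: "(\<lambda>n. 1 / sample_size m n * (\<Sum>i=1..n. \<Sum>j=1..m i. (w i j)\<^sup>2)) \<longlonglongrightarrow> c\<^sub>w"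
    and b: "(\<lambda>n. (1 / sample_size m n) *\<^sub>R
              (\<Sum>i=1..n. \<Sum>j=1..m i. \<Sum>j'\<in>{1..m i} - {j}.
                (w i j * w i j') *\<^sub>R score_crosscov M X \<rho> \<theta> i)) \<longlonglongrightarrow> C"
    and c1: "0 < \<eta>"
      "(\<integral>\<^sup>+\<omega>. ennreal (norm (score \<rho> (X 1 1 \<omega>) \<theta>) powr (2 + \<eta>)) \<partial>M) < \<infinity>"
    and c2: "(\<lambda>n. 1 / sample_size m n powr (1 + \<eta> / 2) *
              (\<Sum>i=1..n. (\<Sum>j=1..m i. w i j) powr (2 + \<eta>))) \<longlonglongrightarrow> 0"
    and d1: "0 < \<delta>"
      "(\<integral>\<^sup>+\<omega>. ennreal (\<nu> (score_deriv \<rho> (X 1 1 \<omega>) \<theta>) powr (1 + \<delta>)) \<partial>M) < \<infinity>"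
    and d2: "\<exists>\<kappa> k. 0 < \<kappa> \<and> \<kappa> \<le> 1 \<and>
              k \<in> borel_measurable borel \<and> (\<forall>x. 0 \<le> k x) \<and>
              (\<forall>x. \<forall>a1\<in>\<Theta>. \<forall>a2\<in>\<Theta>.
                \<nu> (score_deriv \<rho> x a2 - score_deriv \<rho> x a1) \<le> k x * norm (a2 - a1) powr \<kappa>) \<and>
              (\<integral>\<^sup>+\<omega>. ennreal (k (X 1 1 \<omega>) powr (1 + \<delta>)) \<partial>M) < \<infinity>"
    and d3: "(\<lambda>n. \<Sum>i=1..n. ((\<Sum>j=1..m i. w i j) / sample_size m n) powr (1 + \<delta>)) \<longlonglongrightarrow> 0"
    and e1: "(\<lambda>n. \<Sum>i=1..n. ((\<Sum>j=1..m i. (w i j)\<^sup>2) / sample_size m n) powr (1 + \<eta> / 2))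
              \<longlonglongrightarrow> 0"
    and e2: "(\<lambda>n. \<Sum>i=1..n. ((\<Sum>j=1..m i. \<Sum>j'\<in>{1..m i} - {j}. w i j * w i j')
                / sample_size m n) powr (1 + \<eta> / 2)) \<longlonglongrightarrow> 0"
  shows
    "((SUP a\<in>\<Theta>. \<integral>\<^sup>+\<omega>. ennreal (norm (score \<rho> (X 1 1 \<omega>) a) powr (2 + \<eta>)) \<partial>M) < \<infinity> \<and>
      (\<exists>\<kappa> k. 0 < \<kappa> \<and> \<kappa> \<le> 1 \<and>
        k \<in> borel_measurable borel \<and> (\<forall>x. 0 \<le> k x) \<and>
        (\<integral>\<^sup>+\<omega>. ennreal (k (X 1 1 \<omega>) powr (1 + \<eta> / 2)) \<partial>M) < \<infinity> \<and>
        (\<forall>x. \<forall>a1\<in>\<Theta>. \<forall>a2\<in>\<Theta>.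
          \<nu> (outer (score \<rho> x a2) (score \<rho> x a2) - outer (score \<rho> x a1) (score \<rho> x a1))
            \<le> k x * norm (a2 - a1) powr \<kappa>))
      \<longrightarrow> tendsto_in_prob M (\<lambda>n \<omega>. B_hat m X \<rho> w n (est n \<omega>) \<omega>) (c\<^sub>w *\<^sub>R score_cov M X \<rho> \<theta>))
   \<and> ((SUP a\<in>\<Theta>. \<integral>\<^sup>+\<omega>. ennreal (norm (score \<rho> (X 1 1 \<omega>) a) powr (2 + \<eta>)) \<partial>M) < \<infinity> \<and>
      (\<exists>\<kappa> k k\<^sub>w. 0 < \<kappa> \<and> \<kappa> \<le> 1 \<and>
        (\<lambda>(x, y). k x y) \<in> borel_measurable (borel \<Otimes>\<^sub>M borel) \<and> (\<forall>x y. 0 \<le> k x y) \<and>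
        (\<forall>x y. \<forall>a1\<in>\<Theta>. \<forall>a2\<in>\<Theta>.
          \<nu> (outer (score \<rho> x a2) (score \<rho> y a2) - outer (score \<rho> x a1) (score \<rho> y a1))
            \<le> k x y * norm (a2 - a1) powr \<kappa>) \<and>
        (\<forall>i\<ge>1. 2 \<le> m i \<longrightarrow>
          (\<integral>\<^sup>+\<omega>. ennreal (k (X i 1 \<omega>) (X i 2 \<omega>) powr (1 + \<eta> / 2)) \<partial>M) < \<infinity>) \<and>
        (\<lambda>n. 1 / sample_size m n *
          (\<Sum>i=1..n. \<Sum>j=1..m i. \<Sum>j'\<in>{1..m i} - {j}.
            w i j * w i j' * (\<integral>\<omega>. k (X i j \<omega>) (X i j' \<omega>) \<partial>M))) \<longlonglongrightarrow> k\<^sub>w)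
      \<longrightarrow> tendsto_in_prob M (\<lambda>n \<omega>. C_hat m X \<rho> w n (est n \<omega>) \<omega>) C)
   \<and> ((SUP a\<in>\<Theta>. \<integral>\<^sup>+\<omega>. ennreal (\<nu> (score_deriv \<rho> (X 1 1 \<omega>) a) powr (1 + \<delta>)) \<partial>M) < \<infinity>
      \<longrightarrow> tendsto_in_prob M (\<lambda>n \<omega>. V_hat m X \<rho> w n (est n \<omega>) \<omega>) (mean_score_deriv M X \<rho> \<theta>))"
proof -
  interpret clustered_M_estimation M m X l \<Theta> \<theta> \<rho> w est by (rule framework)
  obtain L where L: "0 < L" and norm_le: "\<And>A. norm A \<le> L * \<nu> A"
    using matrix_norm_dominates_norm[OF matrix_norm] by blast
  have w_nonneg: "0 \<le> w i j" if "1 \<le> i" "j \<in> {1..m i}" for i j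
    using weights_pos[OF that] by simp
  have a2': "(\<lambda>n. \<Sum>i=1..n. (\<Sum>j=1..m i. (w i j)\<^sup>2) / sample_size m n) \<longlonglongrightarrow> c\<^sub>w"
    using a2 by (simp add: sum_divide_distrib)
  have V: "tendsto_in_prob M (\<lambda>n \<omega>. V_hat m X \<rho> w n (est n \<omega>) \<omega>) (mean_score_deriv M X \<rho> \<theta>)"
  proof -
    obtain \<kappa> k where \<kappa>: "0 < \<kappa>" and k: "k \<in> borel_measurable borel" "\<And>x. 0 \<le> k x"
      and holder: "\<And>x a1 a2. a1 \<in> \<Theta> \<Longrightarrow> a2 \<in> \<Theta> \<Longrightarrow>
        \<nu> (score_deriv \<rho> x a2 - score_deriv \<rho> x a1) \<le> k x * norm (a2 - a1) powr \<kappa>"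
      and k_moment: "(\<integral>\<^sup>+\<omega>. ennreal (k (X 1 1 \<omega>) powr (1 + \<delta>)) \<partial>M) < \<infinity>"
      using d2 by blast
    have norm_holder: "norm (score_deriv \<rho> x a2 - score_deriv \<rho> x a1) \<le> L * k x * norm (a2 - a1) powr \<kappa>"
      if "a1 \<in> \<Theta>" "a2 \<in> \<Theta>" for x a1 a2
      using order_trans[OF norm_le mult_left_mono[OF holder[OF that, of x]]] L by (simp add: mult.assoc)
    have kX: "(\<lambda>\<omega>. k (X 1 1 \<omega>)) \<in> borel_measurable M"
      by (rule measurable_compose[OF random_variable_X1(1) k(1)])
    have "tendsto_in_prob M (\<lambda>n \<omega>. (1 / sample_size m n) *\<^sub>R
        (\<Sum>i=1..n. \<Sum>j=1..m i. w i j *\<^sub>R score_deriv \<rho> (X i j \<omega>) (est n \<omega>)))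
      (1 *\<^sub>R expectation (\<lambda>\<omega>. score_deriv \<rho> (X 1 1 \<omega>) \<theta>))"
    proof (rule plug_in_weighted_average[OF consistent w_nonneg a1 _ d3 score_deriv_measurable _ _ \<kappa>])
      show "continuous_on \<Theta> (score_deriv \<rho> x)" for x
        by (rule continuous_on_if_holder[OF \<kappa> norm_holder])
      show "(\<integral>\<^sup>+\<omega>. ennreal (norm (score_deriv \<rho> (X 1 1 \<omega>) \<theta>) powr (1 + \<delta>)) \<partial>M) < \<infinity>"
      proof (rule nn_integral_powr_finite_mono[OF _ norm_ge_zero norm_le L _ d1(2)])
        show "(\<lambda>\<omega>. norm (score_deriv \<rho> (X 1 1 \<omega>) \<theta>)) \<in> borel_measurable M"
          by (rule measurable_compose[OF measurable_compose[OF random_variable_X1(1)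
                score_deriv_measurable[OF parameter_in]] borel_measurable_norm])
      qed (use d1 in simp)
      show "(\<lambda>x. L * k x) \<in> borel_measurable borel" using k(1) by simp
      show "integrable M (\<lambda>\<omega>. L * k (X 1 1 \<omega>))"
        using integrable_if_powr(2)[OF kX k(2) _ k_moment] d1(1) by simp
      show "norm (score_deriv \<rho> x a - score_deriv \<rho> x \<theta>) \<le> L * k x * norm (a - \<theta>) powr \<kappa>" if "a \<in> \<Theta>" for x a
        by (rule norm_holder[OF parameter_in that])
    qed (use d1 k L in auto)
    then have "tendsto_in_prob M (\<lambda>n \<omega>. (1 / sample_size m n) *\<^sub>R
        (\<Sum>i=1..n. \<Sum>j=1..m i. w i j *\<^sub>R score_deriv \<rho> (X i j \<omega>) (est n \<omega>))) (mean_score_deriv M X \<rho> \<theta>)"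
      by (simp add: mean_score_deriv_def)
    then show ?thesis
    proof (rule tendsto_in_prob_cong[THEN iffD1, rotated])
      fix n :: nat and \<omega> assume "1 \<le> n" "\<omega> \<in> space M"
      then show "(1 / sample_size m n) *\<^sub>R (\<Sum>i=1..n. \<Sum>j=1..m i. w i j *\<^sub>R score_deriv \<rho> (X i j \<omega>) (est n \<omega>)) =
          V_hat m X \<rho> w n (est n \<omega>) \<omega>"
        by (simp add: V_hat_def transpose_score_deriv estimator_in)
    qed
  qed
  have B: "tendsto_in_prob M (\<lambda>n \<omega>. B_hat m X \<rho> w n (est n \<omega>) \<omega>) (c\<^sub>w *\<^sub>R score_cov M X \<rho> \<theta>)"
    if \<kappa>: "0 < \<kappa>" and k: "k \<in> borel_measurable borel" "\<And>x. 0 \<le> k x"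
      and k_moment: "(\<integral>\<^sup>+\<omega>. ennreal (k (X 1 1 \<omega>) powr (1 + \<eta> / 2)) \<partial>M) < \<infinity>"
      and holder: "\<And>x a1 a2. a1 \<in> \<Theta> \<Longrightarrow> a2 \<in> \<Theta> \<Longrightarrow>
        \<nu> (outer (score \<rho> x a2) (score \<rho> x a2) - outer (score \<rho> x a1) (score \<rho> x a1)) \<le> k x * norm (a2 - a1) powr \<kappa>"
    for \<kappa> k
  proof -
    have kX: "(\<lambda>\<omega>. k (X 1 1 \<omega>)) \<in> borel_measurable M"
      by (rule measurable_compose[OF random_variable_X1(1) k(1)])
    show ?thesis
      unfolding B_hat_def score_cov_def
    proof (rule plug_in_weighted_average[OF consistent _ a2' _ e1 _ _ _ \<kappa>, where F="\<lambda>x a. outer (score \<rho> x a) (score \<rho> x a)"])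
      show "(\<lambda>x. outer (score \<rho> x a) (score \<rho> x a)) \<in> borel_measurable borel" if "a \<in> \<Theta>" for a
        by (intro borel_measurable_outer score_measurable that)
      show "continuous_on \<Theta> (\<lambda>a. outer (score \<rho> x a) (score \<rho> x a))" for x
        by (intro continuous_on_outer continuous_on_score)
      show "(\<integral>\<^sup>+\<omega>. ennreal (norm (outer (score \<rho> (X 1 1 \<omega>) \<theta>) (score \<rho> (X 1 1 \<omega>) \<theta>)) powr (1 + \<eta> / 2)) \<partial>M) < \<infinity>"
        using c1(2) by (simp only: norm_outer_self_powr)
      show "(\<lambda>x. L * k x) \<in> borel_measurable borel" using k(1) by simp
      show "integrable M (\<lambda>\<omega>. L * k (X 1 1 \<omega>))"
        using integrable_if_powr(2)[OF kX k(2) _ k_moment] c1(1) by simp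
      show "norm (outer (score \<rho> x a) (score \<rho> x a) - outer (score \<rho> x \<theta>) (score \<rho> x \<theta>)) \<le>
          L * k x * norm (a - \<theta>) powr \<kappa>" if "a \<in> \<Theta>" for x a
        using order_trans[OF norm_le mult_left_mono[OF holder[OF parameter_in that, of x]]] L
        by (simp add: mult.assoc)
    qed (use c1 k L in auto)
  qed
  have C: "tendsto_in_prob M (\<lambda>n \<omega>. C_hat m X \<rho> w n (est n \<omega>) \<omega>) C"
    if \<kappa>: "0 < \<kappa>" and k: "(\<lambda>(x, y). k x y) \<in> borel_measurable (borel \<Otimes>\<^sub>M borel)" "\<And>x y. 0 \<le> k x y"
      and holder: "\<And>x y a1 a2. a1 \<in> \<Theta> \<Longrightarrow> a2 \<in> \<Theta> \<Longrightarrow>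
        \<nu> (outer (score \<rho> x a2) (score \<rho> y a2) - outer (score \<rho> x a1) (score \<rho> y a1)) \<le> k x y * norm (a2 - a1) powr \<kappa>"
      and k_moment: "\<And>i. 1 \<le> i \<Longrightarrow> 2 \<le> m i \<Longrightarrow>
        (\<integral>\<^sup>+\<omega>. ennreal (k (X i 1 \<omega>) (X i 2 \<omega>) powr (1 + \<eta> / 2)) \<partial>M) < \<infinity>"
      and k_limit: "(\<lambda>n. 1 / sample_size m n * (\<Sum>i=1..n. \<Sum>j=1..m i. \<Sum>j'\<in>{1..m i} - {j}.
            w i j * w i j' * (\<integral>\<omega>. k (X i j \<omega>) (X i j' \<omega>) \<partial>M))) \<longlonglongrightarrow> k\<^sub>w"
    for \<kappa> k k\<^sub>w
  proof (rule C_hat_plug_in[OF consistent C_hat_parameter_law[OF a2' b c1 c2 e1] \<kappa>, where k="\<lambda>x y. L * k x y"])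
    show "(\<lambda>(x, y). L * k x y) \<in> borel_measurable (borel \<Otimes>\<^sub>M borel)"
      using borel_measurable_times[OF borel_measurable_const[of L] k(1)] by (simp add: case_prod_beta')
    show "norm (outer (score \<rho> x a) (score \<rho> y a) - outer (score \<rho> x \<theta>) (score \<rho> y \<theta>)) \<le>
        L * k x y * norm (a - \<theta>) powr \<kappa>" if "a \<in> \<Theta>" for x y a
      using order_trans[OF norm_le mult_left_mono[OF holder[OF parameter_in that, of x y]]] L
      by (simp add: mult.assoc)
    show "integrable M (\<lambda>\<omega>. L * k (X i 1 \<omega>) (X i 2 \<omega>))" if i: "1 \<le> i" "2 \<le> m i" for i
    proof -
      have "(\<lambda>\<omega>. (X i 1 \<omega>, X i 2 \<omega>)) \<in> M \<rightarrow>\<^sub>M borel \<Otimes>\<^sub>M borel"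
        using i by (intro measurable_Pair random_variable_X) auto
      from measurable_compose[OF this k(1)]
      have "(\<lambda>\<omega>. k (X i 1 \<omega>) (X i 2 \<omega>)) \<in> borel_measurable M" by simp
      from integrable_if_powr(2)[OF this k(2) _ k_moment[OF i]] show ?thesis using c1(1) by simp
    qed
    have "(\<lambda>n. L * (1 / sample_size m n * (\<Sum>i=1..n. \<Sum>j=1..m i. \<Sum>j'\<in>{1..m i} - {j}.
            w i j * w i j' * (\<integral>\<omega>. k (X i j \<omega>) (X i j' \<omega>) \<partial>M)))) \<longlonglongrightarrow> L * k\<^sub>w"
      by (intro tendsto_mult tendsto_const k_limit)
    then show "(\<lambda>n. 1 / sample_size m n * (\<Sum>i=1..n. \<Sum>j=1..m i. \<Sum>j'\<in>{1..m i} - {j}.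
            w i j * w i j' * (\<integral>\<omega>. L * k (X i j \<omega>) (X i j' \<omega>) \<partial>M))) \<longlonglongrightarrow> L * k\<^sub>w"
      by (simp add: sum_distrib_left mult_ac)
  qed (use k L in auto)
  show ?thesis
  proof (intro conjI impI)
    assume "(SUP a\<in>\<Theta>. \<integral>\<^sup>+\<omega>. ennreal (norm (score \<rho> (X 1 1 \<omega>) a) powr (2 + \<eta>)) \<partial>M) < \<infinity> \<and>
      (\<exists>\<kappa> k. 0 < \<kappa> \<and> \<kappa> \<le> 1 \<and>
        k \<in> borel_measurable borel \<and> (\<forall>x. 0 \<le> k x) \<and>
        (\<integral>\<^sup>+\<omega>. ennreal (k (X 1 1 \<omega>) powr (1 + \<eta> / 2)) \<partial>M) < \<infinity> \<and>
        (\<forall>x. \<forall>a1\<in>\<Theta>. \<forall>a2\<in>\<Theta>.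
          \<nu> (outer (score \<rho> x a2) (score \<rho> x a2) - outer (score \<rho> x a1) (score \<rho> x a1))
            \<le> k x * norm (a2 - a1) powr \<kappa>))"
    then obtain \<kappa> k where "0 < \<kappa>" "k \<in> borel_measurable borel" "\<forall>x. 0 \<le> k x"
      "(\<integral>\<^sup>+\<omega>. ennreal (k (X 1 1 \<omega>) powr (1 + \<eta> / 2)) \<partial>M) < \<infinity>"
      "\<forall>x. \<forall>a1\<in>\<Theta>. \<forall>a2\<in>\<Theta>.
          \<nu> (outer (score \<rho> x a2) (score \<rho> x a2) - outer (score \<rho> x a1) (score \<rho> x a1))
            \<le> k x * norm (a2 - a1) powr \<kappa>"
      by (elim conjE exE) blast
    then show "tendsto_in_prob M (\<lambda>n \<omega>. B_hat m X \<rho> w n (est n \<omega>) \<omega>) (c\<^sub>w *\<^sub>R score_cov M X \<rho> \<theta>)"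
      by (intro B[of \<kappa> k]) blast+
  next
    assume "(SUP a\<in>\<Theta>. \<integral>\<^sup>+\<omega>. ennreal (norm (score \<rho> (X 1 1 \<omega>) a) powr (2 + \<eta>)) \<partial>M) < \<infinity> \<and>
      (\<exists>\<kappa> k k\<^sub>w. 0 < \<kappa> \<and> \<kappa> \<le> 1 \<and>
        (\<lambda>(x, y). k x y) \<in> borel_measurable (borel \<Otimes>\<^sub>M borel) \<and> (\<forall>x y. 0 \<le> k x y) \<and>
        (\<forall>x y. \<forall>a1\<in>\<Theta>. \<forall>a2\<in>\<Theta>.
          \<nu> (outer (score \<rho> x a2) (score \<rho> y a2) - outer (score \<rho> x a1) (score \<rho> y a1))
            \<le> k x y * norm (a2 - a1) powr \<kappa>) \<and>
        (\<forall>i\<ge>1. 2 \<le> m i \<longrightarrow>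
          (\<integral>\<^sup>+\<omega>. ennreal (k (X i 1 \<omega>) (X i 2 \<omega>) powr (1 + \<eta> / 2)) \<partial>M) < \<infinity>) \<and>
        (\<lambda>n. 1 / sample_size m n *
          (\<Sum>i=1..n. \<Sum>j=1..m i. \<Sum>j'\<in>{1..m i} - {j}.
            w i j * w i j' * (\<integral>\<omega>. k (X i j \<omega>) (X i j' \<omega>) \<partial>M))) \<longlonglongrightarrow> k\<^sub>w)"
    then obtain \<kappa> k k\<^sub>w where "0 < \<kappa>" "(\<lambda>(x, y). k x y) \<in> borel_measurable (borel \<Otimes>\<^sub>M borel)"
      "\<forall>x y. 0 \<le> k x y"
      "\<forall>x y. \<forall>a1\<in>\<Theta>. \<forall>a2\<in>\<Theta>.
          \<nu> (outer (score \<rho> x a2) (score \<rho> y a2) - outer (score \<rho> x a1) (score \<rho> y a1))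
            \<le> k x y * norm (a2 - a1) powr \<kappa>"
      "\<forall>i\<ge>1. 2 \<le> m i \<longrightarrow> (\<integral>\<^sup>+\<omega>. ennreal (k (X i 1 \<omega>) (X i 2 \<omega>) powr (1 + \<eta> / 2)) \<partial>M) < \<infinity>"
      "(\<lambda>n. 1 / sample_size m n *
          (\<Sum>i=1..n. \<Sum>j=1..m i. \<Sum>j'\<in>{1..m i} - {j}.
            w i j * w i j' * (\<integral>\<omega>. k (X i j \<omega>) (X i j' \<omega>) \<partial>M))) \<longlonglongrightarrow> k\<^sub>w"
      by (elim conjE exE) blast
    then show "tendsto_in_prob M (\<lambda>n \<omega>. C_hat m X \<rho> w n (est n \<omega>) \<omega>) C"
      by (intro C[of \<kappa> k k\<^sub>w]) blast+
  qed (rule V)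
qed

end
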